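(* Let $(H,\alpha)$ be a monoidal Hom-Hopf algebra over a commutative ring $k$ and let $(A,\beta)$ be a right $(H,\alpha)$-Hom-comodule algebra with coaction $\rho_A$. Let $F:\widetilde{\mathscr{H}}(\mathscr{M}_k)^{H}_{A}\to\widetilde{\mathscr{H}}(\mathscr{M}_k)_{A}$ and $\widetilde F:\widetilde{\mathscr{H}}(\mathscr{M}_k)^{H}_{A}\to\widetilde{\mathscr{H}}(\mathscr{M}_k)^{H}$ be the forgetful functors, and let $G:\widetilde{\mathscr{H}}(\mathscr{M}_k)_{A}\to\widetilde{\mathscr{H}}(\mathscr{M}_k)^{H}_{A}$, $G(M)=M\otimes H$, be the right adjoint of $F$ (described in the context). The following statements are equivalent: (1) there exists a total integral $\phi:(H,\alpha)\to(A,\beta)$; (2) the natural transformation $\rho:\widetilde F\circ 1_{\widetilde{\mathscr{H}}(\mathscr{M}_k)^{H}_{A}}\to\widetilde F\circ G\circ F$, with components the coactions $\rho_M:M\to M\otimes H$, splits, i.e. there is a natural transformation $\lambda:\widetilde F\circ G\circ F\to\widetilde F$ with $\lambda_M\circ\rho_M=\mathrm{id}_M$ for every $(M,\mu)\in\widetilde{\mathscr{H}}(\mathscr{M}_k)^{H}_{A}$; (3) $\rho_A:A\to A\otimes H$ splits in $\widetilde{\mathscr{H}}(\mathscr{M}_k)^{H}$, i.e. there is a morphism $\lambda_A:A\otimes H\to A$ in $\widetilde{\mathscr{H}}(\mathscr{M}_k)^{H}$ with $\lambda_A\circ\rho_A=\mathrm{id}_A$, where $A\otimes H=G(A)$ has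 coaction $a\otimes h\mapsto(\beta^{-1}(a)\otimes h_{(1)})\otimes\alpha(h_{(2)})$. Consequently, if one of these equivalent conditions holds, then every relative Hom-Hopf module $(M,\mu)\in\widetilde{\mathscr{H}}(\mathscr{M}_k)^{H}_{A}$ is injective as a right $(H,\alpha)$-Hom-comodule.
   Context: Conventions. $k$ is a commutative ring, $\otimes=\otimes_k$. $\widetilde{\mathscr{H}}(\mathscr{M}_k)$ is the category with objects pairs $(M,\mu)$, $M$ a $k$-module and $\mu$ a $k$-linear automorphism of $M$; a morphism $f:(M,\mu)\to(N,\nu)$ is a $k$-linear map with $\nu f=f\mu$; $(M,\mu)\otimes(N,\nu)=(M\otimes N,\mu\otimes\nu)$. Monoidal Hom-algebra $(A,\alpha)$: an object of $\widetilde{\mathscr{H}}(\mathscr{M}_k)$ with a $k$-linear multiplication and $1_A\in A$ such that $\alpha(ab)=\alpha(a)\alpha(b)$, $\alpha(1_A)=1_A$, $\alpha(a)(bc)=(ab)\alpha(c)$, $a1_A=1_Aa=\alpha(a)$. Monoidal Hom-coalgebra $(C,\gamma)$: an object of $\widetilde{\mathscr{H}}(\mathscr{M}_k)$ with $k$-linear maps $\Delta:C\to C\otimes C$, $\Delta(c)=c_{(1)}\otimes c_{(2)}$, and $\varepsilon:C\to k$ such that $\Delta(\gamma(c))=\gamma(c_{(1)})\otimes\gamma(c_{(2)})$, $\varepsilon\gamma=\varepsilon$, $\gamma^{-1}(c_{(1)})\otimes c_{(2)(1)}\otimes c_{(2)(2)}=c_{(1)(1)}\otimes c_{(1)(2)}\otimes\gamma^{-1}(c_{(2)})$,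 $\varepsilon(c_{(1)})c_{(2)}=\varepsilon(c_{(2)})c_{(1)}=\gamma^{-1}(c)$. Monoidal Hom-Hopf algebra $(H,\alpha)$: $(H,\alpha)$ is both a monoidal Hom-algebra and a monoidal Hom-coalgebra, $\Delta(ab)=a_{(1)}b_{(1)}\otimes a_{(2)}b_{(2)}$, $\Delta(1_H)=1_H\otimes1_H$, $\varepsilon(ab)=\varepsilon(a)\varepsilon(b)$, $\varepsilon(1_H)=1$, and there is a $k$-linear $S:H\to H$ with $S\alpha=\alpha S$ and $S(h_{(1)})h_{(2)}=h_{(1)}S(h_{(2)})=\varepsilon(h)1_H$. Right $(A,\beta)$-Hom-module $(M,\mu)$: an object of $\widetilde{\mathscr{H}}(\mathscr{M}_k)$ with $k$-linear action $M\otimes A\to M$ such that $\mu(m\cdot a)=\mu(m)\cdot\beta(a)$, $(m\cdot a)\cdot\beta(b)=\mu(m)\cdot(ab)$, $m\cdot1_A=\mu(m)$. Category (with $A$-linear morphisms of $\widetilde{\mathscr{H}}(\mathscr{M}_k)$): $\widetilde{\mathscr{H}}(\mathscr{M}_k)_A$. Right $(H,\alpha)$-Hom-comodule $(M,\mu)$: an object of $\widetilde{\mathscr{H}}(\mathscr{M}_k)$ with $k$-linear $\rho_M:M\to M\otimes H$, $\rho_M(m)=m_{[0]}\otimes m_{[1]}$, such that $\rho_M(\mu(m))=\mu(m_{[0]})\otimes\alpha(m_{[1]})$, $m_{[0][0]}\otimes m_{[0][1]}\otimes\alpha^{-1}(m_{[1]})=\mu^{-1}(m_{[0]})\otimes\Delta(m_{[1]})$,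 $m_{[0]}\varepsilon(m_{[1]})=\mu^{-1}(m)$. Category (with colinear morphisms of $\widetilde{\mathscr{H}}(\mathscr{M}_k)$): $\widetilde{\mathscr{H}}(\mathscr{M}_k)^H$. Right $(H,\alpha)$-Hom-comodule algebra $(A,\beta)$: a monoidal Hom-algebra that is a right $(H,\alpha)$-Hom-comodule with $\rho_A(ab)=a_{[0]}b_{[0]}\otimes a_{[1]}b_{[1]}$, $\rho_A(1_A)=1_A\otimes1_H$. Relative Hom-Hopf module: $(M,\mu)$ which is both a right $(A,\beta)$-Hom-module and a right $(H,\alpha)$-Hom-comodule with $\rho_M(m\cdot a)=m_{[0]}\cdot a_{[0]}\otimes m_{[1]}a_{[1]}$. The category (morphisms are both $A$-linear and $H$-colinear) is $\widetilde{\mathscr{H}}(\mathscr{M}_k)^H_A$. Functor $G$: for $(M,\mu)\in\widetilde{\mathscr{H}}(\mathscr{M}_k)_A$, $G(M)=M\otimes H$ with $(m\otimes h)\cdot a=m\cdot a_{[0]}\otimes ha_{[1]}$ and $\rho(m\otimes h)=(\mu^{-1}(m)\otimes h_{(1)})\otimes\alpha(h_{(2)})$; $G(f)=f\otimes\mathrm{id}_H$. The unit of the adjunction $(F,G)$ at $M$ is $\rho_M$. Total integral: a $k$-linear map $\phi:(H,\alpha)\to(A,\beta)$ with $\rho_A\phi=(\phi\otimes\mathrm{id}_H)\Delta_H$, $\phi\alpha=\beta\phi$, $\phi(1_H)=1_A$.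
   Formalization: "Injective as a right Hom-comodule" is taken as relatively injective: colinear maps extend along colinear maps having a left inverse that is k-linear and commutes with the automorphisms; absolute injectivity fails already for H = A = k (Jordan block extension of (k, id)). *)

theory Defs
  imports "HOL-Algebra.Module" "HOL-Algebra.AbelCoset"
begin

section \<open>Linear and bilinear maps\<close>

definition linear_map ::
  "('k, 'r) ring_scheme \<Rightarrow> ('k, 'm, 's) module_scheme \<Rightarrow> ('k, 'n, 't) module_scheme
    \<Rightarrow> ('m \<Rightarrow> 'n) \<Rightarrow> bool"
  where "linear_map K M N f \<longleftrightarrow>
    f \<in> carrier M \<rightarrow> carrier N \<and>
    (\<forall>x\<in>carrier M. \<forall>y\<in>carrier M. f (x \<oplus>\<^bsub>M\<^esub> y) = f x \<oplus>\<^bsub>N\<^esub> f y) \<and>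
    (\<forall>c\<in>carrier K. \<forall>x\<in>carrier M. f (c \<odot>\<^bsub>M\<^esub> x) = c \<odot>\<^bsub>N\<^esub> f x)"

definition bilinear_map ::
  "('k, 'r) ring_scheme \<Rightarrow> ('k, 'm, 's) module_scheme \<Rightarrow> ('k, 'n, 't) module_scheme
    \<Rightarrow> ('k, 'p, 'u) module_scheme \<Rightarrow> ('m \<Rightarrow> 'n \<Rightarrow> 'p) \<Rightarrow> bool"
  where "bilinear_map K M N P b \<longleftrightarrow>
    (\<forall>x\<in>carrier M. linear_map K N P (b x)) \<and>
    (\<forall>y\<in>carrier N. linear_map K M P (\<lambda>x. b x y))"

definition base_module :: "('k, 'r) ring_scheme \<Rightarrow> ('k, 'k) module"
  where "base_module K =
    \<lparr>carrier = carrier K, mult = mult K, one = one K, zero = zero K, add = add K, smult = mult K\<rparr>"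


section \<open>Tensor products over a commutative ring\<close>

text \<open>
  The tensor product of \<open>M\<close> and \<open>N\<close> is the free module on \<open>carrier M \<times> carrier N\<close>, that is, the
  finitely supported \<open>K\<close>-valued functions, modulo the submodule generated by the bilinearity
  relations. Its elements are cosets of that submodule. As usual for the record type
  \<^typ>\<open>('k, 'm) module\<close>, the fields \<open>mult\<close> and \<open>one\<close> carry no information here.
\<close>

type_synonym ('k, 'm, 'n) tensor = "('m \<times> 'n \<Rightarrow> 'k) set"

definition free_module :: "('k, 'r) ring_scheme \<Rightarrow> 'x set \<Rightarrow> ('k, 'x \<Rightarrow> 'k) module"
  where "free_module K X =
    \<lparr>carrier = {f. range f \<subseteq> carrier K \<and> {x. f x \<noteq> \<zero>\<^bsub>K\<^esub>} \<subseteq> X \<and> finite {x. f x \<noteq> \<zero>\<^bsub>K\<^esub>}},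
     mult = undefined,
     one = undefined,
     zero = (\<lambda>_. \<zero>\<^bsub>K\<^esub>),
     add = (\<lambda>f g x. f x \<oplus>\<^bsub>K\<^esub> g x),
     smult = (\<lambda>c f x. c \<otimes>\<^bsub>K\<^esub> f x)\<rparr>"

definition free_gen :: "('k, 'r) ring_scheme \<Rightarrow> 'x \<Rightarrow> 'x \<Rightarrow> 'k"
  where "free_gen K x = (\<lambda>y. if y = x then \<one>\<^bsub>K\<^esub> else \<zero>\<^bsub>K\<^esub>)"

abbreviation pairs_module ::
  "('k, 'r) ring_scheme \<Rightarrow> ('k, 'm, 's) module_scheme \<Rightarrow> ('k, 'n, 't) module_scheme
    \<Rightarrow> ('k, 'm \<times> 'n \<Rightarrow> 'k) module"
  where "pairs_module K M N \<equiv> free_module K (carrier M \<times> carrier N)"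

definition bilinear_relators ::
  "('k, 'r) ring_scheme \<Rightarrow> ('k, 'm, 's) module_scheme \<Rightarrow> ('k, 'n, 't) module_scheme
    \<Rightarrow> ('m \<times> 'n \<Rightarrow> 'k) set"
  where "bilinear_relators K M N =
    (let F = pairs_module K M N; e = (\<lambda>x y. free_gen K (x, y)) in
      {e (x \<oplus>\<^bsub>M\<^esub> x') y \<ominus>\<^bsub>F\<^esub> (e x y \<oplus>\<^bsub>F\<^esub> e x' y) | x x' y.
          x \<in> carrier M \<and> x' \<in> carrier M \<and> y \<in> carrier N} \<union>
      {e x (y \<oplus>\<^bsub>N\<^esub> y') \<ominus>\<^bsub>F\<^esub> (e x y \<oplus>\<^bsub>F\<^esub> e x y') | x y y'.
          x \<in> carrier M \<and> y \<in> carrier N \<and> y' \<in> carrier N} \<union>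
      {e (c \<odot>\<^bsub>M\<^esub> x) y \<ominus>\<^bsub>F\<^esub> (c \<odot>\<^bsub>F\<^esub> e x y) | c x y.
          c \<in> carrier K \<and> x \<in> carrier M \<and> y \<in> carrier N} \<union>
      {e x (c \<odot>\<^bsub>N\<^esub> y) \<ominus>\<^bsub>F\<^esub> (c \<odot>\<^bsub>F\<^esub> e x y) | c x y.
          c \<in> carrier K \<and> x \<in> carrier M \<and> y \<in> carrier N})"

definition tensor_relations ::
  "('k, 'r) ring_scheme \<Rightarrow> ('k, 'm, 's) module_scheme \<Rightarrow> ('k, 'n, 't) module_scheme
    \<Rightarrow> ('m \<times> 'n \<Rightarrow> 'k) set"
  where "tensor_relations K M N =
    \<Inter>{S. submodule S K (pairs_module K M N) \<and> bilinear_relators K M N \<subseteq> S}"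

definition tensor_module ::
  "('k, 'r) ring_scheme \<Rightarrow> ('k, 'm, 's) module_scheme \<Rightarrow> ('k, 'n, 't) module_scheme
    \<Rightarrow> ('k, ('k, 'm, 'n) tensor) module"
  where "tensor_module K M N =
    (let F = pairs_module K M N; R = tensor_relations K M N in
      \<lparr>carrier = a_rcosets\<^bsub>F\<^esub> R,
       mult = undefined,
       one = undefined,
       zero = R,
       add = set_add F,
       smult = (\<lambda>c T. \<Union>f\<in>T. R +>\<^bsub>F\<^esub> (c \<odot>\<^bsub>F\<^esub> f))\<rparr>)"

definition pure_tensor ::
  "('k, 'r) ring_scheme \<Rightarrow> ('k, 'm, 's) module_scheme \<Rightarrow> ('k, 'n, 't) module_scheme
    \<Rightarrow> 'm \<Rightarrow> 'n \<Rightarrow> ('k, 'm, 'n) tensor"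
  where "pure_tensor K M N x y = tensor_relations K M N +>\<^bsub>pairs_module K M N\<^esub> free_gen K (x, y)"

text \<open>
  For a bilinear map \<open>b\<close> from \<open>M\<close> and \<open>N\<close> to \<open>P\<close>, \<open>tensor_lift K P b\<close> is the induced linear map
  on the tensor product: it evaluates any representative \<open>f = \<Sum>\<^sub>i c\<^sub>i (x\<^sub>i, y\<^sub>i)\<close> of a tensor to
  \<open>\<Sum>\<^sub>i c\<^sub>i b(x\<^sub>i, y\<^sub>i)\<close>. The value does not depend on the representative exactly because \<open>b\<close> is
  bilinear. In Sweedler notation, \<open>tensor_lift K P b (\<Delta> c)\<close> is \<open>b(c\<^sub>1, c\<^sub>2)\<close>.
\<close>

definition tensor_lift ::
  "('k, 'r) ring_scheme \<Rightarrow> ('k, 'p, 'u) module_scheme \<Rightarrow> ('m \<Rightarrow> 'n \<Rightarrow> 'p)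
    \<Rightarrow> ('k, 'm, 'n) tensor \<Rightarrow> 'p"
  where "tensor_lift K P b t =
    (let f = (SOME f. f \<in> t) in
      finsum P (\<lambda>(x, y). f (x, y) \<odot>\<^bsub>P\<^esub> b x y) {z. f z \<noteq> \<zero>\<^bsub>K\<^esub>})"

text \<open>The map \<open>f \<otimes> g\<close>; \<open>P\<close> and \<open>Q\<close> are the codomains of \<open>f\<close> and \<open>g\<close>.\<close>

definition tensor_map ::
  "('k, 'r) ring_scheme \<Rightarrow> ('k, 'p, 's) module_scheme \<Rightarrow> ('k, 'q, 't) module_scheme
    \<Rightarrow> ('m \<Rightarrow> 'p) \<Rightarrow> ('n \<Rightarrow> 'q) \<Rightarrow> ('k, 'm, 'n) tensor \<Rightarrow> ('k, 'p, 'q) tensor"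
  where "tensor_map K P Q f g =
    tensor_lift K (tensor_module K P Q) (\<lambda>x y. pure_tensor K P Q (f x) (g y))"

text \<open>
  The componentwise product \<open>(x \<otimes> y)(x' \<otimes> y') = b(x, x') \<otimes> c(y, y')\<close>, where \<open>b\<close> and \<open>c\<close> are
  bilinear with values in \<open>P\<close> and \<open>Q\<close>.
\<close>

definition tensor_times ::
  "('k, 'r) ring_scheme \<Rightarrow> ('k, 'p, 's) module_scheme \<Rightarrow> ('k, 'q, 't) module_scheme
    \<Rightarrow> ('m \<Rightarrow> 'm1 \<Rightarrow> 'p) \<Rightarrow> ('n \<Rightarrow> 'n1 \<Rightarrow> 'q)
    \<Rightarrow> ('k, 'm, 'n) tensor \<Rightarrow> ('k, 'm1, 'n1) tensor \<Rightarrow> ('k, 'p, 'q) tensor"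
  where "tensor_times K P Q b c s t =
    tensor_lift K (tensor_module K P Q)
      (\<lambda>x y. tensor_lift K (tensor_module K P Q)
        (\<lambda>x' y'. pure_tensor K P Q (b x x') (c y y')) t) s"

text \<open>The canonical isomorphism \<open>(x \<otimes> y) \<otimes> z \<mapsto> x \<otimes> (y \<otimes> z)\<close>.\<close>

definition tensor_assoc ::
  "('k, 'r) ring_scheme \<Rightarrow> ('k, 'm, 's) module_scheme \<Rightarrow> ('k, 'n, 't) module_scheme
    \<Rightarrow> ('k, 'p, 'u) module_scheme
    \<Rightarrow> ('k, ('k, 'm, 'n) tensor, 'p) tensor \<Rightarrow> ('k, 'm, ('k, 'n, 'p) tensor) tensor"
  where "tensor_assoc K M N P =
    (let NP = tensor_module K N P; T = tensor_module K M NP in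
      tensor_lift K T
        (\<lambda>s z. tensor_lift K T (\<lambda>x y. pure_tensor K M NP x (pure_tensor K N P y z)) s))"


section \<open>The category of modules with an automorphism\<close>

record ('k, 'm) hom_object = "('k, 'm) module" +
  twist :: "'m \<Rightarrow> 'm"

locale hom_object = module K M
  for K :: "('k, 'r) ring_scheme" and M :: "('k, 'm, 's) hom_object_scheme" +
  assumes twist_linear: "linear_map K M M (twist M)"
    and twist_bij: "bij_betw (twist M) (carrier M) (carrier M)"

definition inv_twist :: "('k, 'm, 's) hom_object_scheme \<Rightarrow> 'm \<Rightarrow> 'm"
  where "inv_twist M = inv_into (carrier M) (twist M)"

definition hom_morphisms ::
  "('k, 'r) ring_scheme \<Rightarrow> ('k, 'm, 's) hom_object_scheme \<Rightarrow> ('k, 'n, 't) hom_object_scheme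
    \<Rightarrow> ('m \<Rightarrow> 'n) set"
  where "hom_morphisms K M N =
    {f. linear_map K M N f \<and> (\<forall>x\<in>carrier M. twist N (f x) = f (twist M x))}"

definition hom_tensor ::
  "('k, 'r) ring_scheme \<Rightarrow> ('k, 'm, 's) hom_object_scheme \<Rightarrow> ('k, 'n, 't) hom_object_scheme
    \<Rightarrow> ('k, ('k, 'm, 'n) tensor) hom_object"
  where "hom_tensor K M N =
    module.extend (tensor_module K M N)
      (hom_object.fields (tensor_map K M N (twist M) (twist N)))"


section \<open>Monoidal Hom-algebras, Hom-coalgebras and Hom-Hopf algebras\<close>

text \<open>
  The multiplication and unit of a Hom-algebra are the fields \<open>mult\<close> and \<open>one\<close> of the underlying
  record; they need not form a ring.
\<close>

locale monoidal_hom_algebra = hom_object K A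
  for K :: "('k, 'r) ring_scheme" and A :: "('k, 'a, 's) hom_object_scheme" +
  assumes mult_bilinear: "bilinear_map K A A A (mult A)"
    and unit_closed: "\<one>\<^bsub>A\<^esub> \<in> carrier A"
    and twist_mult: "\<lbrakk>a \<in> carrier A; b \<in> carrier A\<rbrakk> \<Longrightarrow>
      twist A (a \<otimes>\<^bsub>A\<^esub> b) = twist A a \<otimes>\<^bsub>A\<^esub> twist A b"
    and twist_unit: "twist A \<one>\<^bsub>A\<^esub> = \<one>\<^bsub>A\<^esub>"
    and hom_assoc: "\<lbrakk>a \<in> carrier A; b \<in> carrier A; c \<in> carrier A\<rbrakk> \<Longrightarrow>
      twist A a \<otimes>\<^bsub>A\<^esub> (b \<otimes>\<^bsub>A\<^esub> c) = (a \<otimes>\<^bsub>A\<^esub> b) \<otimes>\<^bsub>A\<^esub> twist A c"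
    and mult_unit: "a \<in> carrier A \<Longrightarrow> a \<otimes>\<^bsub>A\<^esub> \<one>\<^bsub>A\<^esub> = twist A a"
    and unit_mult: "a \<in> carrier A \<Longrightarrow> \<one>\<^bsub>A\<^esub> \<otimes>\<^bsub>A\<^esub> a = twist A a"

record ('k, 'h) hom_bialgebra = "('k, 'h) hom_object" +
  comult :: "'h \<Rightarrow> ('k, 'h, 'h) tensor"
  counit :: "'h \<Rightarrow> 'k"

locale monoidal_hom_coalgebra = hom_object K C
  for K :: "('k, 'r) ring_scheme" and C :: "('k, 'h, 's) hom_bialgebra_scheme" +
  assumes comult_linear: "linear_map K C (tensor_module K C C) (comult C)"
    and counit_linear: "linear_map K C (base_module K) (counit C)"
    and comult_twist: "c \<in> carrier C \<Longrightarrow>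
      comult C (twist C c) = tensor_map K C C (twist C) (twist C) (comult C c)"
    and counit_twist: "c \<in> carrier C \<Longrightarrow> counit C (twist C c) = counit C c"
    and hom_coassoc: "c \<in> carrier C \<Longrightarrow>
      tensor_map K C (tensor_module K C C) (inv_twist C) (comult C) (comult C c) =
      tensor_assoc K C C C
        (tensor_map K (tensor_module K C C) C (comult C) (inv_twist C) (comult C c))"
    and counit_left: "c \<in> carrier C \<Longrightarrow>
      tensor_lift K C (\<lambda>x y. counit C x \<odot>\<^bsub>C\<^esub> y) (comult C c) = inv_twist C c"
    and counit_right: "c \<in> carrier C \<Longrightarrow>
      tensor_lift K C (\<lambda>x y. counit C y \<odot>\<^bsub>C\<^esub> x) (comult C c) = inv_twist C c"

definition antipode ::
  "('k, 'r) ring_scheme \<Rightarrow> ('k, 'h, 's) hom_bialgebra_scheme \<Rightarrow> ('h \<Rightarrow> 'h) \<Rightarrow> bool"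
  where "antipode K H S \<longleftrightarrow>
    linear_map K H H S \<and>
    (\<forall>h\<in>carrier H. S (twist H h) = twist H (S h)) \<and>
    (\<forall>h\<in>carrier H. tensor_lift K H (\<lambda>x y. S x \<otimes>\<^bsub>H\<^esub> y) (comult H h) = counit H h \<odot>\<^bsub>H\<^esub> \<one>\<^bsub>H\<^esub>) \<and>
    (\<forall>h\<in>carrier H. tensor_lift K H (\<lambda>x y. x \<otimes>\<^bsub>H\<^esub> S y) (comult H h) = counit H h \<odot>\<^bsub>H\<^esub> \<one>\<^bsub>H\<^esub>)"

locale monoidal_hom_Hopf_algebra =
  monoidal_hom_algebra K H + monoidal_hom_coalgebra K H
  for K :: "('k, 'r) ring_scheme" and H :: "('k, 'h, 's) hom_bialgebra_scheme" +
  assumes comult_mult: "\<lbrakk>a \<in> carrier H; b \<in> carrier H\<rbrakk> \<Longrightarrow>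
      comult H (a \<otimes>\<^bsub>H\<^esub> b) =
      tensor_times K H H (mult H) (mult H) (comult H a) (comult H b)"
    and comult_unit: "comult H \<one>\<^bsub>H\<^esub> = pure_tensor K H H \<one>\<^bsub>H\<^esub> \<one>\<^bsub>H\<^esub>"
    and counit_mult: "\<lbrakk>a \<in> carrier H; b \<in> carrier H\<rbrakk> \<Longrightarrow>
      counit H (a \<otimes>\<^bsub>H\<^esub> b) = counit H a \<otimes>\<^bsub>K\<^esub> counit H b"
    and counit_unit: "counit H \<one>\<^bsub>H\<^esub> = \<one>\<^bsub>K\<^esub>"
    and antipode_exists: "\<exists>S. antipode K H S"


section \<open>Hom-modules, Hom-comodules and relative Hom-Hopf modules\<close>

text \<open>
  Objects of the three categories are tuples \<open>(M, act)\<close>, \<open>(M, \<rho>)\<close> and \<open>(M, act, \<rho>)\<close>.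
\<close>

type_synonym ('k, 'a, 'm) Hmod = "('k, 'm) hom_object \<times> ('m \<Rightarrow> 'a \<Rightarrow> 'm)"
type_synonym ('k, 'h, 'm) Hcomod = "('k, 'm) hom_object \<times> ('m \<Rightarrow> ('k, 'm, 'h) tensor)"
type_synonym ('k, 'a, 'h, 'm) Hrel =
  "('k, 'm) hom_object \<times> ('m \<Rightarrow> 'a \<Rightarrow> 'm) \<times> ('m \<Rightarrow> ('k, 'm, 'h) tensor)"

locale right_hom_module = hom_object K M
  for K :: "('k, 'r) ring_scheme" and A :: "('k, 'a, 's) hom_object_scheme"
    and M :: "('k, 'm, 't) hom_object_scheme" and act :: "'m \<Rightarrow> 'a \<Rightarrow> 'm" +
  assumes act_bilinear: "bilinear_map K M A M act"
    and act_twist: "\<lbrakk>m \<in> carrier M; a \<in> carrier A\<rbrakk> \<Longrightarrow>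
      twist M (act m a) = act (twist M m) (twist A a)"
    and act_assoc: "\<lbrakk>m \<in> carrier M; a \<in> carrier A; b \<in> carrier A\<rbrakk> \<Longrightarrow>
      act (act m a) (twist A b) = act (twist M m) (a \<otimes>\<^bsub>A\<^esub> b)"
    and act_unit: "m \<in> carrier M \<Longrightarrow> act m \<one>\<^bsub>A\<^esub> = twist M m"

locale right_hom_comodule = hom_object K M
  for K :: "('k, 'r) ring_scheme" and H :: "('k, 'h, 's) hom_bialgebra_scheme"
    and M :: "('k, 'm, 't) hom_object_scheme" and \<rho> :: "'m \<Rightarrow> ('k, 'm, 'h) tensor" +
  assumes coact_linear: "linear_map K M (tensor_module K M H) \<rho>"
    and coact_twist: "m \<in> carrier M \<Longrightarrow>
      \<rho> (twist M m) = tensor_map K M H (twist M) (twist H) (\<rho> m)"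
    and coact_coassoc: "m \<in> carrier M \<Longrightarrow>
      tensor_assoc K M H H
        (tensor_map K (tensor_module K M H) H \<rho> (inv_twist H) (\<rho> m)) =
      tensor_map K M (tensor_module K H H) (inv_twist M) (comult H) (\<rho> m)"
    and coact_counit: "m \<in> carrier M \<Longrightarrow>
      tensor_lift K M (\<lambda>x h. counit H h \<odot>\<^bsub>M\<^esub> x) (\<rho> m) = inv_twist M m"

locale right_hom_comodule_algebra =
  monoidal_hom_algebra K A + right_hom_comodule K H A \<rho>
  for K :: "('k, 'r) ring_scheme" and H :: "('k, 'h, 's) hom_bialgebra_scheme"
    and A :: "('k, 'a, 't) hom_object_scheme" and \<rho> :: "'a \<Rightarrow> ('k, 'a, 'h) tensor" +
  assumes coact_mult: "\<lbrakk>a \<in> carrier A; b \<in> carrier A\<rbrakk> \<Longrightarrow>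
      \<rho> (a \<otimes>\<^bsub>A\<^esub> b) = tensor_times K A H (mult A) (mult H) (\<rho> a) (\<rho> b)"
    and coact_unit: "\<rho> \<one>\<^bsub>A\<^esub> = pure_tensor K A H \<one>\<^bsub>A\<^esub> \<one>\<^bsub>H\<^esub>"

locale relative_hom_Hopf_module =
  right_hom_module K A M act + right_hom_comodule K H M \<rho>
  for K :: "('k, 'r) ring_scheme" and H :: "('k, 'h, 's) hom_bialgebra_scheme"
    and A :: "('k, 'a, 't) hom_object_scheme" and \<rho>A :: "'a \<Rightarrow> ('k, 'a, 'h) tensor"
    and M :: "('k, 'm, 'u) hom_object_scheme"
    and act :: "'m \<Rightarrow> 'a \<Rightarrow> 'm" and \<rho> :: "'m \<Rightarrow> ('k, 'm, 'h) tensor" +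
  assumes coact_act: "\<lbrakk>m \<in> carrier M; a \<in> carrier A\<rbrakk> \<Longrightarrow>
      \<rho> (act m a) = tensor_times K M H act (mult H) (\<rho> m) (\<rho>A a)"

definition comodules ::
  "('k, 'r) ring_scheme \<Rightarrow> ('k, 'h, 's) hom_bialgebra_scheme \<Rightarrow> ('k, 'h, 'm) Hcomod set"
  where "comodules K H = {(M, \<rho>). right_hom_comodule K H M \<rho>}"

definition relative_Hopf_modules ::
  "('k, 'r) ring_scheme \<Rightarrow> ('k, 'h, 's) hom_bialgebra_scheme \<Rightarrow> ('k, 'a, 't) hom_object_scheme
    \<Rightarrow> ('a \<Rightarrow> ('k, 'a, 'h) tensor) \<Rightarrow> ('k, 'a, 'h, 'm) Hrel set"
  where "relative_Hopf_modules K H A \<rho>A =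
    {(M, act, \<rho>). relative_hom_Hopf_module K H A \<rho>A M act \<rho>}"

fun module_morphisms ::
  "('k, 'r) ring_scheme \<Rightarrow> ('k, 'a, 's) hom_object_scheme
    \<Rightarrow> ('k, 'a, 'm) Hmod \<Rightarrow> ('k, 'a, 'n) Hmod \<Rightarrow> ('m \<Rightarrow> 'n) set"
  where "module_morphisms K A (M, act) (N, act') =
    {f \<in> hom_morphisms K M N. \<forall>m\<in>carrier M. \<forall>a\<in>carrier A. f (act m a) = act' (f m) a}"

fun comodule_morphisms ::
  "('k, 'r) ring_scheme \<Rightarrow> ('k, 'h, 's) hom_bialgebra_scheme
    \<Rightarrow> ('k, 'h, 'm) Hcomod \<Rightarrow> ('k, 'h, 'n) Hcomod \<Rightarrow> ('m \<Rightarrow> 'n) set"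
  where "comodule_morphisms K H (M, \<rho>) (N, \<rho>') =
    {f \<in> hom_morphisms K M N. \<forall>m\<in>carrier M. \<rho>' (f m) = tensor_map K N H f id (\<rho> m)}"


section \<open>The functors\<close>

fun forget_coaction :: "('k, 'a, 'h, 'm) Hrel \<Rightarrow> ('k, 'a, 'm) Hmod"
  where "forget_coaction (M, act, \<rho>) = (M, act)"

fun forget_action :: "('k, 'a, 'h, 'm) Hrel \<Rightarrow> ('k, 'h, 'm) Hcomod"
  where "forget_action (M, act, \<rho>) = (M, \<rho>)"

definition relative_Hopf_morphisms ::
  "('k, 'r) ring_scheme \<Rightarrow> ('k, 'h, 's) hom_bialgebra_scheme \<Rightarrow> ('k, 'a, 't) hom_object_scheme
    \<Rightarrow> ('k, 'a, 'h, 'm) Hrel \<Rightarrow> ('k, 'a, 'h, 'n) Hrel \<Rightarrow> ('m \<Rightarrow> 'n) set"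
  where "relative_Hopf_morphisms K H A X Y =
    module_morphisms K A (forget_coaction X) (forget_coaction Y) \<inter>
    comodule_morphisms K H (forget_action X) (forget_action Y)"

text \<open>
  The right adjoint of \<^const>\<open>forget_coaction\<close>, on objects and on the underlying map of a morphism.
  Both forgetful functors leave underlying maps unchanged.
\<close>

fun induced ::
  "('k, 'r) ring_scheme \<Rightarrow> ('k, 'h) hom_bialgebra \<Rightarrow> ('a \<Rightarrow> ('k, 'a, 'h) tensor)
    \<Rightarrow> ('k, 'a, 'm) Hmod \<Rightarrow> ('k, 'a, 'h, ('k, 'm, 'h) tensor) Hrel"
  where "induced K H \<rho>A (M, act) =
    (hom_tensor K M H,
     (\<lambda>t a. tensor_times K M H act (mult H) t (\<rho>A a)),
     tensor_lift K (tensor_module K (tensor_module K M H) H)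
       (\<lambda>m h. tensor_lift K (tensor_module K (tensor_module K M H) H)
         (\<lambda>h1 h2. pure_tensor K (tensor_module K M H) H
            (pure_tensor K M H (inv_twist M m) h1) (twist H h2))
         (comult H h)))"

definition induced_map ::
  "('k, 'r) ring_scheme \<Rightarrow> ('k, 'h, 's) hom_bialgebra_scheme \<Rightarrow> ('k, 'a, 'n) Hmod
    \<Rightarrow> ('m \<Rightarrow> 'n) \<Rightarrow> ('k, 'm, 'h) tensor \<Rightarrow> ('k, 'n, 'h) tensor"
  where "induced_map K H Y f = tensor_map K (fst Y) H f id"


section \<open>Total integrals, splittings and injectivity\<close>

definition total_integral ::
  "('k, 'r) ring_scheme \<Rightarrow> ('k, 'h, 's) hom_bialgebra_scheme \<Rightarrow> ('k, 'a, 't) hom_object_scheme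
    \<Rightarrow> ('a \<Rightarrow> ('k, 'a, 'h) tensor) \<Rightarrow> ('h \<Rightarrow> 'a) \<Rightarrow> bool"
  where "total_integral K H A \<rho>A \<phi> \<longleftrightarrow>
    linear_map K H A \<phi> \<and>
    (\<forall>h\<in>carrier H. \<rho>A (\<phi> h) = tensor_map K A H \<phi> id (comult H h)) \<and>
    (\<forall>h\<in>carrier H. \<phi> (twist H h) = twist A (\<phi> h)) \<and>
    \<phi> \<one>\<^bsub>H\<^esub> = \<one>\<^bsub>A\<^esub>"

text \<open>
  Naturality for a family of maps between two functors \<open>P\<close> and \<open>Q\<close> from relative Hom-Hopf modules to
  Hom-comodules. A functor is given by its object map and, as its action on a morphism \<open>X \<rightarrow> Y\<close>, by
  a map depending on \<open>Y\<close> and the underlying function.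
\<close>

definition natural_transformation ::
  "('k, 'r) ring_scheme \<Rightarrow> ('k, 'h, 's) hom_bialgebra_scheme \<Rightarrow> ('k, 'a, 't) hom_object_scheme
    \<Rightarrow> ('a \<Rightarrow> ('k, 'a, 'h) tensor)
    \<Rightarrow> (('k, 'a, 'h, 'm) Hrel \<Rightarrow> ('k, 'h, 'p) Hcomod)
    \<Rightarrow> (('k, 'a, 'h, 'm) Hrel \<Rightarrow> ('m \<Rightarrow> 'm) \<Rightarrow> 'p \<Rightarrow> 'p)
    \<Rightarrow> (('k, 'a, 'h, 'm) Hrel \<Rightarrow> ('k, 'h, 'q) Hcomod)
    \<Rightarrow> (('k, 'a, 'h, 'm) Hrel \<Rightarrow> ('m \<Rightarrow> 'm) \<Rightarrow> 'q \<Rightarrow> 'q)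
    \<Rightarrow> (('k, 'a, 'h, 'm) Hrel \<Rightarrow> 'p \<Rightarrow> 'q) \<Rightarrow> bool"
  where "natural_transformation K H A \<rho>A P Pmap Q Qmap \<eta> \<longleftrightarrow>
    (\<forall>X\<in>relative_Hopf_modules K H A \<rho>A. \<eta> X \<in> comodule_morphisms K H (P X) (Q X)) \<and>
    (\<forall>X\<in>relative_Hopf_modules K H A \<rho>A. \<forall>Y\<in>relative_Hopf_modules K H A \<rho>A.
      \<forall>f\<in>relative_Hopf_morphisms K H A X Y.
      \<forall>x\<in>carrier (fst (P X)). \<eta> Y (Pmap Y f x) = Qmap Y f (\<eta> X x))"

text \<open>
  A splitting of the natural transformation \<open>\<rho>\<close>, whose component at \<open>(M, act, \<rho>)\<close> is \<open>\<rho>\<close> itself.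
  The type \<open>'m\<close> is the universe of the modules under consideration.
\<close>

definition natural_coaction_retraction ::
  "('k, 'r) ring_scheme \<Rightarrow> ('k, 'h) hom_bialgebra \<Rightarrow> ('k, 'a, 't) hom_object_scheme
    \<Rightarrow> ('a \<Rightarrow> ('k, 'a, 'h) tensor)
    \<Rightarrow> (('k, 'a, 'h, 'm) Hrel \<Rightarrow> ('k, 'm, 'h) tensor \<Rightarrow> 'm) \<Rightarrow> bool"
  where "natural_coaction_retraction K H A \<rho>A l \<longleftrightarrow>
    natural_transformation K H A \<rho>A
      (\<lambda>X. forget_action (induced K H \<rho>A (forget_coaction X)))
      (\<lambda>Y f. induced_map K H (forget_coaction Y) f)
      forget_action
      (\<lambda>Y f. f)
      l \<and>
    (\<forall>(M, act, \<rho>)\<in>relative_Hopf_modules K H A \<rho>A. \<forall>m\<in>carrier M. l (M, act, \<rho>) (\<rho> m) = m)"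

definition naturally_split ::
  "'m itself \<Rightarrow> ('k, 'r) ring_scheme \<Rightarrow> ('k, 'h) hom_bialgebra \<Rightarrow> ('k, 'a, 't) hom_object_scheme
    \<Rightarrow> ('a \<Rightarrow> ('k, 'a, 'h) tensor) \<Rightarrow> bool"
  where "naturally_split (_ :: 'm itself) K H A \<rho>A \<longleftrightarrow>
    (\<exists>l :: ('k, 'a, 'h, 'm) Hrel \<Rightarrow> ('k, 'm, 'h) tensor \<Rightarrow> 'm.
      natural_coaction_retraction K H A \<rho>A l)"

definition coaction_split ::
  "('k, 'r) ring_scheme \<Rightarrow> ('k, 'h) hom_bialgebra \<Rightarrow> ('k, 'a) hom_object
    \<Rightarrow> ('a \<Rightarrow> ('k, 'a, 'h) tensor) \<Rightarrow> bool"
  where "coaction_split K H A \<rho>A \<longleftrightarrow>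
    (\<exists>l\<in>comodule_morphisms K H
          (forget_action (induced K H \<rho>A (A, mult A))) (A, \<rho>A).
      \<forall>a\<in>carrier A. l (\<rho>A a) = a)"

text \<open>
  Injectivity of a Hom-comodule is relative to the base category: colinear maps extend along those
  colinear maps that have a left inverse in the category of modules with an automorphism. Over a
  commutative ring this is the usual meaning of the term. Absolute injectivity is not available: for
  \<open>H = A = K\<close> every \<open>K\<close>-module with an automorphism is a relative Hom-Hopf module, with coaction
  \<open>m \<mapsto> \<mu>\<^sup>-\<^sup>1(m) \<otimes> 1\<close>, and colinear maps are just the morphisms of the base
  category. The test comodules live on the types \<open>'x\<close> and \<open>'y\<close>.
\<close>

definition injective_comodule ::
  "'x itself \<Rightarrow> 'y itself \<Rightarrow> ('k, 'r) ring_scheme \<Rightarrow> ('k, 'h, 's) hom_bialgebra_scheme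
    \<Rightarrow> ('k, 'h, 'm) Hcomod \<Rightarrow> bool"
  where "injective_comodule (_ :: 'x itself) (_ :: 'y itself) K H V \<longleftrightarrow>
    (\<forall>X \<in> (comodules K H :: ('k, 'h, 'x) Hcomod set).
      \<forall>Y \<in> (comodules K H :: ('k, 'h, 'y) Hcomod set).
      \<forall>i \<in> comodule_morphisms K H X Y.
        (\<exists>p\<in>hom_morphisms K (fst Y) (fst X). \<forall>x\<in>carrier (fst X). p (i x) = x) \<longrightarrow>
        (\<forall>f\<in>comodule_morphisms K H X V.
          \<exists>g\<in>comodule_morphisms K H Y V. \<forall>x\<in>carrier (fst X). g (i x) = f x))"

end

theory Submission
  imports Defs
begin

text \<open>
  Sweedler notation is rendered by nested uses of \<^const>\<open>tensor_lift\<close>: by the universal property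
  of the tensor product, \<open>tensor_lift K P b (\<Delta> c)\<close> is \<open>b(c\<^sub>1, c\<^sub>2)\<close> for every bilinear \<open>b\<close>, so
  each axiom becomes an identity between such expressions for arbitrary multilinear maps.

  The Hom-structures are untwisted: with \<open>a \<star> b = \<alpha>\<^sup>-\<^sup>1(a b)\<close>, \<open>m \<cdot>' a = \<mu>\<^sup>-\<^sup>1(m \<cdot> a)\<close>,
  \<open>\<Delta>' = \<Delta> \<alpha>\<close> and \<open>\<rho>' = \<rho> \<mu>\<close>, all Hom-axioms turn into the ordinary ones, so that Doi's argument
  applies: \<open>\<lambda>'(m \<otimes> h) = m\<^sub>0 \<cdot>' \<phi>(S(m\<^sub>1) \<star> h)\<close> retracts \<open>\<rho>'\<close> and satisfies
  \<open>\<rho>' \<lambda>'(m \<otimes> h) = \<lambda>'(m \<otimes> h\<^sub>1) \<otimes> h\<^sub>2\<close>. Twisting back, \<open>\<lambda> = \<mu> \<lambda>'\<close> is the natural colinear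
  retraction of \<open>\<rho>\<close>. Conversely, a colinear retraction \<open>\<lambda>\<close> of \<open>\<rho>\<^sub>A\<close> gives the total integral
  \<open>\<phi>(h) = \<lambda>(1 \<otimes> \<alpha>\<^sup>-\<^sup>1(h))\<close>. For injectivity, a colinear \<open>f : X \<rightarrow> M\<close> is extended along
  \<open>i : X \<rightarrow> Y\<close> with left inverse \<open>p\<close> by \<open>y \<mapsto> \<lambda>(f(p(y\<^sub>0)) \<otimes> y\<^sub>1)\<close>.
\<close>

section \<open>Linear maps\<close>

text \<open>A tensor is a coset evaluated through a chosen representative, so identities of tensors
  are stated by testing them with an arbitrary multilinear map into an arbitrary module
  \<open>Q\<close>. Such an identity can be applied underneath other Sweedler sums, and taking
  \<open>pure_tensor\<close> as the test map recovers the tensor identity itself.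

  The delicate point of Doi's argument is the colinearity of \<lambda>'. The coaction of
  \<lambda>'(m \<otimes> h) contains the comultiplication of S(m2) \<star> h with m1 multiplied onto
  its second leg; one identity for S, derived from the antipode axioms and the multiplicativity of
  \<Delta>, removes that factor.

  The factor \<mu> in \<lambda> = \<mu> \<lambda>' is forced: \<lambda>' commutes with the twists,
  so \<mu> \<lambda>' \<rho> = \<lambda>' \<rho> \<mu> = \<lambda>' \<rho>' = id.

  A last obstacle concerns types. Statement (2) speaks of modules on the type 'm, on which A itself
  need not live. To reach (3), the retraction is evaluated at a copy of A carried to 'm by the
  injection \<iota>, and the result is moved back.\<close>

lemma linear_mapI:
  assumes "\<And>x. x \<in> carrier M \<Longrightarrow> f x \<in> carrier N"
    and "\<And>x y. x \<in> carrier M \<Longrightarrow> y \<in> carrier M \<Longrightarrow> f (x \<oplus>\<^bsub>M\<^esub> y) = f x \<oplus>\<^bsub>N\<^esub> f y"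
    and "\<And>c x. c \<in> carrier K \<Longrightarrow> x \<in> carrier M \<Longrightarrow> f (c \<odot>\<^bsub>M\<^esub> x) = c \<odot>\<^bsub>N\<^esub> f x"
  shows "linear_map K M N f"
  using assms by (auto simp: linear_map_def)

lemma linear_mapD:
  assumes "linear_map K M N f"
  shows linear_map_closed: "x \<in> carrier M \<Longrightarrow> f x \<in> carrier N"
    and linear_map_add: "x \<in> carrier M \<Longrightarrow> y \<in> carrier M \<Longrightarrow> f (x \<oplus>\<^bsub>M\<^esub> y) = f x \<oplus>\<^bsub>N\<^esub> f y"
    and linear_map_smult: "c \<in> carrier K \<Longrightarrow> x \<in> carrier M \<Longrightarrow> f (c \<odot>\<^bsub>M\<^esub> x) = c \<odot>\<^bsub>N\<^esub> f x"
  using assms by (auto simp: linear_map_def)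

lemma linear_map_zero:
  assumes "module K M" "module K N" "linear_map K M N f"
  shows "f \<zero>\<^bsub>M\<^esub> = \<zero>\<^bsub>N\<^esub>"
proof -
  interpret M: module K M by fact
  interpret N: module K N by fact
  have "f (\<zero>\<^bsub>K\<^esub> \<odot>\<^bsub>M\<^esub> \<zero>\<^bsub>M\<^esub>) = \<zero>\<^bsub>K\<^esub> \<odot>\<^bsub>N\<^esub> f \<zero>\<^bsub>M\<^esub>"
    using assms(3) by (intro linear_map_smult) auto
  then show ?thesis
    using linear_map_closed[OF assms(3), of "\<zero>\<^bsub>M\<^esub>"] by simp
qed

lemma linear_map_minus:
  assumes "module K M" "module K N" "linear_map K M N f" "x \<in> carrier M" "y \<in> carrier M"
  shows "f (x \<ominus>\<^bsub>M\<^esub> y) = f x \<ominus>\<^bsub>N\<^esub> f y"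
proof -
  interpret M: module K M by fact
  interpret N: module K N by fact
  have m: "\<ominus>\<^bsub>M\<^esub> y = (\<ominus>\<^bsub>K\<^esub> \<one>\<^bsub>K\<^esub>) \<odot>\<^bsub>M\<^esub> y"
    using assms(5) by (simp add: M.smult_l_minus)
  have n: "\<ominus>\<^bsub>N\<^esub> f y = (\<ominus>\<^bsub>K\<^esub> \<one>\<^bsub>K\<^esub>) \<odot>\<^bsub>N\<^esub> f y"
    using assms(5) linear_map_closed[OF assms(3), of y] by (simp add: N.smult_l_minus)
  show ?thesis
    unfolding a_minus_def m n
    using assms(3-) by (subst linear_map_add[OF assms(3)]) (auto simp: linear_map_smult[OF assms(3)])
qed

lemma linear_map_finsum:
  assumes "module K M" "module K N" "linear_map K M N f"
    and "finite S" "g \<in> S \<rightarrow> carrier M"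
  shows "f (finsum M g S) = finsum N (\<lambda>x. f (g x)) S"
proof -
  interpret M: module K M by fact
  interpret N: module K N by fact
  from assms(4,5) show ?thesis
  proof (induction S)
    case empty
    then show ?case by (simp add: linear_map_zero[OF assms(1-3)])
  next
    case (insert x S)
    have "(\<lambda>x. f (g x)) \<in> S \<rightarrow> carrier N"
      using insert.prems linear_map_closed[OF assms(3)] by auto
    with insert show ?case
      using linear_map_closed[OF assms(3)]
      by (simp add: Pi_iff linear_map_add[OF assms(3)])
  qed
qed

section \<open>Free modules\<close>

lemma free_module_simps [simp]:
  "carrier (free_module K X) =
    {f. range f \<subseteq> carrier K \<and> {x. f x \<noteq> \<zero>\<^bsub>K\<^esub>} \<subseteq> X \<and> finite {x. f x \<noteq> \<zero>\<^bsub>K\<^esub>}}"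
  "zero (free_module K X) = (\<lambda>_. \<zero>\<^bsub>K\<^esub>)"
  "add (free_module K X) f g = (\<lambda>x. f x \<oplus>\<^bsub>K\<^esub> g x)"
  "smult (free_module K X) c f = (\<lambda>x. c \<otimes>\<^bsub>K\<^esub> f x)"
  by (simp_all add: free_module_def)

lemma (in cring) module_free_module: "module R (free_module R X)"
proof (rule moduleI)
  show "cring R" by (rule is_cring)
  show "abelian_group (free_module R X)"
  proof (rule abelian_groupI)
    fix f g assume fg: "f \<in> carrier (free_module R X)" "g \<in> carrier (free_module R X)"
    have "{x. f x \<oplus> g x \<noteq> \<zero>} \<subseteq> {x. f x \<noteq> \<zero>} \<union> {x. g x \<noteq> \<zero>}" by auto
    then have "finite {x. f x \<oplus> g x \<noteq> \<zero>}" and "{x. f x \<oplus> g x \<noteq> \<zero>} \<subseteq> X"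
      using fg by (auto intro: finite_subset)
    then show "f \<oplus>\<^bsub>free_module R X\<^esub> g \<in> carrier (free_module R X)"
      using fg by (auto simp: image_subset_iff)
  next
    fix f assume f: "f \<in> carrier (free_module R X)"
    have "{x. \<ominus> f x \<noteq> \<zero>} \<subseteq> {x. f x \<noteq> \<zero>}" by auto
    then have "finite {x. \<ominus> f x \<noteq> \<zero>}" and "{x. \<ominus> f x \<noteq> \<zero>} \<subseteq> X"
      using f by (auto intro: finite_subset)
    then have "(\<lambda>x. \<ominus> f x) \<in> carrier (free_module R X)"
      using f by (auto simp: image_subset_iff)
    moreover have "(\<lambda>x. \<ominus> f x) \<oplus>\<^bsub>free_module R X\<^esub> f = \<zero>\<^bsub>free_module R X\<^esub>"
      using f by (auto simp: image_subset_iff l_neg)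
    ultimately show "\<exists>g\<in>carrier (free_module R X).
        g \<oplus>\<^bsub>free_module R X\<^esub> f = \<zero>\<^bsub>free_module R X\<^esub>" by blast
  qed (auto simp: image_subset_iff a_ac)
next
  fix c f assume cf: "c \<in> carrier R" "f \<in> carrier (free_module R X)"
  have "{x. c \<otimes> f x \<noteq> \<zero>} \<subseteq> {x. f x \<noteq> \<zero>}" using cf by auto
  then have "finite {x. c \<otimes> f x \<noteq> \<zero>}" and "{x. c \<otimes> f x \<noteq> \<zero>} \<subseteq> X"
    using cf by (auto intro: finite_subset)
  then show "c \<odot>\<^bsub>free_module R X\<^esub> f \<in> carrier (free_module R X)"
    using cf by (auto simp: image_subset_iff)
qed (auto simp: image_subset_iff l_distr r_distr m_assoc)

lemma (in cring) free_gen_closed: "x \<in> X \<Longrightarrow> free_gen R x \<in> carrier (free_module R X)"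
proof -
  assume "x \<in> X"
  moreover have "{y. free_gen R x y \<noteq> \<zero>} \<subseteq> {x}" by (auto simp: free_gen_def)
  moreover have "finite {y. free_gen R x y \<noteq> \<zero>}" using calculation(2) by (rule finite_subset) simp
  ultimately show ?thesis by (auto simp: free_gen_def)
qed

text \<open>\<open>tensor_lift\<close> is this sum for \<open>case_prod b\<close>, taken at a chosen
  representative of the tensor.\<close>

definition free_lift ::
  "('k, 'r) ring_scheme \<Rightarrow> ('k, 'p, 'u) module_scheme \<Rightarrow> ('x \<Rightarrow> 'p) \<Rightarrow> ('x \<Rightarrow> 'k) \<Rightarrow> 'p"
  where "free_lift K P b f = finsum P (\<lambda>z. f z \<odot>\<^bsub>P\<^esub> b z) {z. f z \<noteq> \<zero>\<^bsub>K\<^esub>}"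

text \<open>Terms outside the support are 0 times an element of the carrier, so the sum may run over
  any larger finite subset of \<open>X\<close>. This gives functions with different supports a
  common index set, as additivity requires: the support of a sum can be smaller than the union of
  the supports.\<close>

lemma free_lift_on:
  assumes "module K P" "b \<in> X \<rightarrow> carrier P" "f \<in> carrier (free_module K X)"
    and "finite S" "S \<subseteq> X" "{z. f z \<noteq> \<zero>\<^bsub>K\<^esub>} \<subseteq> S"
  shows "free_lift K P b f = finsum P (\<lambda>z. f z \<odot>\<^bsub>P\<^esub> b z) S"
proof -
  interpret module K P by fact
  show ?thesis unfolding free_lift_def
    using assms by (intro add.finprod_mono_neutral_cong_left) (auto simp: Pi_iff image_subset_iff subset_iff)
qed

lemma free_lift_linear:
  assumes "module K P" "b \<in> X \<rightarrow> carrier P"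
  shows "linear_map K (free_module K X) P (free_lift K P b)"
proof -
  interpret module K P by fact
  show ?thesis
  proof (rule linear_mapI)
    fix f assume "f \<in> carrier (free_module K X)"
    then show "free_lift K P b f \<in> carrier P"
      unfolding free_lift_def using assms(2) 
      by (intro finsum_closed) (auto simp: Pi_iff image_subset_iff subset_iff)
  next
    fix f g assume f: "f \<in> carrier (free_module K X)" and g: "g \<in> carrier (free_module K X)"
    define S where "S = {z. f z \<noteq> \<zero>\<^bsub>K\<^esub>} \<union> {z. g z \<noteq> \<zero>\<^bsub>K\<^esub>}"
    have S: "finite S" "S \<subseteq> X" using f g by (auto simp: S_def)
    have fc: "f z \<in> carrier K" "g z \<in> carrier K" for z using f g by (auto simp: image_subset_iff)
    have bc: "z \<in> S \<Longrightarrow> b z \<in> carrier P" for z using S assms(2) by auto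
    interpret F: module K "free_module K X" by (rule module_free_module)
    have "{z. f z \<oplus>\<^bsub>K\<^esub> g z \<noteq> \<zero>\<^bsub>K\<^esub>} \<subseteq> S" by (auto simp: S_def)
    then have "free_lift K P b (f \<oplus>\<^bsub>free_module K X\<^esub> g)
        = finsum P (\<lambda>z. (f z \<oplus>\<^bsub>K\<^esub> g z) \<odot>\<^bsub>P\<^esub> b z) S"
      using free_lift_on[OF assms F.a_closed[OF f g] S] by simp
    also have "\<dots> = finsum P (\<lambda>z. f z \<odot>\<^bsub>P\<^esub> b z \<oplus>\<^bsub>P\<^esub> g z \<odot>\<^bsub>P\<^esub> b z) S"
      using fc bc by (intro add.finprod_cong') (auto simp: smult_l_distr)
    also have "\<dots> = finsum P (\<lambda>z. f z \<odot>\<^bsub>P\<^esub> b z) S \<oplus>\<^bsub>P\<^esub> finsum P (\<lambda>z. g z \<odot>\<^bsub>P\<^esub> b z) S"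
      using fc bc by (intro finsum_addf) auto
    also have "finsum P (\<lambda>z. f z \<odot>\<^bsub>P\<^esub> b z) S = free_lift K P b f"
      using S f by (intro free_lift_on[OF assms, symmetric]) (auto simp: S_def)
    also have "finsum P (\<lambda>z. g z \<odot>\<^bsub>P\<^esub> b z) S = free_lift K P b g"
      using S g by (intro free_lift_on[OF assms, symmetric]) (auto simp: S_def)
    finally show "free_lift K P b (f \<oplus>\<^bsub>free_module K X\<^esub> g) =
        free_lift K P b f \<oplus>\<^bsub>P\<^esub> free_lift K P b g" .
  next
    fix c f assume c: "c \<in> carrier K" and f: "f \<in> carrier (free_module K X)"
    define S where "S = {z. f z \<noteq> \<zero>\<^bsub>K\<^esub>}"
    have S: "finite S" "S \<subseteq> X" using f by (auto simp: S_def)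
    have fc: "f z \<in> carrier K" for z using f by (auto simp: image_subset_iff)
    have bc: "z \<in> S \<Longrightarrow> b z \<in> carrier P" for z using S assms(2) by auto
    interpret F: module K "free_module K X" by (rule module_free_module)
    have "{z. c \<otimes>\<^bsub>K\<^esub> f z \<noteq> \<zero>\<^bsub>K\<^esub>} \<subseteq> S" using c by (auto simp: S_def)
    then have "free_lift K P b (c \<odot>\<^bsub>free_module K X\<^esub> f)
        = finsum P (\<lambda>z. (c \<otimes>\<^bsub>K\<^esub> f z) \<odot>\<^bsub>P\<^esub> b z) S"
      using free_lift_on[OF assms F.smult_closed[OF c f] S] by simp
    also have "\<dots> = finsum P (\<lambda>z. c \<odot>\<^bsub>P\<^esub> (f z \<odot>\<^bsub>P\<^esub> b z)) S"
      using c fc bc by (intro add.finprod_cong') (auto simp: smult_assoc1)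
    also have "\<dots> = c \<odot>\<^bsub>P\<^esub> finsum P (\<lambda>z. f z \<odot>\<^bsub>P\<^esub> b z) S"
      using S c fc bc by (intro finsum_smult_ldistr[symmetric]) auto
    finally show "free_lift K P b (c \<odot>\<^bsub>free_module K X\<^esub> f) = c \<odot>\<^bsub>P\<^esub> free_lift K P b f"
      by (simp add: free_lift_def S_def)
  qed
qed

lemma free_lift_gen:
  assumes "module K P" "b \<in> X \<rightarrow> carrier P" "x \<in> X"
  shows "free_lift K P b (free_gen K x) = b x"
proof -
  interpret module K P by fact
  have "free_lift K P b (free_gen K x) = finsum P (\<lambda>z. free_gen K x z \<odot>\<^bsub>P\<^esub> b z) {x}"
    by (rule free_lift_on[OF assms(1,2) free_gen_closed]) (use assms in \<open>auto simp: free_gen_def\<close>)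
  moreover have "b x \<in> carrier P" using assms(2,3) by auto
  ultimately show ?thesis by (simp add: free_gen_def)
qed

text \<open>The uniqueness half of the universal property of the free module, by induction on a
  finite set containing the support.\<close>

lemma free_module_linear_eq_lift:
  assumes "module K P" "linear_map K (free_module K X) P g" "f \<in> carrier (free_module K X)"
  shows "g f = free_lift K P (\<lambda>x. g (free_gen K x)) f"
proof -
  interpret module K P by fact
  interpret F: module K "free_module K X" by (rule module_free_module)
  let ?b = "\<lambda>x. g (free_gen K x)"
  have b: "?b \<in> X \<rightarrow> carrier P"
    by (intro funcsetI linear_map_closed[OF assms(2)] free_gen_closed)
  note lin = free_lift_linear[OF assms(1) b]
  have "g f = free_lift K P ?b f"
    if "finite S" "{z. f z \<noteq> \<zero>\<^bsub>K\<^esub>} \<subseteq> S" "S \<subseteq> X" "f \<in> carrier (free_module K X)" for S f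
    using that
  proof (induction S arbitrary: f)
    case empty
    then have "f = \<zero>\<^bsub>free_module K X\<^esub>" by auto
    then show ?case
      using linear_map_zero[OF F.module_axioms assms(1) assms(2)]
        linear_map_zero[OF F.module_axioms assms(1) lin] by metis
  next
    case (insert a S)
    \<comment> \<open>Deleting the coefficient at \<open>a\<close> gives f = h + f(a) e with e the
      basis vector at \<open>a\<close>, and the support of \<open>h\<close> lies in
      \<open>S\<close>. Both \<open>g\<close> and the lift are linear, so both split along this
      decomposition.\<close>
    define h where "h = f(a := \<zero>\<^bsub>K\<^esub>)"
    have "{z. h z \<noteq> \<zero>\<^bsub>K\<^esub>} \<subseteq> {z. f z \<noteq> \<zero>\<^bsub>K\<^esub>}" by (auto simp: h_def)
    then have "finite {z. h z \<noteq> \<zero>\<^bsub>K\<^esub>}" using insert.prems by (auto intro: finite_subset)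
    then have h: "h \<in> carrier (free_module K X)"
      using insert.prems by (auto simp: h_def image_subset_iff)
    have e: "free_gen K a \<in> carrier (free_module K X)"
      using insert.prems by (intro free_gen_closed) auto
    have fa: "f a \<in> carrier K" using insert.prems by (auto simp: image_subset_iff)
    have dec: "f = h \<oplus>\<^bsub>free_module K X\<^esub> (f a \<odot>\<^bsub>free_module K X\<^esub> free_gen K a)"
      using insert.prems by (auto simp: h_def free_gen_def fun_eq_iff image_subset_iff)
    have ih: "g h = free_lift K P ?b h"
      using insert by (intro insert.IH h) (auto simp: h_def)
    have lin_dec: "g' f = g' h \<oplus>\<^bsub>P\<^esub> f a \<odot>\<^bsub>P\<^esub> g' (free_gen K a)"
      if "linear_map K (free_module K X) P g'" for g'
    proof -
      have "g' f = g' (h \<oplus>\<^bsub>free_module K X\<^esub> (f a \<odot>\<^bsub>free_module K X\<^esub> free_gen K a))"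
        using dec by (rule arg_cong)
      also have "\<dots> = g' h \<oplus>\<^bsub>P\<^esub> g' (f a \<odot>\<^bsub>free_module K X\<^esub> free_gen K a)"
        using that h F.smult_closed[OF fa e] by (rule linear_map_add)
      also have "g' (f a \<odot>\<^bsub>free_module K X\<^esub> free_gen K a) = f a \<odot>\<^bsub>P\<^esub> g' (free_gen K a)"
        using that fa e by (rule linear_map_smult)
      finally show ?thesis .
    qed
    note lin_dec[OF assms(2)] lin_dec[OF lin]
    moreover have "free_lift K P ?b (free_gen K a) = g (free_gen K a)"
      using insert.prems by (intro free_lift_gen[OF assms(1) b]) auto
    ultimately show ?case using ih by metis
  qed
  from this[OF _ order_refl _ assms(3)] show ?thesis using assms(3) by auto
qed

section \<open>Quotient modules\<close>

lemma (in module) submodule_abelian_subgroup: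
  assumes "submodule N R M"
  shows "abelian_subgroup N M"
  using assms by (intro abelian_subgroupI3 additive_subgroup.intro M.abelian_group_axioms)
    (auto simp: submodule_def)

text \<open>A submodule absorbs scalars, so every member g of the coset of x yields the same coset
  of c g. The union that defines scalar multiplication in \<open>tensor_module\<close> is therefore
  a nonempty union of equal sets.\<close>

lemma (in module) smult_rcos:
  assumes "submodule N R M" "c \<in> carrier R" "x \<in> carrier M"
  shows "(\<Union>g\<in>N +>\<^bsub>M\<^esub> x. N +>\<^bsub>M\<^esub> (c \<odot>\<^bsub>M\<^esub> g)) = N +>\<^bsub>M\<^esub> (c \<odot>\<^bsub>M\<^esub> x)"
proof -
  interpret N: abelian_subgroup N M using assms(1) by (rule submodule_abelian_subgroup)
  have "N +>\<^bsub>M\<^esub> (c \<odot>\<^bsub>M\<^esub> g) = N +>\<^bsub>M\<^esub> (c \<odot>\<^bsub>M\<^esub> x)" if g: "g \<in> N +>\<^bsub>M\<^esub> x" for g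
  proof -
    obtain n where n: "n \<in> N" "g = n \<oplus>\<^bsub>M\<^esub> x"
      using g by (auto simp: a_r_coset_def')
    then have "c \<odot>\<^bsub>M\<^esub> g = c \<odot>\<^bsub>M\<^esub> n \<oplus>\<^bsub>M\<^esub> c \<odot>\<^bsub>M\<^esub> x"
      using assms by (auto simp: smult_r_distr)
    moreover have "c \<odot>\<^bsub>M\<^esub> n \<in> N"
      using submoduleE(4)[OF assms(1)] assms n by blast
    ultimately have "c \<odot>\<^bsub>M\<^esub> g \<in> N +>\<^bsub>M\<^esub> (c \<odot>\<^bsub>M\<^esub> x)"
      by (auto simp: a_r_coset_def')
    then show ?thesis
      using assms by (intro N.a_repr_independence'[symmetric]) auto
  qed
  moreover have "x \<in> N +>\<^bsub>M\<^esub> x"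
    using assms by (intro N.a_rcos_self) auto
  ultimately show ?thesis by blast
qed

text \<open>\<open>Q\<close> is any record with these four fields, so that the result applies
  directly to \<open>tensor_module\<close>, whose remaining fields are arbitrary.\<close>

lemma (in module) module_quotient:
  assumes N: "submodule N R M"
    and Q: "carrier Q = a_rcosets\<^bsub>M\<^esub> N" "zero Q = N" "add Q = set_add M"
      "\<And>c T. smult Q c T = (\<Union>x\<in>T. N +>\<^bsub>M\<^esub> (c \<odot>\<^bsub>M\<^esub> x))"
  shows "module R Q" "linear_map R M Q (\<lambda>x. N +>\<^bsub>M\<^esub> x)"
proof -
  interpret N: abelian_subgroup N M using assms(1) by (rule submodule_abelian_subgroup)
  have coset: "\<exists>x\<in>carrier M. T = N +>\<^bsub>M\<^esub> x" if "T \<in> carrier Q" for T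
    using that unfolding Q by (auto simp: A_RCOSETS_def')
  have closed: "N +>\<^bsub>M\<^esub> x \<in> carrier Q" if "x \<in> carrier M" for x
    using that unfolding Q by (auto simp: A_RCOSETS_def')
  have plus: "(N +>\<^bsub>M\<^esub> x) \<oplus>\<^bsub>Q\<^esub> (N +>\<^bsub>M\<^esub> y) = N +>\<^bsub>M\<^esub> (x \<oplus>\<^bsub>M\<^esub> y)"
    if "x \<in> carrier M" "y \<in> carrier M" for x y
    using that unfolding Q by (intro N.a_rcos_sum)
  have times: "c \<odot>\<^bsub>Q\<^esub> (N +>\<^bsub>M\<^esub> x) = N +>\<^bsub>M\<^esub> (c \<odot>\<^bsub>M\<^esub> x)"
    if "c \<in> carrier R" "x \<in> carrier M" for c x
    using that unfolding Q by (intro smult_rcos N)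
  \<comment> \<open>Zero is written as a coset so that \<open>plus\<close> applies to it;
    \<open>a_coset_add_zero\<close> would undo this and is switched off below.\<close>
  have zero: "\<zero>\<^bsub>Q\<^esub> = N +>\<^bsub>M\<^esub> \<zero>\<^bsub>M\<^esub>"
    unfolding Q using N.a_subset by simp
  show "linear_map R M Q (\<lambda>x. N +>\<^bsub>M\<^esub> x)"
    by (rule linear_mapI) (simp_all add: closed plus times)
  show "module R Q"
  proof (rule moduleI)
    show "cring R" by (rule R.is_cring)
    show "abelian_group Q"
    proof (rule abelian_groupI)
      show "\<zero>\<^bsub>Q\<^esub> \<in> carrier Q"
        unfolding zero by (rule closed) simp
    next
      fix T assume "T \<in> carrier Q"
      then obtain x where x: "x \<in> carrier M" "T = N +>\<^bsub>M\<^esub> x" using coset by blast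
      then show "\<exists>U\<in>carrier Q. U \<oplus>\<^bsub>Q\<^esub> T = \<zero>\<^bsub>Q\<^esub>"
        unfolding zero
        by (intro bexI[of _ "N +>\<^bsub>M\<^esub> (\<ominus>\<^bsub>M\<^esub> x)"])
          (simp_all add: plus closed M.l_neg del: a_coset_add_zero)
      show "\<zero>\<^bsub>Q\<^esub> \<oplus>\<^bsub>Q\<^esub> T = T"
        using x unfolding zero by (simp add: plus del: a_coset_add_zero)
    next
      fix T U assume "T \<in> carrier Q" "U \<in> carrier Q"
      then obtain x y where x: "x \<in> carrier M" "T = N +>\<^bsub>M\<^esub> x" "y \<in> carrier M" "U = N +>\<^bsub>M\<^esub> y"
        using coset by metis
      then show "T \<oplus>\<^bsub>Q\<^esub> U \<in> carrier Q" "T \<oplus>\<^bsub>Q\<^esub> U = U \<oplus>\<^bsub>Q\<^esub> T"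
        by (simp_all add: plus closed M.a_comm)
      fix V assume "V \<in> carrier Q"
      then obtain z where "z \<in> carrier M" "V = N +>\<^bsub>M\<^esub> z" using coset by blast
      with x show "T \<oplus>\<^bsub>Q\<^esub> U \<oplus>\<^bsub>Q\<^esub> V = T \<oplus>\<^bsub>Q\<^esub> (U \<oplus>\<^bsub>Q\<^esub> V)"
        by (simp add: plus M.a_assoc)
    qed
  next
    fix c T assume c: "c \<in> carrier R" and "T \<in> carrier Q"
    then obtain x where x: "x \<in> carrier M" "T = N +>\<^bsub>M\<^esub> x" using coset by blast
    then show "c \<odot>\<^bsub>Q\<^esub> T \<in> carrier Q"
      using c by (simp add: times closed)
    fix d assume "d \<in> carrier R"
    then show "(c \<oplus> d) \<odot>\<^bsub>Q\<^esub> T = c \<odot>\<^bsub>Q\<^esub> T \<oplus>\<^bsub>Q\<^esub> d \<odot>\<^bsub>Q\<^esub> T"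
      "(c \<otimes> d) \<odot>\<^bsub>Q\<^esub> T = c \<odot>\<^bsub>Q\<^esub> (d \<odot>\<^bsub>Q\<^esub> T)"
      using x c by (simp_all add: plus times smult_l_distr smult_assoc1)
  next
    fix c T U assume c: "c \<in> carrier R" and "T \<in> carrier Q" "U \<in> carrier Q"
    then obtain x y where "x \<in> carrier M" "T = N +>\<^bsub>M\<^esub> x" "y \<in> carrier M" "U = N +>\<^bsub>M\<^esub> y"
      using coset by metis
    then show "c \<odot>\<^bsub>Q\<^esub> (T \<oplus>\<^bsub>Q\<^esub> U) = c \<odot>\<^bsub>Q\<^esub> T \<oplus>\<^bsub>Q\<^esub> c \<odot>\<^bsub>Q\<^esub> U"
      using c by (simp add: plus times smult_r_distr)
  qed (auto dest!: coset simp: times)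
qed

declare free_module_simps [simp del]

section \<open>Tensor products\<close>

lemma bilinear_mapI:
  assumes "\<And>x. x \<in> carrier M \<Longrightarrow> linear_map K N P (b x)"
    and "\<And>y. y \<in> carrier N \<Longrightarrow> linear_map K M P (\<lambda>x. b x y)"
  shows "bilinear_map K M N P b"
  using assms by (auto simp: bilinear_map_def)

lemma bilinear_mapD:
  assumes "bilinear_map K M N P b"
  shows bilinear_map_right: "x \<in> carrier M \<Longrightarrow> linear_map K N P (b x)"
    and bilinear_map_left: "y \<in> carrier N \<Longrightarrow> linear_map K M P (\<lambda>x. b x y)"
    and bilinear_map_closed: "x \<in> carrier M \<Longrightarrow> y \<in> carrier N \<Longrightarrow> b x y \<in> carrier P"
  using assms by (auto simp: bilinear_map_def intro: linear_map_closed)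

lemma kernel_submodule:
  assumes "module K M" "module K N" "linear_map K M N f"
  shows "submodule {x \<in> carrier M. f x = \<zero>\<^bsub>N\<^esub>} K M"
proof -
  interpret M: module K M by fact
  interpret N: module K N by fact
  have "f (\<ominus>\<^bsub>M\<^esub> x) = \<zero>\<^bsub>N\<^esub>" if "x \<in> carrier M" "f x = \<zero>\<^bsub>N\<^esub>" for x
    using linear_map_minus[OF assms, of "\<zero>\<^bsub>M\<^esub>" x] that linear_map_zero[OF assms]
    by (simp add: a_minus_def)
  then show ?thesis
    by (intro M.submoduleI)
      (auto simp: linear_map_zero[OF assms] linear_map_add[OF assms(3)] linear_map_smult[OF assms(3)])
qed

lemma (in module) submodule_Inter:
  assumes "\<And>N. N \<in> \<N> \<Longrightarrow> submodule N R M" "\<N> \<noteq> {}"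
  shows "submodule (\<Inter>\<N>) R M"
proof (rule submoduleI)
  show "\<zero>\<^bsub>M\<^esub> \<in> \<Inter>\<N>"
    using subgroup.one_closed[OF submodule.axioms(1)[OF assms(1)]] by simp
next
  show "\<Inter>\<N> \<subseteq> carrier M"
    using assms(2) submoduleE(1)[OF assms(1)] by blast
qed (auto simp: submoduleE(3,4,5)[OF assms(1)])

section \<open>The universal property of the tensor product\<close>

context
  fixes K :: "('k, 'r) ring_scheme"
    and M :: "('k, 'm, 's) module_scheme" and N :: "('k, 'n, 't) module_scheme"
  assumes M: "module K M" and N: "module K N"
begin

interpretation M: module K M by (rule M)
interpretation N: module K N by (rule N)
interpretation F: module K "pairs_module K M N" by (rule M.module_free_module)

lemma pair_gen_closed:
  "x \<in> carrier M \<Longrightarrow> y \<in> carrier N \<Longrightarrow> free_gen K (x, y) \<in> carrier (pairs_module K M N)"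
  by (rule M.free_gen_closed) auto

lemma bilinear_relators_closed: "bilinear_relators K M N \<subseteq> carrier (pairs_module K M N)"
  unfolding bilinear_relators_def Let_def
  by (auto intro!: F.minus_closed F.a_closed F.smult_closed pair_gen_closed)

lemma tensor_relations_submodule: "submodule (tensor_relations K M N) K (pairs_module K M N)"
  unfolding tensor_relations_def
  by (rule F.submodule_Inter) (use F.carrier_is_submodule bilinear_relators_closed in auto)

lemma bilinear_relators_sub: "bilinear_relators K M N \<subseteq> tensor_relations K M N"
  unfolding tensor_relations_def by auto

lemma tensor_module_quotient:
  shows module_tensor: "module K (tensor_module K M N)"
    and tensor_quotient_linear: "linear_map K (pairs_module K M N) (tensor_module K M N)
      (\<lambda>f. tensor_relations K M N +>\<^bsub>pairs_module K M N\<^esub> f)"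
  by (rule F.module_quotient[OF tensor_relations_submodule]; simp add: tensor_module_def Let_def)+

interpretation T: module K "tensor_module K M N" by (rule module_tensor)

interpretation R: abelian_subgroup "tensor_relations K M N" "pairs_module K M N"
  by (rule F.submodule_abelian_subgroup[OF tensor_relations_submodule])

lemma tensor_coset:
  assumes "t \<in> carrier (tensor_module K M N)"
  obtains f where "f \<in> carrier (pairs_module K M N)"
    and "t = tensor_relations K M N +>\<^bsub>pairs_module K M N\<^esub> f"
  using assms by (auto simp: tensor_module_def Let_def A_RCOSETS_def')

text \<open>The relators are given as differences; this turns each of them into an equation of
  cosets, and every bilinearity law of \<open>pure_tensor\<close> is an instance.\<close>

lemma coset_minus_zero:
  assumes "f \<ominus>\<^bsub>pairs_module K M N\<^esub> g \<in> bilinear_relators K M N"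
    and "f \<in> carrier (pairs_module K M N)" "g \<in> carrier (pairs_module K M N)"
  shows "tensor_relations K M N +>\<^bsub>pairs_module K M N\<^esub> f
    = tensor_relations K M N +>\<^bsub>pairs_module K M N\<^esub> g"
proof -
  have "f \<in> tensor_relations K M N +>\<^bsub>pairs_module K M N\<^esub> g"
    using assms bilinear_relators_sub R.a_rcos_module[OF assms(3,2)] by (auto simp: a_minus_def)
  then show ?thesis
    by (intro R.a_repr_independence'[symmetric] assms(3))
qed

lemma bilinear_pure_tensor: "bilinear_map K M N (tensor_module K M N) (pure_tensor K M N)"
proof -
  note q = tensor_quotient_linear
  have "pure_tensor K M N (x \<oplus>\<^bsub>M\<^esub> x') y
      = pure_tensor K M N x y \<oplus>\<^bsub>tensor_module K M N\<^esub> pure_tensor K M N x' y"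
    if "x \<in> carrier M" "x' \<in> carrier M" "y \<in> carrier N" for x x' y
    unfolding pure_tensor_def using that
    by (subst linear_map_add[OF q, symmetric];
        (intro coset_minus_zero pair_gen_closed F.a_closed F.smult_closed M.a_closed N.a_closed
          M.smult_closed N.smult_closed)?;
        (unfold bilinear_relators_def Let_def)?; blast)
  moreover have "pure_tensor K M N x (y \<oplus>\<^bsub>N\<^esub> y')
      = pure_tensor K M N x y \<oplus>\<^bsub>tensor_module K M N\<^esub> pure_tensor K M N x y'"
    if "x \<in> carrier M" "y \<in> carrier N" "y' \<in> carrier N" for x y y'
    unfolding pure_tensor_def using that
    by (subst linear_map_add[OF q, symmetric];
        (intro coset_minus_zero pair_gen_closed F.a_closed F.smult_closed M.a_closed N.a_closed
          M.smult_closed N.smult_closed)?;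
        (unfold bilinear_relators_def Let_def)?; blast)
  moreover have "pure_tensor K M N (c \<odot>\<^bsub>M\<^esub> x) y
      = c \<odot>\<^bsub>tensor_module K M N\<^esub> pure_tensor K M N x y"
    if "c \<in> carrier K" "x \<in> carrier M" "y \<in> carrier N" for c x y
    unfolding pure_tensor_def using that
    by (subst linear_map_smult[OF q, symmetric];
        (intro coset_minus_zero pair_gen_closed F.a_closed F.smult_closed M.a_closed N.a_closed
          M.smult_closed N.smult_closed)?;
        (unfold bilinear_relators_def Let_def)?; blast)
  moreover have "pure_tensor K M N x (c \<odot>\<^bsub>N\<^esub> y)
      = c \<odot>\<^bsub>tensor_module K M N\<^esub> pure_tensor K M N x y"
    if "c \<in> carrier K" "x \<in> carrier M" "y \<in> carrier N" for c x y
    unfolding pure_tensor_def using that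
    by (subst linear_map_smult[OF q, symmetric];
        (intro coset_minus_zero pair_gen_closed F.a_closed F.smult_closed M.a_closed N.a_closed
          M.smult_closed N.smult_closed)?;
        (unfold bilinear_relators_def Let_def)?; blast)
  moreover have "pure_tensor K M N x y \<in> carrier (tensor_module K M N)"
    if "x \<in> carrier M" "y \<in> carrier N" for x y
    unfolding pure_tensor_def using that
    by (intro linear_map_closed[OF q] pair_gen_closed)
  ultimately show ?thesis
    by (intro bilinear_mapI linear_mapI) simp_all
qed

context
  fixes P :: "('k, 'p, 'u) module_scheme" and b :: "'m \<Rightarrow> 'n \<Rightarrow> 'p"
  assumes P: "module K P" and b: "bilinear_map K M N P b"
begin

interpretation P: module K P by (rule P)

lemma case_prod_bilinear_closed: "case_prod b \<in> carrier M \<times> carrier N \<rightarrow> carrier P"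
  using bilinear_map_closed[OF b] by auto

lemma free_lift_pair:
  "x \<in> carrier M \<Longrightarrow> y \<in> carrier N \<Longrightarrow> free_lift K P (case_prod b) (free_gen K (x, y)) = b x y"
  by (subst free_lift_gen[OF P case_prod_bilinear_closed]) auto

text \<open>Bilinearity of \<open>b\<close> says exactly that the lift vanishes on the relators. Its
  kernel is then one of the submodules intersected in \<open>tensor_relations\<close>, so it
  contains all relations.\<close>

lemma free_lift_tensor_relations:
  assumes "r \<in> tensor_relations K M N"
  shows "free_lift K P (case_prod b) r = \<zero>\<^bsub>P\<^esub>"
proof -
  let ?F = "pairs_module K M N"
  note L = free_lift_linear[OF P case_prod_bilinear_closed]
  have "free_lift K P (case_prod b) (f \<ominus>\<^bsub>?F\<^esub> g) = \<zero>\<^bsub>P\<^esub>"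
    if "f \<in> carrier ?F" "g \<in> carrier ?F" 
      "free_lift K P (case_prod b) f = free_lift K P (case_prod b) g" for f g
    using that linear_map_minus[OF F.module_axioms P L that(1,2)] linear_map_closed[OF L that(2)]
    by (simp add: P.r_neg a_minus_def)
  then have "bilinear_relators K M N \<subseteq> {f \<in> carrier ?F. free_lift K P (case_prod b) f = \<zero>\<^bsub>P\<^esub>}"
    using bilinear_relators_closed
    unfolding bilinear_relators_def Let_def
    by (auto simp: linear_map_add[OF L] linear_map_smult[OF L] free_lift_pair pair_gen_closed
        linear_map_add[OF bilinear_map_left[OF b]] linear_map_add[OF bilinear_map_right[OF b]]
        linear_map_smult[OF bilinear_map_left[OF b]] linear_map_smult[OF bilinear_map_right[OF b]])
  then show ?thesis
    using assms kernel_submodule[OF F.module_axioms P L] unfolding tensor_relations_def by auto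
qed

text \<open>The representative picked by \<open>SOME\<close> is r + f with r a relation, and the
  lift kills r. Here the arbitrary choice in \<open>tensor_lift\<close> disappears.\<close>

lemma tensor_lift_coset:
  assumes "f \<in> carrier (pairs_module K M N)"
  shows "tensor_lift K P b (tensor_relations K M N +>\<^bsub>pairs_module K M N\<^esub> f)
    = free_lift K P (case_prod b) f"
proof -
  let ?t = "tensor_relations K M N +>\<^bsub>pairs_module K M N\<^esub> f"
  note L = free_lift_linear[OF P case_prod_bilinear_closed]
  have "f \<in> ?t" using assms by (rule R.a_rcos_self)
  then have "(SOME g. g \<in> ?t) \<in> ?t" by (rule someI[of "\<lambda>g. g \<in> ?t"])
  then obtain r where r: "r \<in> tensor_relations K M N"
    "(SOME g. g \<in> ?t) = r \<oplus>\<^bsub>pairs_module K M N\<^esub> f"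
    by (auto simp: a_r_coset_def')
  have "r \<in> carrier (pairs_module K M N)" using r R.a_subset by blast
  then have "free_lift K P (case_prod b) (SOME g. g \<in> ?t) = free_lift K P (case_prod b) f"
    using r assms linear_map_closed[OF L assms]
    by (simp add: linear_map_add[OF L] free_lift_tensor_relations)
  moreover have "tensor_lift K P b ?t = free_lift K P (case_prod b) (SOME g. g \<in> ?t)"
    unfolding tensor_lift_def free_lift_def Let_def by (simp add: case_prod_beta')
  ultimately show ?thesis by simp
qed

lemma tensor_lift_pure:
  "x \<in> carrier M \<Longrightarrow> y \<in> carrier N \<Longrightarrow> tensor_lift K P b (pure_tensor K M N x y) = b x y"
  unfolding pure_tensor_def by (simp add: tensor_lift_coset pair_gen_closed free_lift_pair)

lemma tensor_lift_linear: "linear_map K (tensor_module K M N) P (tensor_lift K P b)"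
proof (rule linear_mapI)
  note L = free_lift_linear[OF P case_prod_bilinear_closed]
  note q = tensor_quotient_linear
  fix s assume "s \<in> carrier (tensor_module K M N)"
  then obtain f where f: "f \<in> carrier (pairs_module K M N)"
    "s = tensor_relations K M N +>\<^bsub>pairs_module K M N\<^esub> f" by (rule tensor_coset)
  then show "tensor_lift K P b s \<in> carrier P"
    by (simp add: tensor_lift_coset linear_map_closed[OF L])
  show "tensor_lift K P b (c \<odot>\<^bsub>tensor_module K M N\<^esub> s) = c \<odot>\<^bsub>P\<^esub> tensor_lift K P b s"
    if "c \<in> carrier K" for c
    using f that
    by (simp add: tensor_lift_coset linear_map_smult[OF q, symmetric] linear_map_smult[OF L])
  fix t assume "t \<in> carrier (tensor_module K M N)"
  then obtain g where "g \<in> carrier (pairs_module K M N)"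
    "t = tensor_relations K M N +>\<^bsub>pairs_module K M N\<^esub> g" by (rule tensor_coset)
  with f show "tensor_lift K P b (s \<oplus>\<^bsub>tensor_module K M N\<^esub> t)
      = tensor_lift K P b s \<oplus>\<^bsub>P\<^esub> tensor_lift K P b t"
    by (simp add: tensor_lift_coset linear_map_add[OF q, symmetric] linear_map_add[OF L])
qed

end

text \<open>A linear map on a tensor product is recovered from its values on pure tensors. With the
  identity for \<open>g\<close> this expands an arbitrary tensor as the lift of
  \<open>pure_tensor\<close> at itself.\<close>

lemma tensor_linear_eq_lift:
  assumes P: "module K P" and g: "linear_map K (tensor_module K M N) P g"
    and t: "t \<in> carrier (tensor_module K M N)"
  shows "g t = tensor_lift K P (\<lambda>x y. g (pure_tensor K M N x y)) t"
proof -
  let ?q = "\<lambda>f. tensor_relations K M N +>\<^bsub>pairs_module K M N\<^esub> f"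
  note q = tensor_quotient_linear
  note p = bilinear_pure_tensor
  obtain f where f: "f \<in> carrier (pairs_module K M N)" "t = ?q f"
    using t by (rule tensor_coset)
  have gq: "linear_map K (pairs_module K M N) P (\<lambda>f. g (?q f))"
    by (rule linear_mapI) (simp_all add: linear_map_closed[OF q] linear_map_add[OF q]
        linear_map_smult[OF q] linear_map_closed[OF g] linear_map_add[OF g] linear_map_smult[OF g])
  have b: "bilinear_map K M N P (\<lambda>x y. g (pure_tensor K M N x y))"
    by (intro bilinear_mapI linear_mapI)
      (simp_all add: bilinear_map_closed[OF p] linear_map_closed[OF g]
        linear_map_add[OF g] linear_map_smult[OF g]
        linear_map_add[OF bilinear_map_left[OF p]] linear_map_add[OF bilinear_map_right[OF p]]
        linear_map_smult[OF bilinear_map_left[OF p]] linear_map_smult[OF bilinear_map_right[OF p]])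
  have "g (?q f) = free_lift K P (\<lambda>x. g (?q (free_gen K x))) f"
    by (rule free_module_linear_eq_lift[OF P gq f(1)])
  also have "(\<lambda>x. g (?q (free_gen K x))) = case_prod (\<lambda>x y. g (pure_tensor K M N x y))"
    by (auto simp: pure_tensor_def)
  finally show ?thesis
    using f by (simp add: tensor_lift_coset[OF P b])
qed

lemma tensor_rep_closed:
  assumes t: "t \<in> carrier (tensor_module K M N)"
  shows "(SOME f. f \<in> t) \<in> carrier (pairs_module K M N)"
proof -
  obtain f where f: "f \<in> carrier (pairs_module K M N)"
    "t = tensor_relations K M N +>\<^bsub>pairs_module K M N\<^esub> f"
    using t by (rule tensor_coset)
  then have "f \<in> t" by (simp add: R.a_rcos_self)
  then have "(SOME g. g \<in> t) \<in> t" by (rule someI[of "\<lambda>g. g \<in> t"])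
  moreover have "t \<subseteq> carrier (pairs_module K M N)"
    using f F.a_r_coset_subset_G R.a_subset by simp
  ultimately show ?thesis by blast
qed

end

section \<open>Sweedler calculus\<close>

text \<open>The inductive relation behind finite folds applies its function only to elements of
  \<open>S\<close>.\<close>

lemma foldSetD_cong:
  assumes "(S, y) \<in> foldSetD D (\<lambda>x. h (f x)) e" "\<And>x. x \<in> S \<Longrightarrow> f x = g x"
  shows "(S, y) \<in> foldSetD D (\<lambda>x. h (g x)) e"
  using assms by (induction rule: foldSetD.induct) (auto intro!: foldSetD.intros)

text \<open>Unlike \<open>finsum_cong\<close>, no closure condition: it would be a side condition of every
  congruence step under \<^const>\<open>tensor_lift\<close>.\<close>

lemma finsum_eqI:
  fixes P :: "('p, 'u) ring_scheme"
  assumes "\<And>x. x \<in> S \<Longrightarrow> f x = g x"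
  shows "finsum P f S = finsum P g S"
proof -
  \<comment> \<open>A fold is a definite description over this relation, so equal relations give
    equal sums even when some summand lies outside the carrier.\<close>
  have "(S, y) \<in> foldSetD D (\<lambda>x. h (f x)) e \<longleftrightarrow> (S, y) \<in> foldSetD D (\<lambda>x. h (g x)) e"
    for D y e and h :: "'p \<Rightarrow> 'p \<Rightarrow> 'p"
    using foldSetD_cong[of S y D h f e g] foldSetD_cong[of S y D h g e f] assms by auto
  then show ?thesis
    by (simp add: finsum_def finprod_def foldD_def comp_def)
qed

context
  fixes K :: "('k, 'r) ring_scheme"
    and M :: "('k, 'm, 's) module_scheme" and N :: "('k, 'n, 't) module_scheme"
    and t :: "('k, 'm, 'n) tensor"
  assumes t: "t \<in> carrier (tensor_module K M N)" and M: "module K M" and N: "module K N"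
begin

text \<open>Naming the representative makes every lift at \<open>t\<close> a finite sum over one
  fixed index set inside the product of the carriers. Congruence, closure and the passage of a
  linear map through the sum are then facts about finite sums, and the last two ask only that the
  summands lie in the module.\<close>

definition tensor_rep where "tensor_rep = (SOME f. f \<in> t)"

lemma tensor_rep:
  "finite {z. tensor_rep z \<noteq> \<zero>\<^bsub>K\<^esub>}" "tensor_rep z \<in> carrier K"
  "tensor_rep (x, y) \<noteq> \<zero>\<^bsub>K\<^esub> \<Longrightarrow> x \<in> carrier M" "tensor_rep (x, y) \<noteq> \<zero>\<^bsub>K\<^esub> \<Longrightarrow> y \<in> carrier N"
  using tensor_rep_closed[OF M N t] by (cases z; auto simp: free_module_simps tensor_rep_def image_subset_iff)+

lemma tensor_lift_rep:
  "tensor_lift K P b t = finsum P (\<lambda>(x, y). tensor_rep (x, y) \<odot>\<^bsub>P\<^esub> b x y) {z. tensor_rep z \<noteq> \<zero>\<^bsub>K\<^esub>}"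
  by (simp add: tensor_lift_def tensor_rep_def Let_def)

lemma tensor_lift_cong:
  assumes "\<And>x y. x \<in> carrier M \<Longrightarrow> y \<in> carrier N \<Longrightarrow> b x y = b' x y"
  shows "tensor_lift K P b t = tensor_lift K P b' t"
  unfolding tensor_lift_rep using assms by (intro finsum_eqI) (auto simp: tensor_rep(3,4))

lemma tensor_lift_closed:
  assumes P: "module K P" and "\<And>x y. x \<in> carrier M \<Longrightarrow> y \<in> carrier N \<Longrightarrow> b x y \<in> carrier P"
  shows "tensor_lift K P b t \<in> carrier P"
proof -
  interpret P: module K P by fact
  show ?thesis
    unfolding tensor_lift_rep using assms(2) by (intro P.finsum_closed) (auto simp: tensor_rep)
qed

lemma linear_tensor_lift:
  assumes P: "module K P" and Q: "module K Q" and g: "linear_map K P Q g"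
    and "\<And>x y. x \<in> carrier M \<Longrightarrow> y \<in> carrier N \<Longrightarrow> b x y \<in> carrier P"
  shows "g (tensor_lift K P b t) = tensor_lift K Q (\<lambda>x y. g (b x y)) t"
proof -
  interpret P: module K P by fact
  show ?thesis
    unfolding tensor_lift_rep using assms(4)
    by (subst linear_map_finsum[OF P Q g])
      (auto intro!: finsum_eqI simp: linear_map_smult[OF g] tensor_rep)
qed

text \<open>Linearity in a parameter of the integrand, with the tensor fixed. The counterpart
  \<open>linear_map_lift_arg\<close> treats a parameter of the tensor with the integrand fixed; a
  bound variable that occurs once sits in one of these two places.\<close>

lemma linear_tensor_lift_body:
  assumes P: "module K P"
    and b: "\<And>x y. x \<in> carrier M \<Longrightarrow> y \<in> carrier N \<Longrightarrow> linear_map K L P (\<lambda>z. b z x y)"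
  shows "linear_map K L P (\<lambda>z. tensor_lift K P (b z) t)"
proof -
  interpret P: module K P by fact
  have c: "b z x y \<in> carrier P" if "tensor_rep (x, y) \<noteq> \<zero>\<^bsub>K\<^esub>" "z \<in> carrier L" for x y z
    using that by (intro linear_map_closed[OF b]) (auto simp: tensor_rep(3,4))
  show ?thesis
  proof (rule linear_mapI)
    fix z w assume zw: "z \<in> carrier L" "w \<in> carrier L"
    have "tensor_lift K P (b (z \<oplus>\<^bsub>L\<^esub> w)) t = finsum P (\<lambda>a. (case a of (x, y) \<Rightarrow> tensor_rep (x, y) \<odot>\<^bsub>P\<^esub> b z x y)
       \<oplus>\<^bsub>P\<^esub> (case a of (x, y) \<Rightarrow> tensor_rep (x, y) \<odot>\<^bsub>P\<^esub> b w x y)) {a. tensor_rep a \<noteq> \<zero>\<^bsub>K\<^esub>}"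
      unfolding tensor_lift_rep using zw
      by (intro finsum_eqI)
        (auto simp: linear_map_add[OF b] tensor_rep(3,4) tensor_rep(2) c P.smult_r_distr)
    then show "tensor_lift K P (b (z \<oplus>\<^bsub>L\<^esub> w)) t = tensor_lift K P (b z) t \<oplus>\<^bsub>P\<^esub> tensor_lift K P (b w) t"
      unfolding tensor_lift_rep using zw by (subst (asm) P.finsum_addf) (auto simp: tensor_rep c)
  next
    fix k z assume kz: "k \<in> carrier K" "z \<in> carrier L"
    have "tensor_lift K P (b (k \<odot>\<^bsub>L\<^esub> z)) t =
        finsum P (\<lambda>a. k \<odot>\<^bsub>P\<^esub> (case a of (x, y) \<Rightarrow> tensor_rep (x, y) \<odot>\<^bsub>P\<^esub> b z x y)) {a. tensor_rep a \<noteq> \<zero>\<^bsub>K\<^esub>}"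
      unfolding tensor_lift_rep using kz
      by (intro finsum_eqI)
        (auto simp: linear_map_smult[OF b] tensor_rep(3,4) tensor_rep(2) c P.smult_assoc1[symmetric] P.m_comm)
    then show "tensor_lift K P (b (k \<odot>\<^bsub>L\<^esub> z)) t = k \<odot>\<^bsub>P\<^esub> tensor_lift K P (b z) t"
      unfolding tensor_lift_rep using kz
      by (subst P.finsum_smult_ldistr) (auto simp: tensor_rep c)
  qed (auto intro!: tensor_lift_closed P linear_map_closed[OF b])
qed

end

lemma linear_map_id: "linear_map K M M (\<lambda>x. x)"
  by (simp add: linear_map_def)

lemma linear_map_comp:
  assumes "linear_map K M N f" "linear_map K L M g"
  shows "linear_map K L N (\<lambda>x. f (g x))"
  by (rule linear_mapI)
    (simp_all add: linear_map_closed[OF assms(2)] linear_map_add[OF assms(2)]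
      linear_map_smult[OF assms(2)] linear_map_closed[OF assms(1)] linear_map_add[OF assms(1)]
      linear_map_smult[OF assms(1)])

lemma bilinear_map_comp_left:
  assumes "bilinear_map K M N P b" "linear_map K L M g" "y \<in> carrier N"
  shows "linear_map K L P (\<lambda>z. b (g z) y)"
  by (rule linear_map_comp[OF bilinear_map_left[OF assms(1,3)] assms(2)])

lemma bilinear_map_comp_right:
  assumes "bilinear_map K M N P b" "linear_map K L N g" "x \<in> carrier M"
  shows "linear_map K L P (\<lambda>z. b x (g z))"
  by (rule linear_map_comp[OF bilinear_map_right[OF assms(1,3)] assms(2)])

lemma module_base_module: "cring K \<Longrightarrow> module K (base_module K)"
proof -
  assume "cring K"
  then interpret cring K .
  show ?thesis
    by (rule moduleI) (auto simp: base_module_def a_ac l_distr r_distr m_assoc is_cring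
        intro!: abelian_groupI bexI[where x = "\<ominus>\<^bsub>K\<^esub> _"] l_neg)
qed

lemma bilinear_smult:
  assumes "module K M"
  shows "bilinear_map K (base_module K) M M (smult M)"
proof -
  interpret module K M by fact
  show ?thesis
    by (intro bilinear_mapI linear_mapI)
      (simp_all add: base_module_def smult_l_distr smult_r_distr smult_assoc1[symmetric] m_comm)
qed

lemma linear_map_lift_arg:
  assumes "linear_map K L (tensor_module K M N) t" "bilinear_map K M N P b"
    and "module K M" "module K N" "module K P"
  shows "linear_map K L P (\<lambda>z. tensor_lift K P b (t z))"
  by (rule linear_map_comp[OF tensor_lift_linear[OF assms(3-5,2)] assms(1)])

text \<open>As a function of \<open>t\<close> the left side is linear, hence determined by its
  values on pure tensors, where the inner lift collapses to \<open>b x y u v\<close>.\<close>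

lemma tensor_lift_swap:
  assumes s: "s \<in> carrier (tensor_module K M N)" and t: "t \<in> carrier (tensor_module K M' N')"
    and mods: "module K M" "module K N" "module K M'" "module K N'" "module K P"
    and b: "\<And>x y. x \<in> carrier M \<Longrightarrow> y \<in> carrier N \<Longrightarrow> bilinear_map K M' N' P (b x y)"
  shows "tensor_lift K P (\<lambda>x y. tensor_lift K P (\<lambda>u v. b x y u v) t) s =
    tensor_lift K P (\<lambda>u v. tensor_lift K P (\<lambda>x y. b x y u v) s) t"
proof -
  let ?g = "\<lambda>t. tensor_lift K P (\<lambda>x y. tensor_lift K P (b x y) t) s"
  have "linear_map K (tensor_module K M' N') P ?g"
    using s mods b
    by (intro linear_tensor_lift_body[where M = M and N = N] tensor_lift_linear[where M = M' and N = N'])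
  then have "?g t = tensor_lift K P (\<lambda>u v. ?g (pure_tensor K M' N' u v)) t"
    using mods t by (intro tensor_linear_eq_lift)
  also have "\<dots> = tensor_lift K P (\<lambda>u v. tensor_lift K P (\<lambda>x y. b x y u v) s) t"
    by (intro tensor_lift_cong[OF t mods(3,4)] tensor_lift_cong[OF s mods(1,2)])
      (simp add: tensor_lift_pure[OF mods(3,4,5) b])
  finally show ?thesis .
qed

text \<open>
  Nested \<^const>\<open>tensor_lift\<close> expressions are handled by \<open>(assumption | rule multilinear)+\<close>, which
  decides closure and linearity in a bound variable by following the term structure. A rule
  \<open>linear_map K L N (\<lambda>z. f (g z))\<close> selects the unique argument in which \<open>z\<close> occurs.
\<close>

named_theorems multilinear

lemmas [multilinear] = bilinear_mapI linear_map_id linear_map_lift_arg linear_tensor_lift_body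
  bilinear_map_comp_left[OF bilinear_pure_tensor] bilinear_map_comp_right[OF bilinear_pure_tensor]
  bilinear_map_comp_left[OF bilinear_smult] bilinear_map_comp_right[OF bilinear_smult]
  tensor_lift_closed bilinear_map_closed[OF bilinear_pure_tensor] module_tensor

lemma tensor_lift_lift:
  assumes "t \<in> carrier (tensor_module K M N)" "bilinear_map K M' N' Q c"
    and "\<And>x y. x \<in> carrier M \<Longrightarrow> y \<in> carrier N \<Longrightarrow> b x y \<in> carrier (tensor_module K M' N')"
    and "module K M" "module K N" "module K M'" "module K N'" "module K Q"
  shows "tensor_lift K Q c (tensor_lift K (tensor_module K M' N') b t) =
    tensor_lift K Q (\<lambda>x y. tensor_lift K Q c (b x y)) t"
  using assms by (intro linear_tensor_lift[where M = M and N = N] tensor_lift_linear module_tensor)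

lemma tensor_lift_map:
  assumes t: "t \<in> carrier (tensor_module K M N)" and c: "bilinear_map K M' N' Q c"
    and f: "\<And>x. x \<in> carrier M \<Longrightarrow> f x \<in> carrier M'"
    and g: "\<And>y. y \<in> carrier N \<Longrightarrow> g y \<in> carrier N'"
    and mods: "module K M" "module K N" "module K M'" "module K N'" "module K Q"
  shows "tensor_lift K Q c (tensor_map K M' N' f g t) = tensor_lift K Q (\<lambda>x y. c (f x) (g y)) t"
proof -
  have "tensor_lift K Q c (tensor_map K M' N' f g t) =
      tensor_lift K Q (\<lambda>x y. tensor_lift K Q c (pure_tensor K M' N' (f x) (g y))) t"
    unfolding tensor_map_def
    by (intro tensor_lift_lift[OF t c] mods bilinear_map_closed[OF bilinear_pure_tensor] f g)
  also have "\<dots> = tensor_lift K Q (\<lambda>x y. c (f x) (g y)) t"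
    by (intro tensor_lift_cong[OF t mods(1,2)] tensor_lift_pure[OF mods(3-5) c] f g)
  finally show ?thesis .
qed

lemma tensor_lift_assoc:
  assumes t: "t \<in> carrier (tensor_module K (tensor_module K M N) P)"
    and mods [multilinear]: "module K M" "module K N" "module K P" "module K Q"
    and T [multilinear]: "\<And>x y. x \<in> carrier M \<Longrightarrow> y \<in> carrier N \<Longrightarrow> linear_map K P Q (\<lambda>z. T x y z)"
      "\<And>x z. x \<in> carrier M \<Longrightarrow> z \<in> carrier P \<Longrightarrow> linear_map K N Q (\<lambda>y. T x y z)"
      "\<And>y z. y \<in> carrier N \<Longrightarrow> z \<in> carrier P \<Longrightarrow> linear_map K M Q (\<lambda>x. T x y z)"
  shows "tensor_lift K Q (\<lambda>x s. tensor_lift K Q (\<lambda>y z. T x y z) s) (tensor_assoc K M N P t)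
    = tensor_lift K Q (\<lambda>s z. tensor_lift K Q (\<lambda>x y. T x y z) s) t"
proof -
  let ?g = "tensor_lift K Q (\<lambda>x s. tensor_lift K Q (\<lambda>y z. T x y z) s)"
  have "?g (tensor_assoc K M N P t) = 
     tensor_lift K Q (\<lambda>s z. ?g (tensor_lift K (tensor_module K M (tensor_module K N P)) (\<lambda>x y. pure_tensor K M (tensor_module K N P) x (pure_tensor K N P y z)) s)) t"
    unfolding tensor_assoc_def Let_def
    by (rule tensor_lift_lift[OF t]) (assumption | rule multilinear)+
  also have "\<dots> = tensor_lift K Q (\<lambda>s z. tensor_lift K Q (\<lambda>x y. ?g (pure_tensor K M (tensor_module K N P) x (pure_tensor K N P y z))) s) t"
    by (rule tensor_lift_cong[OF t], (assumption | rule multilinear)+, rule tensor_lift_lift) (assumption | rule multilinear)+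
  also have "\<dots> = tensor_lift K Q (\<lambda>s z. tensor_lift K Q (\<lambda>x y. T x y z) s) t"
    apply (rule tensor_lift_cong[OF t], (assumption | rule multilinear)+)
    apply (rule tensor_lift_cong, (assumption | rule multilinear)+)
    apply (subst tensor_lift_pure, (assumption | rule multilinear)+)
    apply (subst tensor_lift_pure, (assumption | rule multilinear refl)+)
    done
  finally show ?thesis .
qed

context hom_object
begin

lemma twist_closed: "x \<in> carrier M \<Longrightarrow> twist M x \<in> carrier M"
  using twist_linear by (rule linear_map_closed)

lemma inv_twist_closed: "x \<in> carrier M \<Longrightarrow> inv_twist M x \<in> carrier M"
  using twist_bij unfolding inv_twist_def by (auto simp: bij_betw_def intro: inv_into_into)

lemma twist_inv_twist: "x \<in> carrier M \<Longrightarrow> twist M (inv_twist M x) = x"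
  using twist_bij unfolding inv_twist_def by (auto simp: bij_betw_def intro: f_inv_into_f)

lemma inv_twist_twist: "x \<in> carrier M \<Longrightarrow> inv_twist M (twist M x) = x"
  using twist_bij unfolding inv_twist_def by (auto simp: bij_betw_def)

lemma inv_twist_eqI: "\<lbrakk>twist M x = y; x \<in> carrier M\<rbrakk> \<Longrightarrow> inv_twist M y = x"
  by (auto simp: inv_twist_twist)

lemma inv_twist_linear: "linear_map K M M (inv_twist M)"
  by (rule linear_mapI)
    (simp_all add: inv_twist_closed inv_twist_eqI twist_inv_twist
      linear_map_add[OF twist_linear] linear_map_smult[OF twist_linear])

lemmas hom_object_multilinear =
  linear_map_comp[OF twist_linear] linear_map_comp[OF inv_twist_linear]
  twist_closed inv_twist_closed module_axioms

end

section \<open>Untwisted coactions\<close>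

definition untwisted_act :: "('k, 'm, 's) hom_object_scheme \<Rightarrow> ('m \<Rightarrow> 'a \<Rightarrow> 'm) \<Rightarrow> 'm \<Rightarrow> 'a \<Rightarrow> 'm"
  where "untwisted_act M act m a = inv_twist M (act m a)"

definition untwisted_coact :: "('k, 'm, 's) hom_object_scheme \<Rightarrow> ('m \<Rightarrow> ('k, 'm, 'h) tensor)
    \<Rightarrow> 'm \<Rightarrow> ('k, 'm, 'h) tensor"
  where "untwisted_coact M \<rho> m = \<rho> (twist M m)"

locale hom_comodule = C: monoidal_hom_coalgebra K H + M: right_hom_comodule K H M \<rho>
  for K :: "('k, 'r) ring_scheme" and H :: "('k, 'h, 's) hom_bialgebra_scheme"
    and M :: "('k, 'm, 't) hom_object_scheme" and \<rho> :: "'m \<Rightarrow> ('k, 'm, 'h) tensor"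
begin

lemmas comodule_multilinear =
  C.hom_object_multilinear M.hom_object_multilinear
  linear_map_comp[OF M.coact_linear] linear_map_comp[OF C.comult_linear]
  linear_map_comp[OF C.counit_linear]
  linear_map_closed[OF M.coact_linear] linear_map_closed[OF C.comult_linear]
  linear_map_closed[OF C.counit_linear] module_base_module[OF C.R.is_cring]

declare comodule_multilinear [multilinear]

lemma untwisted_coact_linear: "linear_map K M (tensor_module K M H) (untwisted_coact M \<rho>)"
  unfolding untwisted_coact_def by (rule multilinear)+

lemma coact_twist_lift:
  assumes "module K Q" "bilinear_map K M H Q b" "m \<in> carrier M"
  shows "tensor_lift K Q b (\<rho> (twist M m)) =
    tensor_lift K Q (\<lambda>x h. b (twist M x) (twist H h)) (\<rho> m)"
  unfolding M.coact_twist[OF assms(3)]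
  by (rule tensor_lift_map) (assumption | rule assms multilinear)+

text \<open>Hom-coassociativity tested against a trilinear map. The inverse twist sits on the last
  leg on one side and on the first leg on the other; untwisting removes this asymmetry.\<close>

lemma coact_coassoc_lift:
  assumes m: "m \<in> carrier M"
    and Q [multilinear]: "module K Q"
    and T [multilinear]: "\<And>x y. x \<in> carrier M \<Longrightarrow> y \<in> carrier H \<Longrightarrow> linear_map K H Q (\<lambda>z. T x y z)"
      "\<And>x z. x \<in> carrier M \<Longrightarrow> z \<in> carrier H \<Longrightarrow> linear_map K H Q (\<lambda>y. T x y z)"
      "\<And>y z. y \<in> carrier H \<Longrightarrow> z \<in> carrier H \<Longrightarrow> linear_map K M Q (\<lambda>x. T x y z)"
  shows "tensor_lift K Q (\<lambda>x y. tensor_lift K Q (\<lambda>u v. T u v (inv_twist H y)) (\<rho> x)) (\<rho> m) =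
    tensor_lift K Q (\<lambda>x y. tensor_lift K Q (\<lambda>u v. T (inv_twist M x) u v) (comult H y)) (\<rho> m)"
proof -
  let ?g = "tensor_lift K Q (\<lambda>x s. tensor_lift K Q (\<lambda>y z. T x y z) s)"
  have rm: "\<rho> m \<in> carrier (tensor_module K M H)" using m by (rule multilinear)+
  have mem: "tensor_map K (tensor_module K M H) H \<rho> (inv_twist H) (\<rho> m)
      \<in> carrier (tensor_module K (tensor_module K M H) H)"
    unfolding tensor_map_def by (assumption | rule multilinear m)+
  have "tensor_lift K Q (\<lambda>x y. tensor_lift K Q (\<lambda>u v. T u v (inv_twist H y)) (\<rho> x)) (\<rho> m)
    = tensor_lift K Q (\<lambda>s z. tensor_lift K Q (\<lambda>x y. T x y z) s)
       (tensor_map K (tensor_module K M H) H \<rho> (inv_twist H) (\<rho> m))"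
    by (rule tensor_lift_map[OF rm, symmetric]) (assumption | rule multilinear)+
  also have "\<dots> = ?g (tensor_assoc K M H H (tensor_map K (tensor_module K M H) H \<rho> (inv_twist H) (\<rho> m)))"
    by (rule tensor_lift_assoc[OF mem, symmetric]) (assumption | rule multilinear)+
  also have "\<dots> = ?g (tensor_map K M (tensor_module K H H) (inv_twist M) (comult H) (\<rho> m))"
    by (simp only: M.coact_coassoc[OF m])
  also have "\<dots> = tensor_lift K Q (\<lambda>x y. tensor_lift K Q (\<lambda>u v. T (inv_twist M x) u v) (comult H y)) (\<rho> m)"
    by (rule tensor_lift_map[OF rm]) (assumption | rule multilinear)+
  finally show ?thesis .
qed

end

lemma (in monoidal_hom_coalgebra) counit_closed: "c \<in> carrier C \<Longrightarrow> counit C c \<in> carrier K"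
  using linear_map_closed[OF counit_linear] by (simp add: base_module_def)

text \<open>With H as a comodule over itself, each comodule result also yields a result on the
  comultiplication.\<close>

lemma (in monoidal_hom_coalgebra) comult_hom_comodule: "hom_comodule K C C (comult C)"
  by unfold_locales (simp_all add: comult_linear comult_twist hom_coassoc counit_right)

context hom_comodule
begin

abbreviation "R \<equiv> untwisted_coact M \<rho>"
abbreviation "D \<equiv> untwisted_coact H (comult H)"

interpretation C: hom_comodule K H H "comult H" by (rule C.comult_hom_comodule)

lemmas untwisted_comodule_multilinear =
  linear_map_comp[OF untwisted_coact_linear] linear_map_comp[OF C.untwisted_coact_linear]
  linear_map_closed[OF untwisted_coact_linear] linear_map_closed[OF C.untwisted_coact_linear]

declare untwisted_comodule_multilinear [multilinear]

lemma untwisted_coact_lift: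
  assumes "module K Q" "bilinear_map K M H Q b" "m \<in> carrier M"
  shows "tensor_lift K Q b (R m) = tensor_lift K Q (\<lambda>x h. b (twist M x) (twist H h)) (\<rho> m)"
  unfolding untwisted_coact_def using assms by (rule coact_twist_lift)

lemma untwisted_coact_twist_lift:
  assumes [multilinear]: "module K Q" "bilinear_map K M H Q b" "m \<in> carrier M"
  shows "tensor_lift K Q b (R (twist M m)) =
    tensor_lift K Q (\<lambda>x h. b (twist M x) (twist H h)) (R m)"
  unfolding untwisted_coact_def by (rule coact_twist_lift) (assumption | rule multilinear)+

end

context hom_comodule
begin

interpretation C: hom_comodule K H H "comult H" by (rule C.comult_hom_comodule)

lemma untwisted_coact_coassoc:
  assumes m [multilinear]: "m \<in> carrier M"
    and Q [multilinear]: "module K Q"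
    and T [multilinear]: "\<And>x y. x \<in> carrier M \<Longrightarrow> y \<in> carrier H \<Longrightarrow> linear_map K H Q (\<lambda>z. T x y z)"
      "\<And>x z. x \<in> carrier M \<Longrightarrow> z \<in> carrier H \<Longrightarrow> linear_map K H Q (\<lambda>y. T x y z)"
      "\<And>y z. y \<in> carrier H \<Longrightarrow> z \<in> carrier H \<Longrightarrow> linear_map K M Q (\<lambda>x. T x y z)"
  shows "tensor_lift K Q (\<lambda>x y. tensor_lift K Q (\<lambda>u v. T u v y) (R x)) (R m) =
    tensor_lift K Q (\<lambda>x y. tensor_lift K Q (\<lambda>u v. T x u v) (D y)) (R m)"
proof -
  note [multilinear] = linear_map_comp[OF T(1)] linear_map_comp[OF T(2)] linear_map_comp[OF T(3)]
  let ?t = "twist M" and ?s = "twist H"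
  have "tensor_lift K Q (\<lambda>x y. tensor_lift K Q (\<lambda>u v. T u v y) (R x)) (R m) =
      tensor_lift K Q (\<lambda>x y. tensor_lift K Q (\<lambda>u v. T u v (?s y)) (R (?t x))) (\<rho> m)"
    by (rule untwisted_coact_lift) (assumption | rule multilinear)+
  \<comment> \<open>One twist comes from \<open>R m\<close> and another from \<open>R\<close> at a
    twisted argument, so the first two legs carry two twists. The last leg has only one and is
    rewritten as two twists of \<open>inv_twist H y\<close>, which supplies the inverse twist of
    Hom-coassociativity.\<close>
  also have "\<dots> = tensor_lift K Q (\<lambda>x y. tensor_lift K Q
      (\<lambda>u v. T (?t (?t u)) (?s (?s v)) (?s (?s (inv_twist H y)))) (\<rho> x)) (\<rho> m)"
    apply (rule tensor_lift_cong, (assumption | rule multilinear)+)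
    apply (subst untwisted_coact_twist_lift, (assumption | rule multilinear)+)
    apply (subst untwisted_coact_lift, (assumption | rule multilinear)+)
    apply (simp add: C.twist_inv_twist)
    done
  also have "\<dots> = tensor_lift K Q (\<lambda>x y. tensor_lift K Q
      (\<lambda>u v. T (?t (?t (inv_twist M x))) (?s (?s u)) (?s (?s v))) (comult H y)) (\<rho> m)"
    by (rule coact_coassoc_lift) (assumption | rule multilinear)+
  also have "\<dots> = tensor_lift K Q (\<lambda>x y. tensor_lift K Q (\<lambda>u v. T (?t x) u v) (D (?s y))) (\<rho> m)"
    apply (rule tensor_lift_cong, (assumption | rule multilinear)+)
    apply (subst C.untwisted_coact_twist_lift, (assumption | rule multilinear)+)
    apply (subst C.untwisted_coact_lift, (assumption | rule multilinear)+)
    apply (simp add: M.twist_inv_twist)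
    done
  also have "\<dots> = tensor_lift K Q (\<lambda>x y. tensor_lift K Q (\<lambda>u v. T x u v) (D y)) (R m)"
    by (rule untwisted_coact_lift[symmetric]) (assumption | rule multilinear)+
  finally show ?thesis .
qed

text \<open>The counit axiom yields the inverse twist of m, and the twist inside \<open>R\<close>
  cancels it. The linear \<open>f\<close> lets the rule act inside a larger expression.\<close>

lemma untwisted_coact_counit:
  assumes m [multilinear]: "m \<in> carrier M"
    and Q [multilinear]: "module K Q" and f: "linear_map K M Q f"
  shows "tensor_lift K Q (\<lambda>x h. counit H h \<odot>\<^bsub>Q\<^esub> f x) (R m) = f m"
proof -
  note [multilinear] = linear_map_comp[OF f] linear_map_closed[OF f] M.smult_closed C.counit_closed
  have "tensor_lift K Q (\<lambda>x h. counit H h \<odot>\<^bsub>Q\<^esub> f x) (R m) =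
     tensor_lift K Q (\<lambda>x h. counit H (twist H h) \<odot>\<^bsub>Q\<^esub> f (twist M x)) (\<rho> m)"
    by (rule untwisted_coact_lift) (assumption | rule multilinear)+
  also have "\<dots> = tensor_lift K Q (\<lambda>x h. f (twist M (counit H h \<odot>\<^bsub>M\<^esub> x))) (\<rho> m)"
    by (rule tensor_lift_cong, (assumption | rule multilinear)+)
      (simp add: C.counit_twist C.counit_closed linear_map_smult[OF M.twist_linear]
        linear_map_smult[OF f] M.twist_closed)
  also have "\<dots> = f (twist M (tensor_lift K M (\<lambda>x h. counit H h \<odot>\<^bsub>M\<^esub> x) (\<rho> m)))"
    by (rule linear_tensor_lift[symmetric, where g = "\<lambda>x. f (twist M x)"]) (assumption | rule multilinear)+
  also have "\<dots> = f m"
    by (simp add: M.coact_counit M.twist_inv_twist m)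
  finally show ?thesis .
qed

end

text \<open>The counit on the first leg has no analogue for comodules, so this does not follow by
  specializing \<open>untwisted_coact_counit\<close> to H.\<close>

lemma (in monoidal_hom_coalgebra) untwisted_comult_counit_left:
  assumes c: "c \<in> carrier C" and Q: "module K Q" and f: "linear_map K C Q f"
  shows "tensor_lift K Q (\<lambda>x y. counit C x \<odot>\<^bsub>Q\<^esub> f y) (untwisted_coact C (comult C) c) = f c"
proof -
  interpret H: hom_comodule K C C "comult C" by (rule comult_hom_comodule)
  note [multilinear] = c Q linear_map_comp[OF f] linear_map_closed[OF f] smult_closed counit_closed
  have "tensor_lift K Q (\<lambda>x y. counit C x \<odot>\<^bsub>Q\<^esub> f y) (untwisted_coact C (comult C) c) =
     tensor_lift K Q (\<lambda>x y. counit C (twist C x) \<odot>\<^bsub>Q\<^esub> f (twist C y)) (comult C c)"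
    by (rule H.untwisted_coact_lift) (assumption | rule multilinear)+
  also have "\<dots> = tensor_lift K Q (\<lambda>x y. f (twist C (counit C x \<odot>\<^bsub>C\<^esub> y))) (comult C c)"
    by (rule tensor_lift_cong, (assumption | rule multilinear)+)
      (simp add: counit_twist counit_closed linear_map_smult[OF twist_linear]
        linear_map_smult[OF f] twist_closed)
  also have "\<dots> = f (twist C (tensor_lift K C (\<lambda>x y. counit C x \<odot>\<^bsub>C\<^esub> y) (comult C c)))"
    by (rule linear_tensor_lift[symmetric, where g = "\<lambda>x. f (twist C x)"]) (assumption | rule multilinear)+
  also have "\<dots> = f c"
    by (simp add: counit_left twist_inv_twist c)
  finally show ?thesis .
qed

section \<open>Untwisting Hom-Hopf algebras and relative Hom-Hopf modules\<close>

text \<open>The product is the untwisted action of A on itself by right multiplication, so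
  statements about untwisted actions specialize to \<star> without translation.\<close>

abbreviation untwisted_mult :: "('k, 'a, 's) hom_object_scheme \<Rightarrow> 'a \<Rightarrow> 'a \<Rightarrow> 'a"
  (infixl "\<star>\<index>" 70)
  where "untwisted_mult A \<equiv> untwisted_act A (mult A)"

context monoidal_hom_algebra
begin

lemma untwisted_mult_bilinear: "bilinear_map K A A A (untwisted_mult A)"
  unfolding untwisted_act_def
  by (intro bilinear_mapI linear_map_comp[OF inv_twist_linear] bilinear_map_right[OF mult_bilinear]
      bilinear_map_left[OF mult_bilinear])

text \<open>Pulling the inner inverse twist out of x \<otimes> \<open>inv_twist A\<close> (y
  \<otimes> z) puts a twist on x, and Hom-associativity speaks of exactly this product of twist x
  with y \<otimes> z.\<close>

lemma untwisted_mult_assoc: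
  assumes "x \<in> carrier A" "y \<in> carrier A" "z \<in> carrier A"
  shows "x \<star>\<^bsub>A\<^esub> (y \<star>\<^bsub>A\<^esub> z) = (x \<star>\<^bsub>A\<^esub> y) \<star>\<^bsub>A\<^esub> z"
proof -
  note c = bilinear_map_closed[OF mult_bilinear] inv_twist_closed
  have "x \<otimes>\<^bsub>A\<^esub> inv_twist A (y \<otimes>\<^bsub>A\<^esub> z) = inv_twist A (twist A x \<otimes>\<^bsub>A\<^esub> (y \<otimes>\<^bsub>A\<^esub> z))"
    using assms by (intro inv_twist_eqI[symmetric]) (simp_all add: twist_mult twist_inv_twist c)
  also have "\<dots> = inv_twist A ((x \<otimes>\<^bsub>A\<^esub> y) \<otimes>\<^bsub>A\<^esub> twist A z)"
    using assms by (simp add: hom_assoc)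
  also have "\<dots> = inv_twist A (x \<otimes>\<^bsub>A\<^esub> y) \<otimes>\<^bsub>A\<^esub> z"
    using assms by (intro inv_twist_eqI) (simp_all add: twist_mult twist_inv_twist c)
  finally show ?thesis by (simp add: untwisted_act_def)
qed

lemma untwisted_mult_unit: "x \<in> carrier A \<Longrightarrow> x \<star>\<^bsub>A\<^esub> \<one>\<^bsub>A\<^esub> = x"
  by (simp add: untwisted_act_def mult_unit inv_twist_twist)

lemma untwisted_unit_mult: "x \<in> carrier A \<Longrightarrow> \<one>\<^bsub>A\<^esub> \<star>\<^bsub>A\<^esub> x = x"
  by (simp add: untwisted_act_def unit_mult inv_twist_twist)

lemma untwisted_mult_twist:
  "x \<in> carrier A \<Longrightarrow> y \<in> carrier A \<Longrightarrow> twist A x \<star>\<^bsub>A\<^esub> twist A y = twist A (x \<star>\<^bsub>A\<^esub> y)"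
  by (simp add: untwisted_act_def twist_mult[symmetric] twist_inv_twist inv_twist_twist
      bilinear_map_closed[OF mult_bilinear])

end

text \<open>Multiplicativity of the coaction is the compatibility required of a relative Hom-Hopf
  module. This makes A an object at which statement (2) can be evaluated.\<close>

lemma (in right_hom_comodule_algebra) relative_self:
  "relative_hom_Hopf_module K H A \<rho> A (mult A) \<rho>"
  by unfold_locales
    (simp_all add: mult_bilinear twist_mult hom_assoc mult_unit coact_linear coact_twist
      coact_coassoc coact_counit coact_mult)

locale hom_relative =
  H: monoidal_hom_Hopf_algebra K H + A: right_hom_comodule_algebra K H A \<rho>A +
  M: relative_hom_Hopf_module K H A \<rho>A M act \<rho>
  for K :: "('k, 'r) ring_scheme" and H :: "('k, 'h, 's) hom_bialgebra_scheme"
    and A :: "('k, 'a, 't) hom_object_scheme" and \<rho>A :: "'a \<Rightarrow> ('k, 'a, 'h) tensor"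
    and M :: "('k, 'm, 'u) hom_object_scheme"
    and act :: "'m \<Rightarrow> 'a \<Rightarrow> 'm" and \<rho> :: "'m \<Rightarrow> ('k, 'm, 'h) tensor"

text \<open>Taking A and M to be H, the compatibility of coaction and action becomes the
  multiplicativity of \<Delta>, so no separate untwisting for the bialgebra structure has to be
  done.\<close>

lemma (in monoidal_hom_Hopf_algebra) hom_relative_self:
  "hom_relative K H H (comult H) H (mult H) (comult H)"
proof -
  interpret H: hom_comodule K H H "comult H" by (rule comult_hom_comodule)
  interpret A: right_hom_comodule_algebra K H H "comult H"
    by unfold_locales (simp_all add: comult_mult comult_unit)
  interpret M: relative_hom_Hopf_module K H H "comult H" H "mult H" "comult H"
    by (rule A.relative_self)
  show ?thesis by unfold_locales
qed

sublocale hom_relative \<subseteq> M: hom_comodule K H M \<rho>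
  by unfold_locales

sublocale hom_relative \<subseteq> A: hom_comodule K H A \<rho>A
  by unfold_locales

context hom_relative
begin

abbreviation "act' \<equiv> untwisted_act M act"

lemma untwisted_act_bilinear: "bilinear_map K M A M act'"
  unfolding untwisted_act_def
  by (intro bilinear_mapI linear_map_comp[OF M.inv_twist_linear] bilinear_map_right[OF M.act_bilinear]
      bilinear_map_left[OF M.act_bilinear])

lemma untwisted_act_unit: "m \<in> carrier M \<Longrightarrow> act' m \<one>\<^bsub>A\<^esub> = m"
  by (simp add: untwisted_act_def M.act_unit M.inv_twist_twist)

lemma untwisted_act_twist:
  "m \<in> carrier M \<Longrightarrow> a \<in> carrier A \<Longrightarrow> act' (twist M m) (twist A a) = twist M (act' m a)"
  by (simp add: untwisted_act_def M.act_twist[symmetric] M.twist_inv_twist M.inv_twist_twist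
      bilinear_map_closed[OF M.act_bilinear])

lemmas relative_multilinear =
  bilinear_map_comp_left[OF untwisted_act_bilinear] bilinear_map_comp_right[OF untwisted_act_bilinear]
  bilinear_map_comp_left[OF H.untwisted_mult_bilinear] bilinear_map_comp_right[OF H.untwisted_mult_bilinear]
  bilinear_map_closed[OF untwisted_act_bilinear] bilinear_map_closed[OF H.untwisted_mult_bilinear]
  bilinear_map_comp_left[OF M.act_bilinear] bilinear_map_comp_right[OF M.act_bilinear]
  bilinear_map_closed[OF M.act_bilinear]
  bilinear_map_comp_left[OF H.mult_bilinear] bilinear_map_comp_right[OF H.mult_bilinear]
  bilinear_map_closed[OF H.mult_bilinear]
  H.unit_closed A.unit_closed

declare relative_multilinear [multilinear]

lemma untwisted_coact_act:
  assumes [multilinear]: "m \<in> carrier M" "a \<in> carrier A" "module K Q" and b: "bilinear_map K M H Q b"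
  shows "tensor_lift K Q b (M.R (act' m a)) =
    tensor_lift K Q (\<lambda>x h. tensor_lift K Q (\<lambda>y k. b (act' x y) (h \<star>\<^bsub>H\<^esub> k)) (A.R a)) (M.R m)"
proof -
  note [multilinear] = b bilinear_map_comp_left[OF b] bilinear_map_comp_right[OF b]
  have "tensor_lift K Q b (M.R (act' m a)) = tensor_lift K Q b (\<rho> (act m a))"
    using assms(1,2) by (simp add: untwisted_coact_def untwisted_act_def M.twist_inv_twist
        bilinear_map_closed[OF M.act_bilinear])
  also have "\<dots> = tensor_lift K Q (\<lambda>x h. tensor_lift K Q b
      (tensor_lift K (tensor_module K M H) (\<lambda>y k. pure_tensor K M H (act x y) (h \<otimes>\<^bsub>H\<^esub> k)) (\<rho>A a))) (\<rho> m)"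
    unfolding M.coact_act[OF assms(1,2)] tensor_times_def
    by (rule tensor_lift_lift) (assumption | rule multilinear)+
  also have "\<dots> = tensor_lift K Q (\<lambda>x h. tensor_lift K Q
      (\<lambda>y k. tensor_lift K Q b (pure_tensor K M H (act x y) (h \<otimes>\<^bsub>H\<^esub> k))) (\<rho>A a)) (\<rho> m)"
    by (rule tensor_lift_cong, (assumption | rule multilinear)+, rule tensor_lift_lift)
      (assumption | rule multilinear)+
  also have "\<dots> = tensor_lift K Q (\<lambda>x h. tensor_lift K Q
      (\<lambda>y k. b (act x y) (h \<otimes>\<^bsub>H\<^esub> k)) (\<rho>A a)) (\<rho> m)"
    by (rule tensor_lift_cong, (assumption | rule multilinear)+, rule tensor_lift_cong,
        (assumption | rule multilinear)+, rule tensor_lift_pure) (assumption | rule multilinear)+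
  \<comment> \<open>By definition the untwisted action of twisted arguments is the original action
    of the arguments, and likewise for \<star>. The twists introduced here are those that convert
    \<open>\<rho>A\<close> and \<open>\<rho>\<close> into \<open>A.R\<close> and
    \<open>M.R\<close>.\<close>
  also have "\<dots> = tensor_lift K Q (\<lambda>x h. tensor_lift K Q
      (\<lambda>y k. b (act' (twist M x) (twist A y)) (twist H h \<star>\<^bsub>H\<^esub> twist H k)) (\<rho>A a)) (\<rho> m)"
    by (rule tensor_lift_cong, (assumption | rule multilinear)+, rule tensor_lift_cong,
        (assumption | rule multilinear)+)
      (simp add: untwisted_act_def M.act_twist[symmetric] H.twist_mult[symmetric] M.inv_twist_twist
        H.inv_twist_twist bilinear_map_closed[OF M.act_bilinear] bilinear_map_closed[OF H.mult_bilinear])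
  also have "\<dots> = tensor_lift K Q (\<lambda>x h. tensor_lift K Q
      (\<lambda>y k. b (act' (twist M x) y) (twist H h \<star>\<^bsub>H\<^esub> k)) (A.R a)) (\<rho> m)"
    by (rule tensor_lift_cong, (assumption | rule multilinear)+,
        rule A.untwisted_coact_lift[symmetric]) (assumption | rule multilinear)+
  also have "\<dots> = tensor_lift K Q (\<lambda>x h. tensor_lift K Q
      (\<lambda>y k. b (act' x y) (h \<star>\<^bsub>H\<^esub> k)) (A.R a)) (M.R m)"
    by (rule M.untwisted_coact_lift[symmetric]) (assumption | rule multilinear)+
  finally show ?thesis .
qed

end

section \<open>The antipode\<close>

locale hom_relative_antipode = hom_relative +
  fixes S
  assumes antipode: "antipode K H S"
begin

interpretation HH: hom_relative K H H "comult H" H "mult H" "comult H"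
  by (rule H.hom_relative_self)

lemma antipode_linear: "linear_map K H H S"
  using antipode by (simp add: antipode_def)

lemma antipode_twist: "h \<in> carrier H \<Longrightarrow> S (twist H h) = twist H (S h)"
  using antipode by (simp add: antipode_def)

lemmas antipode_multilinear = linear_map_comp[OF antipode_linear] linear_map_closed[OF antipode_linear]

declare antipode_multilinear [multilinear]

abbreviation "D \<equiv> untwisted_coact H (comult H)"

text \<open>S commutes with the twist, so the twists introduced by \<open>D\<close> cancel the
  inverse twist in \<star>, and the antipode axiom itself remains. The linear \<open>f\<close> again
  allows use inside larger terms.\<close>

lemma untwisted_antipode_left:
  assumes [multilinear]: "h \<in> carrier H" "module K Q" and f: "linear_map K H Q f"
  shows "tensor_lift K Q (\<lambda>x y. f (S x \<star>\<^bsub>H\<^esub> y)) (D h) = counit H h \<odot>\<^bsub>Q\<^esub> f \<one>\<^bsub>H\<^esub>"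
proof -
  note [multilinear] = linear_map_comp[OF f] linear_map_closed[OF f]
  have "tensor_lift K Q (\<lambda>x y. f (S x \<star>\<^bsub>H\<^esub> y)) (D h) =
      tensor_lift K Q (\<lambda>x y. f (S (twist H x) \<star>\<^bsub>H\<^esub> twist H y)) (comult H h)"
    by (rule HH.M.untwisted_coact_lift) (assumption | rule multilinear)+
  also have "\<dots> = tensor_lift K Q (\<lambda>x y. f (S x \<otimes>\<^bsub>H\<^esub> y)) (comult H h)"
    by (rule tensor_lift_cong, (assumption | rule multilinear)+)
      (simp add: antipode_twist untwisted_act_def H.twist_mult[symmetric] H.inv_twist_twist
        linear_map_closed[OF antipode_linear] bilinear_map_closed[OF H.mult_bilinear])
  also have "\<dots> = f (tensor_lift K H (\<lambda>x y. S x \<otimes>\<^bsub>H\<^esub> y) (comult H h))"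
    by (rule linear_tensor_lift[symmetric]) (assumption | rule multilinear f)+
  also have "\<dots> = counit H h \<odot>\<^bsub>Q\<^esub> f \<one>\<^bsub>H\<^esub>"
    using antipode assms(1) by (simp add: antipode_def linear_map_smult[OF f] H.counit_closed H.unit_closed)
  finally show ?thesis .
qed

lemma untwisted_antipode_right:
  assumes [multilinear]: "h \<in> carrier H" "module K Q" and f: "linear_map K H Q f"
  shows "tensor_lift K Q (\<lambda>x y. f (x \<star>\<^bsub>H\<^esub> S y)) (D h) = counit H h \<odot>\<^bsub>Q\<^esub> f \<one>\<^bsub>H\<^esub>"
proof -
  note [multilinear] = linear_map_comp[OF f] linear_map_closed[OF f]
  have "tensor_lift K Q (\<lambda>x y. f (x \<star>\<^bsub>H\<^esub> S y)) (D h) =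
      tensor_lift K Q (\<lambda>x y. f (twist H x \<star>\<^bsub>H\<^esub> S (twist H y))) (comult H h)"
    by (rule HH.M.untwisted_coact_lift) (assumption | rule multilinear)+
  also have "\<dots> = tensor_lift K Q (\<lambda>x y. f (x \<otimes>\<^bsub>H\<^esub> S y)) (comult H h)"
    by (rule tensor_lift_cong, (assumption | rule multilinear)+)
      (simp add: antipode_twist untwisted_act_def H.twist_mult[symmetric] H.inv_twist_twist
        linear_map_closed[OF antipode_linear] bilinear_map_closed[OF H.mult_bilinear])
  also have "\<dots> = f (tensor_lift K H (\<lambda>x y. x \<otimes>\<^bsub>H\<^esub> S y) (comult H h))"
    by (rule linear_tensor_lift[symmetric]) (assumption | rule multilinear f)+
  also have "\<dots> = counit H h \<odot>\<^bsub>Q\<^esub> f \<one>\<^bsub>H\<^esub>"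
    using antipode assms(1) by (simp add: antipode_def linear_map_smult[OF f] H.counit_closed H.unit_closed)
  finally show ?thesis .
qed

lemma untwisted_comult_unit:
  assumes "module K Q" "bilinear_map K H H Q b"
  shows "tensor_lift K Q b (D \<one>\<^bsub>H\<^esub>) = b \<one>\<^bsub>H\<^esub> \<one>\<^bsub>H\<^esub>"
  unfolding untwisted_coact_def H.twist_unit H.comult_unit
  using assms by (intro tensor_lift_pure H.module_axioms H.unit_closed)

text \<open>In Sweedler notation \<open>S(a\<^sub>2)\<^sub>1 \<otimes> a\<^sub>1 S(a\<^sub>2)\<^sub>2 = S(a) \<otimes> 1\<close>. It replaces the
  anti-comultiplicativity of the antipode.\<close>

lemma comult_antipode:
  assumes a [multilinear]: "a \<in> carrier H" and Q [multilinear]: "module K Q"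
    and b: "bilinear_map K H H Q b"
  shows "tensor_lift K Q (\<lambda>x y. tensor_lift K Q (\<lambda>u v. b u (x \<star>\<^bsub>H\<^esub> v)) (D (S y))) (D a) = b (S a) \<one>\<^bsub>H\<^esub>"
proof -
  note [multilinear] = bilinear_map_closed[OF b] bilinear_map_comp_left[OF b] bilinear_map_comp_right[OF b]
  \<comment> \<open>At the unit, \<open>?G x\<close> has the value b (S x) 1. That unit is expanded
    as a2 \<star> S(a3); comultiplying this product gives \<open>?W\<close> in four legs a1, a2, a3,
    a4. Coassociativity then groups a1 with a2, and S(a1) \<star> a2 collapses to a counit, leaving
    \<open>?f a\<close> at the unit.\<close>
  let ?G = "\<lambda>x z. tensor_lift K Q (\<lambda>u v. b (S x \<star>\<^bsub>H\<^esub> u) v) (D z)"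
  let ?W = "\<lambda>x p q r. tensor_lift K Q (\<lambda>u v. b (S x \<star>\<^bsub>H\<^esub> (p \<star>\<^bsub>H\<^esub> u)) (q \<star>\<^bsub>H\<^esub> v)) (D (S r))"
  let ?f = "\<lambda>r z. tensor_lift K Q (\<lambda>p q. tensor_lift K Q (\<lambda>u v. b (z \<star>\<^bsub>H\<^esub> u) (p \<star>\<^bsub>H\<^esub> v)) (D (S q))) (D r)"
  have "b (S a) \<one>\<^bsub>H\<^esub> = tensor_lift K Q (\<lambda>x y. counit H y \<odot>\<^bsub>Q\<^esub> b (S x) \<one>\<^bsub>H\<^esub>) (D a)"
    by (rule HH.M.untwisted_coact_counit[symmetric]) (assumption | rule multilinear)+
  also have "\<dots> = tensor_lift K Q (\<lambda>x y. counit H y \<odot>\<^bsub>Q\<^esub> ?G x \<one>\<^bsub>H\<^esub>) (D a)"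
    apply (rule tensor_lift_cong, (assumption | rule multilinear)+)
    apply (subst untwisted_comult_unit, (assumption | rule multilinear)+)
    apply (simp add: H.untwisted_mult_unit linear_map_closed[OF antipode_linear])
    done
  also have "\<dots> = tensor_lift K Q (\<lambda>x y. tensor_lift K Q (\<lambda>p q. ?G x (p \<star>\<^bsub>H\<^esub> S q)) (D y)) (D a)"
    by (rule tensor_lift_cong, (assumption | rule multilinear)+, rule untwisted_antipode_right[symmetric])
      (assumption | rule multilinear)+
  also have "\<dots> = tensor_lift K Q (\<lambda>x y. tensor_lift K Q (\<lambda>s r. tensor_lift K Q (\<lambda>p q. ?W x p q r) (D s)) (D y)) (D a)"
    by (rule tensor_lift_cong, (assumption | rule multilinear)+, rule tensor_lift_cong,
        (assumption | rule multilinear)+, rule HH.untwisted_coact_act) (assumption | rule multilinear)+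
  also have "\<dots> = tensor_lift K Q (\<lambda>x y. tensor_lift K Q (\<lambda>p s. tensor_lift K Q (\<lambda>q r. ?W x p q r) (D s)) (D y)) (D a)"
    by (rule tensor_lift_cong, (assumption | rule multilinear)+, rule HH.M.untwisted_coact_coassoc)
      (assumption | rule multilinear)+
  also have "\<dots> = tensor_lift K Q (\<lambda>y s. tensor_lift K Q (\<lambda>x p. tensor_lift K Q (\<lambda>q r. ?W x p q r) (D s)) (D y)) (D a)"
    by (rule HH.M.untwisted_coact_coassoc[symmetric]) (assumption | rule multilinear)+
  also have "\<dots> = tensor_lift K Q (\<lambda>y s. tensor_lift K Q (\<lambda>x p. ?f s (S x \<star>\<^bsub>H\<^esub> p)) (D y)) (D a)"
    apply (rule tensor_lift_cong, (assumption | rule multilinear)+)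
    apply (rule tensor_lift_cong, (assumption | rule multilinear)+)
    apply (rule tensor_lift_cong, (assumption | rule multilinear)+)
    apply (rule tensor_lift_cong, (assumption | rule multilinear)+)
    apply (simp add: H.untwisted_mult_assoc linear_map_closed[OF antipode_linear])
    done
  also have "\<dots> = tensor_lift K Q (\<lambda>y s. counit H y \<odot>\<^bsub>Q\<^esub> ?f s \<one>\<^bsub>H\<^esub>) (D a)"
    by (rule tensor_lift_cong, (assumption | rule multilinear)+, rule untwisted_antipode_left)
      (assumption | rule multilinear)+
  also have "\<dots> = ?f a \<one>\<^bsub>H\<^esub>"
    by (rule H.untwisted_comult_counit_left) (assumption | rule multilinear)+
  also have "\<dots> = tensor_lift K Q (\<lambda>x y. tensor_lift K Q (\<lambda>u v. b u (x \<star>\<^bsub>H\<^esub> v)) (D (S y))) (D a)"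
    apply (rule tensor_lift_cong, (assumption | rule multilinear)+)
    apply (rule tensor_lift_cong, (assumption | rule multilinear)+)
    apply (simp add: H.untwisted_unit_mult)
    done
  finally show ?thesis by (rule sym)
qed

text \<open>The form in which the antipode enters the colinearity of \<lambda>': the factor h is
  absorbed into the test map \<open>?b\<close>, to which \<open>comult_antipode\<close>
  applies.\<close>

lemma comult_antipode_mult:
  assumes a [multilinear]: "a \<in> carrier H" and h [multilinear]: "h \<in> carrier H"
    and Q [multilinear]: "module K Q" and b: "bilinear_map K H H Q b"
  shows "tensor_lift K Q (\<lambda>x y. tensor_lift K Q (\<lambda>u v. b u (x \<star>\<^bsub>H\<^esub> v)) (D (S y \<star>\<^bsub>H\<^esub> h))) (D a) =
    tensor_lift K Q (\<lambda>u v. b (S a \<star>\<^bsub>H\<^esub> u) v) (D h)"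
proof -
  note [multilinear] = bilinear_map_closed[OF b] bilinear_map_comp_left[OF b] bilinear_map_comp_right[OF b]
  let ?b = "\<lambda>p q. tensor_lift K Q (\<lambda>u v. b (p \<star>\<^bsub>H\<^esub> u) (q \<star>\<^bsub>H\<^esub> v)) (D h)"
  have "tensor_lift K Q (\<lambda>x y. tensor_lift K Q (\<lambda>u v. b u (x \<star>\<^bsub>H\<^esub> v)) (D (S y \<star>\<^bsub>H\<^esub> h))) (D a) =
      tensor_lift K Q (\<lambda>x y. tensor_lift K Q (\<lambda>p q. tensor_lift K Q (\<lambda>u v. b (p \<star>\<^bsub>H\<^esub> u) (x \<star>\<^bsub>H\<^esub> (q \<star>\<^bsub>H\<^esub> v))) (D h)) (D (S y))) (D a)"
    by (rule tensor_lift_cong, (assumption | rule multilinear)+, rule HH.untwisted_coact_act)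
      (assumption | rule multilinear)+
  also have "\<dots> = tensor_lift K Q (\<lambda>x y. tensor_lift K Q (\<lambda>p q. ?b p (x \<star>\<^bsub>H\<^esub> q)) (D (S y))) (D a)"
    apply (rule tensor_lift_cong, (assumption | rule multilinear)+)
    apply (rule tensor_lift_cong, (assumption | rule multilinear)+)
    apply (rule tensor_lift_cong, (assumption | rule multilinear)+)
    apply (simp add: H.untwisted_mult_assoc)
    done
  also have "\<dots> = ?b (S a) \<one>\<^bsub>H\<^esub>"
    by (rule comult_antipode) (assumption | rule multilinear)+
  also have "\<dots> = tensor_lift K Q (\<lambda>u v. b (S a \<star>\<^bsub>H\<^esub> u) v) (D h)"
    by (rule tensor_lift_cong, (assumption | rule multilinear)+) (simp add: H.untwisted_unit_mult)
  finally show ?thesis .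
qed

end

section \<open>Linear maps between tensor products\<close>

lemma tensor_linear_ext:
  assumes "linear_map K (tensor_module K M N) P f" "linear_map K (tensor_module K M N) P g"
    and "\<And>x y. x \<in> carrier M \<Longrightarrow> y \<in> carrier N \<Longrightarrow> f (pure_tensor K M N x y) = g (pure_tensor K M N x y)"
    and "t \<in> carrier (tensor_module K M N)" "module K M" "module K N" "module K P"
  shows "f t = g t"
  using assms tensor_linear_eq_lift[of K M N P f t] tensor_linear_eq_lift[of K M N P g t]
    tensor_lift_cong[of t K M N "\<lambda>x y. f (pure_tensor K M N x y)" "\<lambda>x y. g (pure_tensor K M N x y)" P]
  by simp

lemma tensor_map_linear:
  assumes [multilinear]: "module K M" "module K N" "module K P" "module K Q"
    and f: "linear_map K M P f" and g: "linear_map K N Q g"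
  shows "linear_map K (tensor_module K M N) (tensor_module K P Q) (tensor_map K P Q f g)"
proof -
  note [multilinear] = linear_map_comp[OF f] linear_map_comp[OF g]
    linear_map_closed[OF f] linear_map_closed[OF g]
  show ?thesis unfolding tensor_map_def by (assumption | rule multilinear)+
qed

lemma tensor_map_pure:
  assumes [multilinear]: "module K M" "module K N" "module K P" "module K Q"
    and f: "linear_map K M P f" and g: "linear_map K N Q g"
    and "x \<in> carrier M" "y \<in> carrier N"
  shows "tensor_map K P Q f g (pure_tensor K M N x y) = pure_tensor K P Q (f x) (g y)"
proof -
  note [multilinear] = linear_map_comp[OF f] linear_map_comp[OF g]
    linear_map_closed[OF f] linear_map_closed[OF g]
  show ?thesis unfolding tensor_map_def
    by (rule tensor_lift_pure) (assumption | rule multilinear assms)+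
qed

section \<open>The retraction defined by a total integral\<close>

text \<open>The coaction component of \<open>induced\<close>, separated from the action and from
  \<open>\<rho>A\<close>, on which it does not depend.\<close>

definition induced_coact ::
  "('k, 'r) ring_scheme \<Rightarrow> ('k, 'h, 's) hom_bialgebra_scheme \<Rightarrow> ('k, 'm, 'u) hom_object_scheme
    \<Rightarrow> ('k, 'm, 'h) tensor \<Rightarrow> ('k, ('k, 'm, 'h) tensor, 'h) tensor"
  where "induced_coact K H M =
    tensor_lift K (tensor_module K (tensor_module K M H) H)
      (\<lambda>m h. tensor_lift K (tensor_module K (tensor_module K M H) H)
        (\<lambda>h1 h2. pure_tensor K (tensor_module K M H) H
          (pure_tensor K M H (inv_twist M m) h1) (twist H h2)) (comult H h))"

context hom_comodule
begin

interpretation C: hom_comodule K H H "comult H" by (rule C.comult_hom_comodule)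

lemma induced_coact_linear:
  "linear_map K (tensor_module K M H) (tensor_module K (tensor_module K M H) H) (induced_coact K H M)"
  unfolding induced_coact_def by (assumption | rule multilinear)+

lemma induced_coact_pure:
  assumes "m \<in> carrier M" "h \<in> carrier H"
  shows "induced_coact K H M (pure_tensor K M H m h) =
    tensor_lift K (tensor_module K (tensor_module K M H) H)
      (\<lambda>h1 h2. pure_tensor K (tensor_module K M H) H
        (pure_tensor K M H (inv_twist M m) h1) (twist H h2)) (comult H h)"
  unfolding induced_coact_def by (rule tensor_lift_pure) (assumption | rule multilinear assms)+

end

text \<open>The outer \<open>twist M\<close> is the factor \<mu> in \<lambda> = \<mu> \<lambda>'.
  All data are explicit arguments, so that the maps for two different modules can be compared when
  naturality is proved.\<close>

definition integral_retraction ::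
  "('k, 'r) ring_scheme \<Rightarrow> ('k, 'h, 's) hom_bialgebra_scheme \<Rightarrow> ('h \<Rightarrow> 'h) \<Rightarrow> ('h \<Rightarrow> 'a)
    \<Rightarrow> ('k, 'm, 'u) hom_object_scheme \<Rightarrow> ('m \<Rightarrow> 'a \<Rightarrow> 'm) \<Rightarrow> ('m \<Rightarrow> ('k, 'm, 'h) tensor)
    \<Rightarrow> ('k, 'm, 'h) tensor \<Rightarrow> 'm"
  where "integral_retraction K H S \<phi> M act \<rho> = tensor_lift K M (\<lambda>m h. twist M (tensor_lift K M
    (\<lambda>x y. untwisted_act M act x (\<phi> (S y \<star>\<^bsub>H\<^esub> h))) (untwisted_coact M \<rho> m)))"

locale hom_relative_integral = hom_relative_antipode +
  fixes \<phi>
  assumes integral: "total_integral K H A \<rho>A \<phi>"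
begin

interpretation HH: hom_relative K H H "comult H" H "mult H" "comult H"
  by (rule H.hom_relative_self)

lemma integral_linear: "linear_map K H A \<phi>"
  and integral_twist: "h \<in> carrier H \<Longrightarrow> \<phi> (twist H h) = twist A (\<phi> h)"
  and integral_unit: "\<phi> \<one>\<^bsub>H\<^esub> = \<one>\<^bsub>A\<^esub>"
  and integral_coact: "h \<in> carrier H \<Longrightarrow> \<rho>A (\<phi> h) = tensor_map K A H \<phi> id (comult H h)"
  using integral by (auto simp: total_integral_def)

lemmas integral_multilinear = linear_map_comp[OF integral_linear] linear_map_closed[OF integral_linear]

declare integral_multilinear [multilinear]

text \<open>Because \<phi> commutes with the twists, the untwisted coaction at \<phi>(h) is
  \<open>\<rho>A\<close> at \<phi> of the twisted h, where the colinearity of \<phi>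
  applies.\<close>

lemma untwisted_coact_integral:
  assumes [multilinear]: "h \<in> carrier H" "module K Q" and b: "bilinear_map K A H Q b"
  shows "tensor_lift K Q b (A.R (\<phi> h)) = tensor_lift K Q (\<lambda>x y. b (\<phi> x) y) (D h)"
proof -
  have h: "twist H h \<in> carrier H" by (rule multilinear assms)+
  have c: "comult H (twist H h) \<in> carrier (tensor_module K H H)" by (rule multilinear assms)+
  have "tensor_lift K Q b (A.R (\<phi> h)) = tensor_lift K Q b (tensor_map K A H \<phi> id (comult H (twist H h)))"
    using assms(1) h by (simp add: untwisted_coact_def integral_twist[symmetric] integral_coact)
  also have "\<dots> = tensor_lift K Q (\<lambda>x y. b (\<phi> x) (id y)) (comult H (twist H h))"
    by (rule tensor_lift_map[OF c b]) (simp | rule multilinear)+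
  finally show ?thesis by (simp add: untwisted_coact_def)
qed

text \<open>The untwisted retraction \<lambda>', as a bilinear map.\<close>

abbreviation "lam m h \<equiv> tensor_lift K M (\<lambda>x y. act' x (\<phi> (S y \<star>\<^bsub>H\<^esub> h))) (M.R m)"

lemma lam_bilinear: "bilinear_map K M H M lam"
  by (assumption | rule multilinear)+

lemmas lam_multilinear = bilinear_map_closed[OF lam_bilinear]
  bilinear_map_comp_left[OF lam_bilinear] bilinear_map_comp_right[OF lam_bilinear]

text \<open>The equation that carries results from \<lambda>' to \<lambda>: it moves \<mu> through
  \<lambda>' in all three properties of the retraction below.\<close>

lemma lam_twist:
  assumes [multilinear]: "m \<in> carrier M" "h \<in> carrier H"
  shows "twist M (lam m h) = lam (twist M m) (twist H h)"
proof -
  have "twist M (lam m h) = tensor_lift K M (\<lambda>x y. twist M (act' x (\<phi> (S y \<star>\<^bsub>H\<^esub> h)))) (M.R m)"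
    by (rule linear_tensor_lift) (assumption | rule M.twist_linear multilinear)+
  also have "\<dots> = tensor_lift K M (\<lambda>x y. act' (twist M x) (\<phi> (S (twist H y) \<star>\<^bsub>H\<^esub> twist H h))) (M.R m)"
    by (rule tensor_lift_cong, (assumption | rule multilinear)+)
      (simp add: assms antipode_twist H.untwisted_mult_twist integral_twist untwisted_act_twist
        linear_map_closed[OF antipode_linear] bilinear_map_closed[OF H.untwisted_mult_bilinear]
        linear_map_closed[OF integral_linear])
  also have "\<dots> = lam (twist M m) (twist H h)"
    by (rule M.untwisted_coact_twist_lift[symmetric]) (assumption | rule multilinear)+
  finally show ?thesis .
qed

text \<open>Coassociativity gives m0 \<phi>(S(m1) \<star> m2), which the antipode reduces to
  \<epsilon>(m1) m0 \<phi>(1). The normalization \<phi>(1) = 1 enters here.\<close>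

lemma lam_coact_unit:
  assumes [multilinear]: "m \<in> carrier M"
  shows "tensor_lift K M lam (M.R m) = m"
proof -
  have "tensor_lift K M lam (M.R m) = tensor_lift K M (\<lambda>x n. tensor_lift K M
      (\<lambda>p q. act' x (\<phi> (S p \<star>\<^bsub>H\<^esub> q))) (D n)) (M.R m)"
    by (rule M.untwisted_coact_coassoc) (assumption | rule multilinear)+
  also have "\<dots> = tensor_lift K M (\<lambda>x n. counit H n \<odot>\<^bsub>M\<^esub> act' x (\<phi> \<one>\<^bsub>H\<^esub>)) (M.R m)"
    by (rule tensor_lift_cong, (assumption | rule multilinear)+, rule untwisted_antipode_left)
      (assumption | rule multilinear)+
  also have "\<dots> = tensor_lift K M (\<lambda>x n. counit H n \<odot>\<^bsub>M\<^esub> x) (M.R m)"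
    by (rule tensor_lift_cong, (assumption | rule multilinear)+)
      (simp add: integral_unit untwisted_act_unit)
  also have "\<dots> = m"
    by (rule M.untwisted_coact_counit) (assumption | rule multilinear)+
  finally show ?thesis .
qed

text \<open>Colinearity of \<phi> turns the coaction of m0 \<phi>(S(m1) \<star> h) into m0
  \<phi>((S(m2) \<star> h)1) \<otimes> m1 \<star> (S(m2) \<star> h)2, and the antipode identity
  reduces this to m0 \<phi>(S(m1) \<star> h1) \<otimes> h2.\<close>

lemma coact_lam:
  assumes [multilinear]: "m \<in> carrier M" "h \<in> carrier H" "module K Q" and b: "bilinear_map K M H Q b"
  shows "tensor_lift K Q b (M.R (lam m h)) = tensor_lift K Q (\<lambda>u v. b (lam m u) v) (D h)"
proof -
  note [multilinear] = bilinear_map_closed[OF b] bilinear_map_comp_left[OF b] bilinear_map_comp_right[OF b]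
  have "tensor_lift K Q b (M.R (lam m h)) = 
      tensor_lift K Q (\<lambda>x y. tensor_lift K Q b (M.R (act' x (\<phi> (S y \<star>\<^bsub>H\<^esub> h))))) (M.R m)"
    by (rule linear_tensor_lift) (assumption | rule multilinear)+
  also have "\<dots> = tensor_lift K Q (\<lambda>z y. tensor_lift K Q (\<lambda>x n. tensor_lift K Q (\<lambda>a c.
      b (act' x a) (n \<star>\<^bsub>H\<^esub> c)) (A.R (\<phi> (S y \<star>\<^bsub>H\<^esub> h)))) (M.R z)) (M.R m)"
    by (rule tensor_lift_cong, (assumption | rule multilinear)+, rule untwisted_coact_act)
      (assumption | rule multilinear)+
  also have "\<dots> = tensor_lift K Q (\<lambda>z y. tensor_lift K Q (\<lambda>x n. tensor_lift K Q (\<lambda>u v.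
      b (act' x (\<phi> u)) (n \<star>\<^bsub>H\<^esub> v)) (D (S y \<star>\<^bsub>H\<^esub> h))) (M.R z)) (M.R m)"
    by (rule tensor_lift_cong, (assumption | rule multilinear)+, rule tensor_lift_cong,
        (assumption | rule multilinear)+, rule untwisted_coact_integral) (assumption | rule multilinear)+
  \<comment> \<open>Coassociativity makes m1 and m2 the two legs \<open>n\<close> and
    \<open>y\<close> of one \<open>D z\<close>, the shape required by
    \<open>comult_antipode_mult\<close>.\<close>
  also have "\<dots> = tensor_lift K Q (\<lambda>x z. tensor_lift K Q (\<lambda>n y. tensor_lift K Q (\<lambda>u v.
      b (act' x (\<phi> u)) (n \<star>\<^bsub>H\<^esub> v)) (D (S y \<star>\<^bsub>H\<^esub> h))) (D z)) (M.R m)"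
    by (rule M.untwisted_coact_coassoc) (assumption | rule multilinear)+
  also have "\<dots> = tensor_lift K Q (\<lambda>x z. tensor_lift K Q (\<lambda>u v.
      b (act' x (\<phi> (S z \<star>\<^bsub>H\<^esub> u))) v) (D h)) (M.R m)"
    by (rule tensor_lift_cong, (assumption | rule multilinear)+, rule comult_antipode_mult)
      (assumption | rule multilinear)+
  also have "\<dots> = tensor_lift K Q (\<lambda>u v. tensor_lift K Q (\<lambda>x z.
      b (act' x (\<phi> (S z \<star>\<^bsub>H\<^esub> u))) v) (M.R m)) (D h)"
    by (rule tensor_lift_swap) (assumption | rule multilinear)+
  also have "\<dots> = tensor_lift K Q (\<lambda>u v. b (lam m u) v) (D h)"
    by (rule tensor_lift_cong, (assumption | rule multilinear)+,
        rule linear_tensor_lift[symmetric, where g = "\<lambda>x. b x _"]) (assumption | rule multilinear)+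
  finally show ?thesis .
qed

abbreviation "\<Lambda> \<equiv> integral_retraction K H S \<phi> M act \<rho>"

lemma retraction_linear: "linear_map K (tensor_module K M H) M \<Lambda>"
  unfolding integral_retraction_def by (assumption | rule multilinear)+

lemma retraction_pure:
  "m \<in> carrier M \<Longrightarrow> h \<in> carrier H \<Longrightarrow> \<Lambda> (pure_tensor K M H m h) = twist M (lam m h)"
  unfolding integral_retraction_def by (rule tensor_lift_pure) (assumption | rule multilinear)+

lemmas retraction_multilinear = linear_map_comp[OF retraction_linear] linear_map_closed[OF retraction_linear]

declare retraction_multilinear [multilinear]

text \<open>Moving the outer twist into \<lambda>' twists both legs of \<open>\<rho> m\<close>,
  which is the passage from \<open>\<rho>\<close> to the untwisted coaction retracted by
  \<lambda>'.\<close>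

lemma retraction_coact:
  assumes [multilinear]: "m \<in> carrier M"
  shows "\<Lambda> (\<rho> m) = m"
proof -
  have "\<Lambda> (\<rho> m) = tensor_lift K M (\<lambda>x h. lam (twist M x) (twist H h)) (\<rho> m)"
    unfolding integral_retraction_def
    by (rule tensor_lift_cong, (assumption | rule multilinear)+) (rule lam_twist)
  also have "\<dots> = tensor_lift K M lam (M.R m)"
    by (rule M.untwisted_coact_lift[symmetric]) (assumption | rule multilinear)+
  finally show ?thesis by (simp add: lam_coact_unit assms)
qed

lemma retraction_twist:
  assumes "t \<in> carrier (tensor_module K M H)"
  shows "twist M (\<Lambda> t) = \<Lambda> (tensor_map K M H (twist M) (twist H) t)"
proof -
  have l: "linear_map K (tensor_module K M H) (tensor_module K M H) (tensor_map K M H (twist M) (twist H))"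
    by (intro tensor_map_linear M.module_axioms H.module_axioms M.twist_linear H.twist_linear)
  show ?thesis
    apply (rule tensor_linear_ext[OF _ _ _ assms, where f = "\<lambda>t. twist M (\<Lambda> t)"])
    apply (assumption | rule multilinear l)+
    apply (subst tensor_map_pure, (assumption | rule multilinear M.twist_linear H.twist_linear)+)
    apply (simp add: retraction_pure M.twist_closed H.twist_closed lam_twist)
    apply (rule multilinear)+
    done
qed

lemma retraction_colinear:
  assumes "t \<in> carrier (tensor_module K M H)"
  shows "\<rho> (\<Lambda> t) = tensor_map K M H \<Lambda> id (induced_coact K H M t)"
proof -
  have l: "linear_map K (tensor_module K (tensor_module K M H) H) (tensor_module K M H)
      (tensor_map K M H \<Lambda> id)"
    unfolding id_def
    by (intro tensor_map_linear M.module_axioms H.module_axioms module_tensor retraction_linear linear_map_id)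
  show ?thesis
  proof (rule tensor_linear_ext[OF _ _ _ assms, where f = "\<lambda>t. \<rho> (\<Lambda> t)"])
    fix m h assume [multilinear]: "m \<in> carrier M" "h \<in> carrier H"
    let ?T = "tensor_module K M H"
    \<comment> \<open>The outer twist of \<Lambda> is what turns \<open>\<rho>\<close> into the
      untwisted coaction.\<close>
    have "\<rho> (\<Lambda> (pure_tensor K M H m h)) = M.R (lam m h)"
      by (subst retraction_pure, (assumption | rule multilinear)+) (simp add: untwisted_coact_def)
    \<comment> \<open>Expanding the tensor by \<open>pure_tensor\<close> puts it under a test map,
      so that \<open>coact_lam\<close> applies.\<close>
    also have "\<dots> = tensor_lift K ?T (pure_tensor K M H) (M.R (lam m h))"
      by (rule tensor_linear_eq_lift[where g = "\<lambda>x. x"]) (assumption | rule multilinear)+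
    also have "\<dots> = tensor_lift K ?T (\<lambda>u v. pure_tensor K M H (lam m u) v) (D h)"
      by (rule coact_lam) (assumption | rule multilinear)+
    also have "\<dots> = tensor_lift K ?T (\<lambda>u v. pure_tensor K M H (lam m (twist H u)) (twist H v)) (comult H h)"
      by (rule HH.M.untwisted_coact_lift) (assumption | rule multilinear)+
    \<comment> \<open>\<lambda>' at m and the twisted u equals \<Lambda> at the pure tensor of the
      inversely twisted m with u. This accounts for both the inverse twist on m and the twist on the
      last leg in the induced coaction.\<close>
    also have "\<dots> = tensor_lift K ?T (\<lambda>u v. tensor_map K M H \<Lambda> id 
        (pure_tensor K ?T H (pure_tensor K M H (inv_twist M m) u) (twist H v))) (comult H h)"
      apply (rule tensor_lift_cong, (assumption | rule multilinear)+)
      apply (subst tensor_map_pure, (assumption | rule multilinear retraction_linear | simp add: id_def)+)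
      apply (simp add: retraction_pure M.inv_twist_closed lam_twist M.twist_inv_twist \<open>m \<in> carrier M\<close>)
      done
    also have "\<dots> = tensor_map K M H \<Lambda> id (induced_coact K H M (pure_tensor K M H m h))"
      apply (subst M.induced_coact_pure, (assumption | rule multilinear)+)
      apply (rule linear_tensor_lift[OF _ _ _ _ _ l, symmetric])
      apply (assumption | rule multilinear)+
      done
    finally show "\<rho> (\<Lambda> (pure_tensor K M H m h)) =
        tensor_map K M H \<Lambda> id (induced_coact K H M (pure_tensor K M H m h))" .
  qed (assumption | rule multilinear linear_map_comp[OF l M.induced_coact_linear])+
qed

end

section \<open>Functoriality of the tensor product\<close>

lemma tensor_map_closed:
  assumes "t \<in> carrier (tensor_module K M N)"
    and "module K M" "module K N" "module K P" "module K Q"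
    and "\<And>x. x \<in> carrier M \<Longrightarrow> f x \<in> carrier P" "\<And>y. y \<in> carrier N \<Longrightarrow> g y \<in> carrier Q"
  shows "tensor_map K P Q f g t \<in> carrier (tensor_module K P Q)"
  unfolding tensor_map_def using assms
  by (intro tensor_lift_closed[OF assms(1)] module_tensor bilinear_map_closed[OF bilinear_pure_tensor])

lemma tensor_map_cong:
  assumes "t \<in> carrier (tensor_module K M N)" "module K M" "module K N"
    and "\<And>x. x \<in> carrier M \<Longrightarrow> f x = f' x" "\<And>y. y \<in> carrier N \<Longrightarrow> g y = g' y"
  shows "tensor_map K P Q f g t = tensor_map K P Q f' g' t"
  unfolding tensor_map_def using assms by (intro tensor_lift_cong[OF assms(1-3)]) simp

lemma tensor_map_comp:
  assumes t: "t \<in> carrier (tensor_module K M N)"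
    and mods: "module K M" "module K N" "module K P" "module K Q" "module K P'" "module K Q'"
    and fg: "\<And>x. x \<in> carrier M \<Longrightarrow> f x \<in> carrier P" "\<And>y. y \<in> carrier N \<Longrightarrow> g y \<in> carrier Q"
    and f': "linear_map K P P' f'" and g': "linear_map K Q Q' g'"
  shows "tensor_map K P' Q' f' g' (tensor_map K P Q f g t) =
    tensor_map K P' Q' (\<lambda>x. f' (f x)) (\<lambda>y. g' (g y)) t"
proof -
  note [multilinear] = mods linear_map_comp[OF f'] linear_map_comp[OF g']
    linear_map_closed[OF f'] linear_map_closed[OF g']
  show ?thesis
    unfolding tensor_map_def[of K P' Q']
    by (rule tensor_lift_map[OF t]) (assumption | rule multilinear fg)+
qed

section \<open>Naturality and injectivity\<close>

text \<open>The retraction is built from action, coaction and twist of the module together with the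
  fixed maps S and \<phi>. A morphism f respects the first three, hence also the inverse twist and
  the untwisted structure.\<close>

lemma retraction_natural:
  assumes M: "hom_relative_integral K H A \<rho>A M act \<rho> S \<phi>"
    and N: "hom_relative_integral K H A \<rho>A N act' \<rho>' S \<phi>"
    and f: "linear_map K M N f"
    and f_twist: "\<And>x. x \<in> carrier M \<Longrightarrow> twist N (f x) = f (twist M x)"
    and f_act: "\<And>x a. x \<in> carrier M \<Longrightarrow> a \<in> carrier A \<Longrightarrow> f (act x a) = act' (f x) a"
    and f_coact: "\<And>x. x \<in> carrier M \<Longrightarrow> \<rho>' (f x) = tensor_map K N H f id (\<rho> x)"
    and t: "t \<in> carrier (tensor_module K M H)"
  shows "integral_retraction K H S \<phi> N act' \<rho>' (tensor_map K N H f id t) =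
    f (integral_retraction K H S \<phi> M act \<rho> t)"
proof -
  interpret M: hom_relative_integral K H A \<rho>A M act \<rho> S \<phi> by fact
  interpret N: hom_relative_integral K H A \<rho>A N act' \<rho>' S \<phi> by fact
  note [multilinear] = linear_map_comp[OF f] linear_map_closed[OF f]
  have f_act': "f (M.act' x a) = N.act' (f x) a" if "x \<in> carrier M" "a \<in> carrier A" for x a
  proof -
    have c: "act x a \<in> carrier M" using that by (rule multilinear)+
    then have "N.act' (f x) a = inv_twist N (f (twist M (inv_twist M (act x a))))"
      using that by (simp add: untwisted_act_def f_act M.M.twist_inv_twist)
    also have "\<dots> = f (inv_twist M (act x a))"
      using c by (intro N.M.inv_twist_eqI f_twist linear_map_closed[OF f]) (auto intro: M.M.inv_twist_closed)
    finally show ?thesis by (simp add: untwisted_act_def)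
  qed
  have f_lam: "f (M.lam m h) = N.lam (f m) h" if [multilinear]: "m \<in> carrier M" "h \<in> carrier H" for m h
  proof -
    have "f (M.lam m h) = tensor_lift K N (\<lambda>x y. f (M.act' x (\<phi> (S y \<star>\<^bsub>H\<^esub> h)))) (M.M.R m)"
      by (rule linear_tensor_lift) (assumption | rule multilinear f)+
    also have "\<dots> = tensor_lift K N (\<lambda>x y. N.act' (f x) (\<phi> (S (id y) \<star>\<^bsub>H\<^esub> h))) (M.M.R m)"
      unfolding id_def
      by (rule tensor_lift_cong, (assumption | rule multilinear)+, rule f_act') (assumption | rule multilinear)+
    also have "\<dots> = tensor_lift K N (\<lambda>x y. N.act' x (\<phi> (S y \<star>\<^bsub>H\<^esub> h))) (tensor_map K N H f id (M.M.R m))"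
      by (rule tensor_lift_map[symmetric]) (assumption | simp only: id_apply | rule multilinear)+
    also have "tensor_map K N H f id (M.M.R m) = N.M.R (f m)"
      using that(1) by (simp add: untwisted_coact_def f_twist f_coact M.M.twist_closed)
    finally show ?thesis .
  qed
  have l: "linear_map K (tensor_module K M H) (tensor_module K N H) (tensor_map K N H f id)"
    unfolding id_def by (rule tensor_map_linear) (rule multilinear f)+
  show ?thesis
  proof (rule tensor_linear_ext[OF _ _ _ t])
    fix m h assume mh [multilinear]: "m \<in> carrier M" "h \<in> carrier H"
    have "tensor_map K N H f id (pure_tensor K M H m h) = pure_tensor K N H (f m) h"
      by (subst tensor_map_pure, (assumption | rule multilinear f | simp add: id_def)+)
    moreover have "M.lam m h \<in> carrier M" by (rule M.lam_multilinear mh)+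
    ultimately show "N.\<Lambda> (tensor_map K N H f id (pure_tensor K M H m h)) = f (M.\<Lambda> (pure_tensor K M H m h))"
      using mh linear_map_closed[OF f mh(1)]
      by (simp add: M.retraction_pure N.retraction_pure f_twist[symmetric] f_lam)
  qed (assumption | rule multilinear l)+
qed

section \<open>From a colinear retraction back to a total integral\<close>

context hom_relative
begin

text \<open>The coaction sends 1 \<otimes> k to (1 \<otimes> k1) \<otimes> \<alpha>(k2). The inverse
  twist in the formula for \<phi> compensates that \<alpha>, and \<phi>(1) = 1 holds because 1
  \<otimes> 1 is the coaction of the unit.\<close>

lemma total_integral_of_retraction:
  assumes l: "linear_map K (tensor_module K A H) A l"
    and l_twist: "\<And>t. t \<in> carrier (tensor_module K A H) \<Longrightarrow>
      twist A (l t) = l (tensor_map K A H (twist A) (twist H) t)"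
    and l_coact: "\<And>t. t \<in> carrier (tensor_module K A H) \<Longrightarrow>
      \<rho>A (l t) = tensor_map K A H l id (induced_coact K H A t)"
    and l_id: "\<And>a. a \<in> carrier A \<Longrightarrow> l (\<rho>A a) = a"
  shows "total_integral K H A \<rho>A (\<lambda>h. l (pure_tensor K A H \<one>\<^bsub>A\<^esub> (inv_twist H h)))"
proof -
  interpret HH: hom_comodule K H H "comult H" by (rule H.comult_hom_comodule)
  let ?\<phi> = "\<lambda>h. l (pure_tensor K A H \<one>\<^bsub>A\<^esub> (inv_twist H h))"
  let ?T = "tensor_module K A H"
  note [multilinear] = linear_map_comp[OF l] linear_map_closed[OF l]
  have inv_unit: "inv_twist A \<one>\<^bsub>A\<^esub> = \<one>\<^bsub>A\<^esub>" "inv_twist H \<one>\<^bsub>H\<^esub> = \<one>\<^bsub>H\<^esub>"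
    by (simp_all add: A.inv_twist_eqI A.twist_unit A.unit_closed H.inv_twist_eqI H.twist_unit H.unit_closed)
  have "\<rho>A (?\<phi> h) = tensor_map K A H ?\<phi> id (comult H h)" if h [multilinear]: "h \<in> carrier H" for h
  proof -
    let ?k = "inv_twist H h"
    have "\<rho>A (?\<phi> h) = tensor_map K A H l id (induced_coact K H A (pure_tensor K A H \<one>\<^bsub>A\<^esub> ?k))"
      by (rule l_coact) (rule multilinear)+
    also have "\<dots> = tensor_map K A H l id (tensor_lift K (tensor_module K ?T H)
        (\<lambda>h1 h2. pure_tensor K ?T H (pure_tensor K A H \<one>\<^bsub>A\<^esub> h1) (twist H h2)) (comult H ?k))"
      by (subst A.induced_coact_pure, (rule multilinear)+) (simp add: inv_unit)
    also have "\<dots> = tensor_lift K ?T (\<lambda>h1 h2. pure_tensor K A H (l (pure_tensor K A H \<one>\<^bsub>A\<^esub> h1)) (id (twist H h2)))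
        (comult H ?k)"
      apply (subst linear_tensor_lift[where g = "tensor_map K A H l id" and Q = ?T])
           apply (assumption | rule multilinear tensor_map_linear l linear_map_id[folded id_def])+
      apply (rule tensor_lift_cong, (assumption | rule multilinear)+, rule tensor_map_pure)
             apply (assumption | rule multilinear l linear_map_id[folded id_def])+
      done
    \<comment> \<open>The value of \<open>l\<close> at 1 \<otimes> x is \<phi> of the twisted x.
      Both legs are now twisted, so the comultiplication at \<open>?k\<close> becomes the one at
      \<open>h\<close>.\<close>
    also have "\<dots> = tensor_lift K ?T (\<lambda>x y. pure_tensor K A H (?\<phi> (twist H x)) (id (twist H y)))
        (comult H ?k)"
      by (rule tensor_lift_cong, (assumption | rule multilinear)+) (simp add: H.inv_twist_twist)
    also have "\<dots> = tensor_lift K ?T (\<lambda>x y. pure_tensor K A H (?\<phi> x) (id y)) (comult H (twist H ?k))"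
      unfolding id_def by (rule HH.coact_twist_lift[symmetric]) (assumption | rule multilinear)+
    also have "\<dots> = tensor_map K A H ?\<phi> id (comult H h)"
      by (simp add: tensor_map_def H.twist_inv_twist h)
    finally show ?thesis .
  qed
  moreover have "linear_map K H A ?\<phi>" by (rule multilinear)+
  moreover have "?\<phi> (twist H h) = twist A (?\<phi> h)" if h [multilinear]: "h \<in> carrier H" for h
  proof -
    have "twist A (?\<phi> h) = l (tensor_map K A H (twist A) (twist H) (pure_tensor K A H \<one>\<^bsub>A\<^esub> (inv_twist H h)))"
      by (rule l_twist) (rule multilinear)+
    also have "\<dots> = l (pure_tensor K A H (twist A \<one>\<^bsub>A\<^esub>) (twist H (inv_twist H h)))"
      by (subst tensor_map_pure, (assumption | rule multilinear A.twist_linear H.twist_linear refl)+)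
    finally show ?thesis by (simp add: A.twist_unit H.twist_inv_twist H.inv_twist_twist h)
  qed
  moreover have "?\<phi> \<one>\<^bsub>H\<^esub> = \<one>\<^bsub>A\<^esub>"
    using l_id[OF A.unit_closed] by (simp add: inv_unit A.coact_unit)
  ultimately show ?thesis by (auto simp: total_integral_def)
qed

end

section \<open>Extension of colinear maps\<close>

context hom_relative_integral
begin

text \<open>The composite u of f with p is linear and compatible with twists, but p need not be
  colinear. Sending y to u(y0) \<otimes> y1 nevertheless gives a colinear map into M \<otimes> H, by
  coassociativity of Y, and \<Lambda> is colinear. On the image of i this map is the coaction of M
  after f, which \<Lambda> retracts.\<close>

lemma retraction_extend:
  assumes X: "right_hom_comodule K H X \<rho>X" and Y: "right_hom_comodule K H Y \<rho>Y"
    and i: "linear_map K X Y i"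
    and i_coact: "\<And>x. x \<in> carrier X \<Longrightarrow> \<rho>Y (i x) = tensor_map K Y H i id (\<rho>X x)"
    and p: "linear_map K Y X p" and p_twist: "\<And>y. y \<in> carrier Y \<Longrightarrow> twist X (p y) = p (twist Y y)"
    and pi: "\<And>x. x \<in> carrier X \<Longrightarrow> p (i x) = x"
    and f: "linear_map K X M f" and f_twist: "\<And>x. x \<in> carrier X \<Longrightarrow> twist M (f x) = f (twist X x)"
    and f_coact: "\<And>x. x \<in> carrier X \<Longrightarrow> \<rho> (f x) = tensor_map K M H f id (\<rho>X x)"
  defines "g \<equiv> \<lambda>y. \<Lambda> (tensor_map K M H (\<lambda>y. f (p y)) id (\<rho>Y y))"
  shows "linear_map K Y M g"
    and "y \<in> carrier Y \<Longrightarrow> twist M (g y) = g (twist Y y)"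
    and "y \<in> carrier Y \<Longrightarrow> \<rho> (g y) = tensor_map K M H g id (\<rho>Y y)"
    and "x \<in> carrier X \<Longrightarrow> g (i x) = f x"
proof -
  interpret X: right_hom_comodule K H X \<rho>X by fact
  interpret Y: right_hom_comodule K H Y \<rho>Y by fact
  interpret X: hom_comodule K H X \<rho>X by unfold_locales
  interpret Y: hom_comodule K H Y \<rho>Y by unfold_locales
  let ?u = "\<lambda>y. f (p y)"
  let ?G = "\<lambda>y. tensor_map K M H ?u id (\<rho>Y y)"
  let ?T = "tensor_module K M H"
  have u: "linear_map K Y M ?u" by (rule linear_map_comp[OF f p])
  note id = linear_map_id[folded id_def]
  note [multilinear] = linear_map_comp[OF u] linear_map_closed[OF u] linear_map_closed[OF i]
    linear_map_closed[OF f] linear_map_closed[OF p]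
  have u_twist: "twist M (?u y) = ?u (twist Y y)" if "y \<in> carrier Y" for y
    using that by (simp add: f_twist p_twist linear_map_closed[OF p])
  have u_inv: "?u (inv_twist Y y) = inv_twist M (?u y)" if "y \<in> carrier Y" for y
    using that by (intro M.inv_twist_eqI[symmetric] linear_map_closed[OF u])
      (simp_all only: u_twist Y.twist_inv_twist Y.inv_twist_closed)
  have G: "linear_map K Y ?T ?G"
    by (rule linear_map_comp[OF tensor_map_linear Y.coact_linear]) (rule multilinear u id)+
  note [multilinear] = linear_map_comp[OF G] linear_map_closed[OF G]
  show g: "linear_map K Y M g" unfolding g_def by (rule multilinear)+
  show "twist M (g y) = g (twist Y y)" if y [multilinear]: "y \<in> carrier Y"
  proof -
    have ry: "\<rho>Y y \<in> carrier (tensor_module K Y H)" by (rule multilinear)+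
    have "tensor_map K M H (twist M) (twist H) (?G y) =
        tensor_map K M H (\<lambda>y. twist M (?u y)) (\<lambda>h. twist H (id h)) (\<rho>Y y)"
      by (rule tensor_map_comp[OF ry]) (assumption | simp only: id_apply | rule multilinear M.twist_linear H.twist_linear)+
    also have "\<dots> = tensor_map K M H (\<lambda>y. ?u (twist Y y)) (\<lambda>h. id (twist H h)) (\<rho>Y y)"
      by (rule tensor_map_cong[OF ry]) (assumption | rule multilinear | simp add: u_twist)+
    also have "\<dots> = tensor_map K M H ?u id (tensor_map K Y H (twist Y) (twist H) (\<rho>Y y))"
      by (rule tensor_map_comp[OF ry, symmetric]) (assumption | rule multilinear u id)+
    also have "\<dots> = ?G (twist Y y)" by (simp only: Y.coact_twist y)
    finally have eq: "tensor_map K M H (twist M) (twist H) (?G y) = ?G (twist Y y)" .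
    have "twist M (g y) = \<Lambda> (tensor_map K M H (twist M) (twist H) (?G y))"
      unfolding g_def by (rule retraction_twist) (rule multilinear)+
    then show ?thesis by (simp only: g_def eq)
  qed
  show "\<rho> (g y) = tensor_map K M H g id (\<rho>Y y)" if y [multilinear]: "y \<in> carrier Y"
  proof -
    have ry: "\<rho>Y y \<in> carrier (tensor_module K Y H)" by (rule multilinear)+
    let ?TH = "tensor_module K ?T H"
    have "induced_coact K H M (?G y) =
        tensor_lift K ?TH (\<lambda>x h. induced_coact K H M (pure_tensor K M H (?u x) (id h))) (\<rho>Y y)"
      unfolding tensor_map_def id_def
      by (rule linear_tensor_lift[OF ry]) (assumption | rule multilinear M.induced_coact_linear)+
    also have "\<dots> = tensor_lift K ?TH (\<lambda>x h. tensor_lift K ?TH (\<lambda>h1 h2. pure_tensor K ?T H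
        (pure_tensor K M H (?u (inv_twist Y x)) h1) (twist H h2)) (comult H h)) (\<rho>Y y)"
      apply (rule tensor_lift_cong[OF ry], (assumption | rule multilinear)+)
      apply (subst M.induced_coact_pure, (assumption | simp only: id_apply | rule multilinear)+)
      apply (simp add: u_inv)
      done
    \<comment> \<open>Hom-coassociativity of Y puts an inverse twist on the last leg, and it cancels
      the twist in the induced coaction.\<close>
    also have "\<dots> = tensor_lift K ?TH (\<lambda>x h. tensor_lift K ?TH (\<lambda>z k. pure_tensor K ?T H
        (pure_tensor K M H (?u z) k) (twist H (inv_twist H h))) (\<rho>Y x)) (\<rho>Y y)"
      by (rule Y.coact_coassoc_lift[symmetric]) (assumption | rule multilinear)+
    also have "\<dots> = tensor_lift K ?TH (\<lambda>x h. pure_tensor K ?T H (?G x) (id h)) (\<rho>Y y)"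
      apply (rule tensor_lift_cong[OF ry], (assumption | rule multilinear)+)
      apply (simp add: H.twist_inv_twist)
      unfolding tensor_map_def id_def
      apply (rule linear_tensor_lift[symmetric, where g = "\<lambda>s. pure_tensor K ?T H s _"])
           apply (assumption | rule multilinear)+
      done
    also have "\<dots> = tensor_map K ?T H ?G id (\<rho>Y y)" by (simp only: tensor_map_def)
    finally have ind: "induced_coact K H M (?G y) = tensor_map K ?T H ?G id (\<rho>Y y)" .
    have "\<rho> (g y) = tensor_map K M H \<Lambda> id (tensor_map K ?T H ?G id (\<rho>Y y))"
      unfolding g_def ind[symmetric] by (rule retraction_colinear) (rule multilinear)+
    also have "\<dots> = tensor_map K M H g (\<lambda>h. id (id h)) (\<rho>Y y)"
      unfolding g_def by (rule tensor_map_comp[OF ry]) (assumption | simp only: id_apply | rule multilinear retraction_linear id)+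
    finally show ?thesis by (simp add: id_def)
  qed
  show "g (i x) = f x" if x [multilinear]: "x \<in> carrier X"
  proof -
    have rx: "\<rho>X x \<in> carrier (tensor_module K X H)" by (rule multilinear)+
    have "?G (i x) = tensor_map K M H (\<lambda>x. ?u (i x)) (\<lambda>h. id (id h)) (\<rho>X x)"
      unfolding i_coact[OF x]
      by (rule tensor_map_comp[OF rx]) (assumption | simp only: id_apply | rule multilinear u id)+
    also have "\<dots> = tensor_map K M H f id (\<rho>X x)"
      by (rule tensor_map_cong[OF rx]) (simp add: pi | rule multilinear)+
    also have "\<dots> = \<rho> (f x)" by (simp only: f_coact x)
    finally show ?thesis
      by (simp add: g_def retraction_coact linear_map_closed[OF f x])
  qed
qed

end

section \<open>Naturality of the associator and of the induced coaction\<close>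

lemma tensor_assoc_linear:
  assumes [multilinear]: "module K M" "module K N" "module K P"
  shows "linear_map K (tensor_module K (tensor_module K M N) P)
    (tensor_module K M (tensor_module K N P)) (tensor_assoc K M N P)"
  unfolding tensor_assoc_def Let_def by (assumption | rule multilinear)+

lemma tensor_assoc_pure:
  assumes [multilinear]: "module K M" "module K N" "module K P"
    "x \<in> carrier M" "y \<in> carrier N" "z \<in> carrier P"
  shows "tensor_assoc K M N P (pure_tensor K (tensor_module K M N) P (pure_tensor K M N x y) z) =
    pure_tensor K M (tensor_module K N P) x (pure_tensor K N P y z)"
  unfolding tensor_assoc_def Let_def
  by (subst tensor_lift_pure, (assumption | rule multilinear)+)+ (rule refl)

text \<open>Naturality in the first factor is what transport calls for: M is replaced by an
  isomorphic copy while both factors H stay. It suffices to check elements (x \<otimes> y) \<otimes>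
  z, by extensionality on the outer and then on the inner tensor product.\<close>

lemma tensor_assoc_natural:
  assumes s: "s \<in> carrier (tensor_module K (tensor_module K M N) P)"
    and mods [multilinear]: "module K M" "module K N" "module K P" "module K M'"
    and f: "linear_map K M M' f"
  shows "tensor_assoc K M' N P (tensor_map K (tensor_module K M' N) P (tensor_map K M' N f id) id s) =
    tensor_map K M' (tensor_module K N P) f id (tensor_assoc K M N P s)"
proof -
  note id = linear_map_id[folded id_def]
  note [multilinear] = linear_map_comp[OF f] linear_map_closed[OF f]
  note fl = tensor_map_linear[OF mods(1,2,4,2) f id]
  note a = linear_map_comp[OF tensor_assoc_linear[OF mods(4,2,3)]]
    linear_map_comp[OF tensor_map_linear[OF module_tensor[OF mods(1,2)] mods(3) module_tensor[OF mods(4,2)] mods(3) fl id]]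
    linear_map_comp[OF tensor_map_linear[OF mods(1) module_tensor[OF mods(2,3)] mods(4) module_tensor[OF mods(2,3)] f id]]
    linear_map_comp[OF tensor_assoc_linear[OF mods(1,2,3)]]
  show ?thesis
  proof (rule tensor_linear_ext[OF _ _ _ s])
    fix q z assume q: "q \<in> carrier (tensor_module K M N)" and z [multilinear]: "z \<in> carrier P"
    show "tensor_assoc K M' N P (tensor_map K (tensor_module K M' N) P (tensor_map K M' N f id) id
          (pure_tensor K (tensor_module K M N) P q z)) =
        tensor_map K M' (tensor_module K N P) f id (tensor_assoc K M N P
          (pure_tensor K (tensor_module K M N) P q z))"
    proof (rule tensor_linear_ext[OF _ _ _ q])
      fix x y assume [multilinear]: "x \<in> carrier M" "y \<in> carrier N"
      show "tensor_assoc K M' N P (tensor_map K (tensor_module K M' N) P (tensor_map K M' N f id) id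
            (pure_tensor K (tensor_module K M N) P (pure_tensor K M N x y) z)) =
          tensor_map K M' (tensor_module K N P) f id (tensor_assoc K M N P
            (pure_tensor K (tensor_module K M N) P (pure_tensor K M N x y) z))"
        apply (subst tensor_map_pure, (assumption | rule multilinear fl id)+)
        apply (subst tensor_map_pure, (assumption | rule multilinear f id)+)
        apply (simp only: id_apply)
        apply (subst tensor_assoc_pure, (assumption | rule multilinear)+)
        apply (subst tensor_assoc_pure, (assumption | rule multilinear)+)
        apply (subst tensor_map_pure, (assumption | rule multilinear f id)+)
        apply (simp only: id_apply)
        done
    qed (assumption | rule a multilinear)+
  qed (assumption | rule a multilinear)+
qed

text \<open>The induced coaction contains the inverse twist of M, which is why f has to respect the
  twists.\<close>

lemma induced_coact_natural:
  assumes M: "hom_comodule K H M \<rho>" and N: "hom_comodule K H N \<rho>'"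
    and f: "linear_map K M N f" and f_twist: "\<And>x. x \<in> carrier M \<Longrightarrow> twist N (f x) = f (twist M x)"
    and t: "t \<in> carrier (tensor_module K M H)"
  shows "induced_coact K H N (tensor_map K N H f id t) =
    tensor_map K (tensor_module K N H) H (tensor_map K N H f id) id (induced_coact K H M t)"
proof -
  interpret M: hom_comodule K H M \<rho> by fact
  interpret N: hom_comodule K H N \<rho>' by fact
  note id = linear_map_id[folded id_def]
  note [multilinear] = linear_map_comp[OF f] linear_map_closed[OF f]
  have fl: "linear_map K (tensor_module K M H) (tensor_module K N H) (tensor_map K N H f id)"
    by (rule tensor_map_linear) (assumption | rule multilinear f id)+
  have fll: "linear_map K (tensor_module K (tensor_module K M H) H) (tensor_module K (tensor_module K N H) H)
     (tensor_map K (tensor_module K N H) H (tensor_map K N H f id) id)"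
    by (rule tensor_map_linear) (assumption | rule multilinear fl id)+
  have f_inv: "inv_twist N (f x) = f (inv_twist M x)" if "x \<in> carrier M" for x
    using that by (intro N.M.inv_twist_eqI linear_map_closed[OF f])
      (simp_all add: f_twist M.M.twist_inv_twist M.M.inv_twist_closed)
  show ?thesis
  proof (rule tensor_linear_ext[OF _ _ _ t])
    fix m h assume [multilinear]: "m \<in> carrier M" "h \<in> carrier H"
    show "induced_coact K H N (tensor_map K N H f id (pure_tensor K M H m h)) =
      tensor_map K (tensor_module K N H) H (tensor_map K N H f id) id
        (induced_coact K H M (pure_tensor K M H m h))"
      apply (subst tensor_map_pure, (assumption | rule multilinear f id)+)
      apply (simp only: id_apply)
      apply (subst N.induced_coact_pure, (assumption | rule multilinear)+)
      apply (subst M.induced_coact_pure, (assumption | rule multilinear)+)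
      apply (subst linear_tensor_lift[OF _ _ _ _ _ fll], (assumption | rule multilinear)+)
      apply (rule tensor_lift_cong, (assumption | rule multilinear)+)
      apply (subst tensor_map_pure, (assumption | rule multilinear fl id)+)
      apply (subst tensor_map_pure, (assumption | rule multilinear f id)+)
      apply (simp add: f_inv \<open>m \<in> carrier M\<close>)
      done
  qed (assumption | rule multilinear linear_map_comp[OF fll] linear_map_comp[OF fl]
      linear_map_comp[OF N.induced_coact_linear] linear_map_comp[OF M.induced_coact_linear])+
qed

section \<open>Transport of structure\<close>

text \<open>Moves a relative Hom-Hopf module to another type along a map injective on its carrier;
  all structure on the image is conjugated by the bijection.\<close>

locale hom_relative_transport = hom_relative K H A \<rho>A M act \<rho>
  for K :: "('k, 'r) ring_scheme" and H :: "('k, 'h, 's) hom_bialgebra_scheme"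
    and A :: "('k, 'a, 't) hom_object_scheme" and \<rho>A :: "'a \<Rightarrow> ('k, 'a, 'h) tensor"
    and M :: "('k, 'm, 'u) hom_object_scheme"
    and act :: "'m \<Rightarrow> 'a \<Rightarrow> 'm" and \<rho> :: "'m \<Rightarrow> ('k, 'm, 'h) tensor" +
  fixes j :: "'m \<Rightarrow> 'n"
  assumes inj: "inj_on j (carrier M)"
begin

abbreviation "\<kappa> \<equiv> inv_into (carrier M) j"

text \<open>Even for M = A the product of A is not copied into the record: the copy serves as a
  relative module, and A acts on it through \<open>actN\<close>.\<close>

definition N :: "('k, 'n) hom_object"
  where "N = \<lparr>carrier = j ` carrier M, mult = undefined, one = undefined, zero = j \<zero>\<^bsub>M\<^esub>,
    add = (\<lambda>x y. j (\<kappa> x \<oplus>\<^bsub>M\<^esub> \<kappa> y)), smult = (\<lambda>c x. j (c \<odot>\<^bsub>M\<^esub> \<kappa> x)),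
    twist = (\<lambda>x. j (twist M (\<kappa> x)))\<rparr>"

definition "actN y a = j (act (\<kappa> y) a)"

definition "\<rho>N y = tensor_map K N H j id (\<rho> (\<kappa> y))"

lemma N_simps: "carrier N = j ` carrier M" "\<zero>\<^bsub>N\<^esub> = j \<zero>\<^bsub>M\<^esub>"
    "x \<oplus>\<^bsub>N\<^esub> y = j (\<kappa> x \<oplus>\<^bsub>M\<^esub> \<kappa> y)" "c \<odot>\<^bsub>N\<^esub> x = j (c \<odot>\<^bsub>M\<^esub> \<kappa> x)"
    "twist N x = j (twist M (\<kappa> x))"
  by (simp_all add: N_def)

lemma inv_j: "x \<in> carrier M \<Longrightarrow> \<kappa> (j x) = x"
  using inj by simp

lemma N_cases:
  assumes "y \<in> carrier N" obtains x where "x \<in> carrier M" "y = j x"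
  using assms by (auto simp: N_simps)

lemma module_N: "module K N"
proof (rule moduleI)
  show "cring K" by (rule H.R.is_cring)
  show "abelian_group N"
  proof (rule abelian_groupI)
    fix y assume "y \<in> carrier N"
    then obtain x where "x \<in> carrier M" "y = j x" by (rule N_cases)
    then show "\<exists>z\<in>carrier N. z \<oplus>\<^bsub>N\<^esub> y = \<zero>\<^bsub>N\<^esub>"
      by (intro bexI[of _ "j (\<ominus>\<^bsub>M\<^esub> x)"]) (simp_all add: N_simps inv_j M.M.l_neg)
  qed (auto elim!: N_cases simp: N_simps inv_j M.M.a_ac)
qed (auto elim!: N_cases simp: N_simps inv_j M.smult_l_distr M.smult_r_distr M.smult_assoc1)

lemma j_linear: "linear_map K M N j"
  by (rule linear_mapI) (simp_all add: N_simps inv_j)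

lemma \<kappa>_linear: "linear_map K N M \<kappa>"
  by (rule linear_mapI) (auto simp: N_simps inv_j)

lemma j_twist: "x \<in> carrier M \<Longrightarrow> twist N (j x) = j (twist M x)"
  by (simp add: N_simps inv_j)

lemmas transport_multilinear = module_N linear_map_comp[OF j_linear] linear_map_closed[OF j_linear]
  linear_map_comp[OF \<kappa>_linear] linear_map_closed[OF \<kappa>_linear]

declare transport_multilinear [multilinear]

lemma hom_object_N: "hom_object K N"
proof -
  have l: "linear_map K N N (twist N)"
    unfolding N_simps(5)[abs_def] by (rule multilinear)+
  have "bij_betw (twist N) (carrier N) (carrier N)"
    by (rule bij_betw_byWitness[where f' = "\<lambda>y. j (inv_twist M (\<kappa> y))"])
      (auto simp: N_simps inv_j M.twist_closed M.inv_twist_closed M.twist_inv_twist M.inv_twist_twist)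
  with l show ?thesis
    by (intro hom_object.intro hom_object_axioms.intro module_N)
qed

interpretation N: hom_object K N by (rule hom_object_N)

lemma inv_twist_N: "x \<in> carrier M \<Longrightarrow> inv_twist N (j x) = j (inv_twist M x)"
  by (rule N.inv_twist_eqI) (simp_all add: j_twist M.twist_inv_twist M.inv_twist_closed
      linear_map_closed[OF j_linear])

lemma \<rho>N_j: "x \<in> carrier M \<Longrightarrow> \<rho>N (j x) = tensor_map K N H j id (\<rho> x)"
  by (simp add: \<rho>N_def inv_j)

lemma actN_j: "x \<in> carrier M \<Longrightarrow> actN (j x) a = j (act x a)"
  by (simp add: actN_def inv_j)

lemmas id_linear = linear_map_id[folded id_def]

lemma \<rho>N_linear: "linear_map K N (tensor_module K N H) \<rho>N"
  unfolding \<rho>N_def[abs_def]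
  by (rule linear_map_comp[OF tensor_map_linear]) (rule multilinear j_linear id_linear)+

text \<open>Each axiom for the copy is the image of the axiom for M under j, or under j tensored
  with identities; \<open>tensor_map_comp\<close> moves j past the structure maps.\<close>

lemma right_hom_comodule_N: "right_hom_comodule K H N \<rho>N"
proof (intro right_hom_comodule.intro right_hom_comodule_axioms.intro hom_object_N \<rho>N_linear)
  note [multilinear] = M.twist_linear M.inv_twist_linear H.twist_linear H.inv_twist_linear
    N.twist_linear N.inv_twist_linear j_linear id_linear
    linear_map_comp[OF \<rho>N_linear] linear_map_closed[OF \<rho>N_linear]
    linear_map_comp[OF N.inv_twist_linear] N.inv_twist_closed N.twist_closed
  fix y assume "y \<in> carrier N"
  then obtain x where x [multilinear]: "x \<in> carrier M" and y: "y = j x" by (rule N_cases)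
  have rx: "\<rho> x \<in> carrier (tensor_module K M H)" by (rule multilinear)+
  have jl: "linear_map K (tensor_module K M H) (tensor_module K N H) (tensor_map K N H j id)"
    by (rule tensor_map_linear) (rule multilinear)+
  show "\<rho>N (twist N y) = tensor_map K N H (twist N) (twist H) (\<rho>N y)"
  proof -
    have "\<rho>N (twist N y) = tensor_map K N H j id (tensor_map K M H (twist M) (twist H) (\<rho> x))"
      by (simp add: y j_twist \<rho>N_j x M.twist_closed M.coact_twist)
    also have "\<dots> = tensor_map K N H (\<lambda>x. j (twist M x)) (\<lambda>h. id (twist H h)) (\<rho> x)"
      by (rule tensor_map_comp[OF rx]) (assumption | rule multilinear)+
    also have "\<dots> = tensor_map K N H (\<lambda>x. twist N (j x)) (\<lambda>h. twist H (id h)) (\<rho> x)"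
      by (rule tensor_map_cong[OF rx]) (simp add: j_twist | rule multilinear)+
    also have "\<dots> = tensor_map K N H (twist N) (twist H) (tensor_map K N H j id (\<rho> x))"
      by (rule tensor_map_comp[OF rx, symmetric]) (assumption | simp only: id_apply | rule multilinear)+
    finally show ?thesis by (simp add: y \<rho>N_j x)
  qed
  show "tensor_assoc K N H H (tensor_map K (tensor_module K N H) H \<rho>N (inv_twist H) (\<rho>N y)) =
    tensor_map K N (tensor_module K H H) (inv_twist N) (comult H) (\<rho>N y)"
  proof -
    have "tensor_map K (tensor_module K N H) H \<rho>N (inv_twist H) (tensor_map K N H j id (\<rho> x)) =
        tensor_map K (tensor_module K N H) H (\<lambda>x. \<rho>N (j x)) (\<lambda>h. inv_twist H (id h)) (\<rho> x)"
      by (rule tensor_map_comp[OF rx]) (assumption | simp only: id_apply | rule \<rho>N_linear multilinear)+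
    also have "\<dots> = tensor_map K (tensor_module K N H) H (\<lambda>x. tensor_map K N H j id (\<rho> x))
        (\<lambda>h. id (inv_twist H h)) (\<rho> x)"
      by (rule tensor_map_cong[OF rx]) (simp add: \<rho>N_j | rule multilinear)+
    also have "\<dots> = tensor_map K (tensor_module K N H) H (tensor_map K N H j id) id
        (tensor_map K (tensor_module K M H) H \<rho> (inv_twist H) (\<rho> x))"
      by (rule tensor_map_comp[OF rx, symmetric]) (assumption | rule multilinear jl)+
    finally have "tensor_assoc K N H H (tensor_map K (tensor_module K N H) H \<rho>N (inv_twist H) (\<rho>N y)) =
        tensor_assoc K N H H (tensor_map K (tensor_module K N H) H (tensor_map K N H j id) id
        (tensor_map K (tensor_module K M H) H \<rho> (inv_twist H) (\<rho> x)))"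
      by (simp add: y \<rho>N_j x)
    also have "\<dots> = tensor_map K N (tensor_module K H H) j id
        (tensor_assoc K M H H (tensor_map K (tensor_module K M H) H \<rho> (inv_twist H) (\<rho> x)))"
      by (rule tensor_assoc_natural[OF tensor_map_closed[OF rx]]) (assumption | rule multilinear)+
    also have "\<dots> = tensor_map K N (tensor_module K H H) j id
        (tensor_map K M (tensor_module K H H) (inv_twist M) (comult H) (\<rho> x))"
      by (simp only: M.coact_coassoc x)
    also have "\<dots> = tensor_map K N (tensor_module K H H) (\<lambda>x. j (inv_twist M x)) (\<lambda>h. id (comult H h)) (\<rho> x)"
      by (rule tensor_map_comp[OF rx]) (assumption | rule multilinear)+
    also have "\<dots> = tensor_map K N (tensor_module K H H) (\<lambda>x. inv_twist N (j x)) (\<lambda>h. comult H (id h)) (\<rho> x)"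
      by (rule tensor_map_cong[OF rx]) (simp add: inv_twist_N | rule multilinear)+
    also have "\<dots> = tensor_map K N (tensor_module K H H) (inv_twist N) (comult H) (tensor_map K N H j id (\<rho> x))"
      by (rule tensor_map_comp[OF rx, symmetric])
        (assumption | simp only: id_apply | rule multilinear H.comult_linear)+
    finally show ?thesis by (simp add: y \<rho>N_j x)
  qed
  show "tensor_lift K N (\<lambda>x h. counit H h \<odot>\<^bsub>N\<^esub> x) (\<rho>N y) = inv_twist N y"
  proof -
    have "tensor_lift K N (\<lambda>x h. counit H h \<odot>\<^bsub>N\<^esub> x) (tensor_map K N H j id (\<rho> x)) =
        tensor_lift K N (\<lambda>x h. counit H (id h) \<odot>\<^bsub>N\<^esub> j x) (\<rho> x)"
      by (rule tensor_lift_map[OF rx]) (assumption | simp only: id_apply | rule multilinear)+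
    also have "\<dots> = tensor_lift K N (\<lambda>x h. j (counit H h \<odot>\<^bsub>M\<^esub> x)) (\<rho> x)"
      by (rule tensor_lift_cong[OF rx], (assumption | rule multilinear)+)
        (simp add: linear_map_smult[OF j_linear] H.counit_closed)
    also have "\<dots> = j (tensor_lift K M (\<lambda>x h. counit H h \<odot>\<^bsub>M\<^esub> x) (\<rho> x))"
      by (rule linear_tensor_lift[OF rx, symmetric])
        (assumption | rule M.smult_closed H.counit_closed multilinear)+
    finally show ?thesis by (simp add: y \<rho>N_j x M.coact_counit inv_twist_N)
  qed
qed

lemma relative_hom_Hopf_module_N: "relative_hom_Hopf_module K H A \<rho>A N actN \<rho>N"
proof (intro relative_hom_Hopf_module.intro relative_hom_Hopf_module_axioms.intro
    right_hom_module.intro right_hom_module_axioms.intro hom_object_N right_hom_comodule_N)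
  show "bilinear_map K N A N actN"
    unfolding actN_def[abs_def] by (assumption | rule multilinear)+
next
  fix y a assume "y \<in> carrier N" and a [multilinear]: "a \<in> carrier A"
  then obtain x where x [multilinear]: "x \<in> carrier M" and y: "y = j x" by (metis N_cases)
  show "twist N (actN y a) = actN (twist N y) (twist A a)"
    by (simp add: y actN_j j_twist x a M.act_twist M.twist_closed bilinear_map_closed[OF M.act_bilinear])
  show "\<rho>N (actN y a) = tensor_times K N H actN (mult H) (\<rho>N y) (\<rho>A a)"
  proof -
    let ?T = "tensor_module K N H"
    have jl: "linear_map K (tensor_module K M H) ?T (tensor_map K N H j id)"
      by (rule tensor_map_linear) (rule multilinear j_linear id_linear)+
    have rx: "\<rho> x \<in> carrier (tensor_module K M H)" by (rule multilinear)+
    have "\<rho>N (actN y a) = tensor_map K N H j id (tensor_times K M H act (mult H) (\<rho> x) (\<rho>A a))"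
      by (simp add: y actN_j \<rho>N_j x a M.coact_act bilinear_map_closed[OF M.act_bilinear])
    also have "\<dots> = tensor_lift K ?T (\<lambda>x h. tensor_map K N H j id
        (tensor_lift K (tensor_module K M H) (\<lambda>y k. pure_tensor K M H (act x y) (h \<otimes>\<^bsub>H\<^esub> k)) (\<rho>A a))) (\<rho> x)"
      unfolding tensor_times_def
      by (rule linear_tensor_lift[OF rx]) (assumption | rule multilinear jl)+
    also have "\<dots> = tensor_lift K ?T (\<lambda>x h. tensor_lift K ?T (\<lambda>y k. tensor_map K N H j id
        (pure_tensor K M H (act x y) (h \<otimes>\<^bsub>H\<^esub> k))) (\<rho>A a)) (\<rho> x)"
      by (rule tensor_lift_cong[OF rx], (assumption | rule multilinear)+, rule linear_tensor_lift)
        (assumption | rule multilinear jl)+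
    also have "\<dots> = tensor_lift K ?T (\<lambda>x h. tensor_lift K ?T (\<lambda>y k.
        pure_tensor K N H (actN (j x) y) (id h \<otimes>\<^bsub>H\<^esub> k)) (\<rho>A a)) (\<rho> x)"
      apply (rule tensor_lift_cong[OF rx], (assumption | rule multilinear)+)
      apply (rule tensor_lift_cong, (assumption | rule multilinear)+)
      apply (subst tensor_map_pure, (assumption | rule multilinear j_linear id_linear)+)
      apply (simp add: actN_j)
      done
    also have "\<dots> = tensor_times K N H actN (mult H) (tensor_map K N H j id (\<rho> x)) (\<rho>A a)"
      unfolding tensor_times_def actN_def
      by (rule tensor_lift_map[OF rx, symmetric]) (assumption | simp only: id_apply | rule multilinear)+
    finally show ?thesis by (simp add: y \<rho>N_j x)
  qed
  fix b assume "b \<in> carrier A"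
  then show "actN (actN y a) (twist A b) = actN (twist N y) (a \<otimes>\<^bsub>A\<^esub> b)"
    by (simp add: y actN_j j_twist x a M.act_assoc M.twist_closed bilinear_map_closed[OF M.act_bilinear])
next
  fix y assume "y \<in> carrier N"
  then obtain x where x: "x \<in> carrier M" and y: "y = j x" by (rule N_cases)
  then show "actN y \<one>\<^bsub>A\<^esub> = twist N y"
    by (simp add: actN_j j_twist M.act_unit)
qed

text \<open>Conjugating back preserves colinearity because \<open>\<kappa>\<close> is itself
  twist-compatible and colinear and the induced coaction is natural in j.\<close>

lemma retraction_transport:
  assumes l: "linear_map K (tensor_module K N H) N l"
    and l_twist: "\<And>t. t \<in> carrier (tensor_module K N H) \<Longrightarrow>
      twist N (l t) = l (tensor_map K N H (twist N) (twist H) t)"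
    and l_coact: "\<And>t. t \<in> carrier (tensor_module K N H) \<Longrightarrow>
      \<rho>N (l t) = tensor_map K N H l id (induced_coact K H N t)"
    and l_id: "\<And>y. y \<in> carrier N \<Longrightarrow> l (\<rho>N y) = y"
  defines "g \<equiv> \<lambda>t. \<kappa> (l (tensor_map K N H j id t))"
  shows "linear_map K (tensor_module K M H) M g"
    and "t \<in> carrier (tensor_module K M H) \<Longrightarrow>
      twist M (g t) = g (tensor_map K M H (twist M) (twist H) t)"
    and "t \<in> carrier (tensor_module K M H) \<Longrightarrow>
      \<rho> (g t) = tensor_map K M H g id (induced_coact K H M t)"
    and "m \<in> carrier M \<Longrightarrow> g (\<rho> m) = m"
proof -
  interpret rN: right_hom_comodule K H N \<rho>N by (rule right_hom_comodule_N)
  interpret cN: hom_comodule K H N \<rho>N by unfold_locales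
  have jl: "linear_map K (tensor_module K M H) (tensor_module K N H) (tensor_map K N H j id)"
    by (rule tensor_map_linear) (rule multilinear j_linear id_linear)+
  note [multilinear] = linear_map_comp[OF l] linear_map_comp[OF jl]
    linear_map_closed[OF l] linear_map_closed[OF jl]
  show g: "linear_map K (tensor_module K M H) M g" unfolding g_def by (rule multilinear)+
  have \<kappa>_twist: "twist M (\<kappa> y) = \<kappa> (twist N y)" if "y \<in> carrier N" for y
    using that by (auto elim!: N_cases simp: j_twist inv_j M.twist_closed)
  have \<kappa>_coact: "\<rho> (\<kappa> y) = tensor_map K M H \<kappa> id (\<rho>N y)" if "y \<in> carrier N" for y
  proof -
    from that obtain x where x [multilinear]: "x \<in> carrier M" and y: "y = j x" by (rule N_cases)
    have rx: "\<rho> x \<in> carrier (tensor_module K M H)" by (rule multilinear)+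
    have "tensor_map K M H \<kappa> id (\<rho>N y) = tensor_map K M H (\<lambda>x. \<kappa> (j x)) (\<lambda>h. id (id h)) (\<rho> x)"
      unfolding y \<rho>N_j[OF x]
      by (rule tensor_map_comp[OF rx]) (assumption | simp only: id_apply | rule multilinear \<kappa>_linear id_linear)+
    \<comment> \<open>\<open>\<kappa>\<close> inverts j on the carrier, leaving a tensor product of
      identity maps, which fixes every tensor.\<close>
    also have "\<dots> = tensor_map K M H (\<lambda>x. x) (\<lambda>h. h) (\<rho> x)"
      by (rule tensor_map_cong[OF rx]) (simp add: inv_j | rule multilinear)+
    also have "\<dots> = \<rho> x"
      unfolding tensor_map_def
      by (rule tensor_linear_eq_lift[where g = "\<lambda>x. x", symmetric]) (rule multilinear)+
    finally show ?thesis by (simp add: y inv_j x)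
  qed
  show "twist M (g t) = g (tensor_map K M H (twist M) (twist H) t)"
    if t [multilinear]: "t \<in> carrier (tensor_module K M H)"
  proof -
    have "tensor_map K N H (twist N) (twist H) (tensor_map K N H j id t) =
        tensor_map K N H (\<lambda>x. twist N (j x)) (\<lambda>h. twist H (id h)) t"
      by (rule tensor_map_comp[OF t])
        (assumption | simp only: id_apply | rule multilinear N.twist_linear H.twist_linear)+
    also have "\<dots> = tensor_map K N H (\<lambda>x. j (twist M x)) (\<lambda>h. id (twist H h)) t"
      by (rule tensor_map_cong[OF t]) (simp add: j_twist | rule multilinear)+
    also have "\<dots> = tensor_map K N H j id (tensor_map K M H (twist M) (twist H) t)"
      by (rule tensor_map_comp[OF t, symmetric]) (assumption | rule multilinear j_linear id_linear)+
    finally have eq: "tensor_map K N H (twist N) (twist H) (tensor_map K N H j id t) =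
      tensor_map K N H j id (tensor_map K M H (twist M) (twist H) t)" .
    have "l (tensor_map K N H j id t) \<in> carrier N" "tensor_map K N H j id t \<in> carrier (tensor_module K N H)"
      by (rule multilinear)+
    then show ?thesis by (simp add: g_def \<kappa>_twist l_twist eq)
  qed
  show "\<rho> (g t) = tensor_map K M H g id (induced_coact K H M t)"
    if t [multilinear]: "t \<in> carrier (tensor_module K M H)"
  proof -
    have it: "induced_coact K H M t \<in> carrier (tensor_module K (tensor_module K M H) H)"
      by (rule linear_map_closed[OF M.induced_coact_linear t])
    have c: "l (tensor_map K N H j id t) \<in> carrier N" "tensor_map K N H j id t \<in> carrier (tensor_module K N H)"
      by (rule multilinear)+
    have "\<rho> (g t) = tensor_map K M H \<kappa> id (tensor_map K N H l id (induced_coact K H N (tensor_map K N H j id t)))"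
      using c by (simp add: g_def \<kappa>_coact l_coact)
    also have "induced_coact K H N (tensor_map K N H j id t) =
        tensor_map K (tensor_module K N H) H (tensor_map K N H j id) id (induced_coact K H M t)"
      by (rule induced_coact_natural[OF M.hom_comodule_axioms cN.hom_comodule_axioms j_linear j_twist t])
    also have "tensor_map K N H l id \<dots> =
        tensor_map K N H (\<lambda>t. l (tensor_map K N H j id t)) (\<lambda>h. id (id h)) (induced_coact K H M t)"
      by (rule tensor_map_comp[OF it]) (assumption | simp only: id_apply | rule multilinear l id_linear)+
    also have "tensor_map K M H \<kappa> id \<dots> = tensor_map K M H g (\<lambda>h. id (id (id h))) (induced_coact K H M t)"
      unfolding g_def
      by (rule tensor_map_comp[OF it]) (assumption | simp only: id_apply | rule multilinear \<kappa>_linear id_linear)+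
    finally show ?thesis by (simp add: id_def)
  qed
  show "g (\<rho> m) = m" if "m \<in> carrier M"
    using that by (simp add: g_def \<rho>N_j[symmetric] l_id linear_map_closed[OF j_linear] inv_j)
qed

end

section \<open>The equivalence\<close>

lemma hom_tensor_simps [simp]:
  "carrier (hom_tensor K M N) = carrier (tensor_module K M N)"
  "add (hom_tensor K M N) = add (tensor_module K M N)"
  "smult (hom_tensor K M N) = smult (tensor_module K M N)"
  "twist (hom_tensor K M N) = tensor_map K M N (twist M) (twist N)"
  by (simp_all add: hom_tensor_def module.defs hom_object.defs)

text \<open>Comodule morphisms out of G(M) depend only on its twist and coaction, so
  \<open>act\<close> and \<open>\<rho>A\<close> disappear. This links the categorical notions with
  the equations proved above.\<close>

lemma comodule_morphisms_induced_iff: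
  "l \<in> comodule_morphisms K H (forget_action (induced K H \<rho>A (M, act))) (M, \<rho>) \<longleftrightarrow>
    linear_map K (tensor_module K M H) M l \<and>
    (\<forall>t\<in>carrier (tensor_module K M H). twist M (l t) = l (tensor_map K M H (twist M) (twist H) t)) \<and>
    (\<forall>t\<in>carrier (tensor_module K M H). \<rho> (l t) = tensor_map K M H l id (induced_coact K H M t))"
  by (simp add: hom_morphisms_def linear_map_def induced_coact_def)

context
  fixes K :: "('k, 'r) ring_scheme" and H :: "('k, 'h) hom_bialgebra"
    and A :: "('k, 'a) hom_object" and \<rho>A :: "'a \<Rightarrow> ('k, 'a, 'h) tensor"
  assumes H: "monoidal_hom_Hopf_algebra K H" and A: "right_hom_comodule_algebra K H A \<rho>A"
begin

lemma hom_relativeI: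
  "relative_hom_Hopf_module K H A \<rho>A M act \<rho> \<Longrightarrow> hom_relative K H A \<rho>A M act \<rho>"
  by (intro hom_relative.intro H A)

lemma hom_relative_integralI:
  assumes "relative_hom_Hopf_module K H A \<rho>A M act \<rho>" "antipode K H S" "total_integral K H A \<rho>A \<phi>"
  shows "hom_relative_integral K H A \<rho>A M act \<rho> S \<phi>"
  using assms by (intro hom_relative_integral.intro hom_relative_antipode.intro hom_relativeI
      hom_relative_antipode_axioms.intro hom_relative_integral_axioms.intro)

lemma naturally_split_of_integral:
  assumes \<phi>: "total_integral K H A \<rho>A \<phi>"
  shows "naturally_split TYPE('m) K H A \<rho>A"
proof -
  \<comment> \<open>One antipode is fixed for all modules, since naturality compares components that
    must be built from the same S and \<phi>.\<close>
  obtain S where S: "antipode K H S"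
    using monoidal_hom_Hopf_algebra.antipode_exists[OF H] by blast
  define l :: "('k, 'a, 'h, 'm) Hrel \<Rightarrow> ('k, 'm, 'h) tensor \<Rightarrow> 'm"
    where "l = (\<lambda>(M, act, \<rho>). integral_retraction K H S \<phi> M act \<rho>)"
  note integral = hom_relative_integralI[OF _ S \<phi>]
  have "natural_coaction_retraction K H A \<rho>A l"
    unfolding natural_coaction_retraction_def natural_transformation_def
  proof (intro conjI ballI)
    fix X assume "X \<in> (relative_Hopf_modules K H A \<rho>A :: ('k, 'a, 'h, 'm) Hrel set)"
    then obtain M act \<rho> where X: "X = (M, act, \<rho>)" "relative_hom_Hopf_module K H A \<rho>A M act \<rho>"
      by (auto simp: relative_Hopf_modules_def)
    interpret X: hom_relative_integral K H A \<rho>A M act \<rho> S \<phi> by (rule integral[OF X(2)])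
    show "l X \<in> comodule_morphisms K H (forget_action (induced K H \<rho>A (forget_coaction X))) (forget_action X)"
      unfolding X l_def forget_coaction.simps forget_action.simps(1)[of M act \<rho>] prod.case
        comodule_morphisms_induced_iff
      using X.retraction_linear X.retraction_twist X.retraction_colinear by blast
    show "case X of (M, act, \<rho>) \<Rightarrow> \<forall>m\<in>carrier M. l (M, act, \<rho>) (\<rho> m) = m"
      by (simp add: X l_def X.retraction_coact)
    fix Y f x assume "Y \<in> (relative_Hopf_modules K H A \<rho>A :: ('k, 'a, 'h, 'm) Hrel set)"
      and f: "f \<in> relative_Hopf_morphisms K H A X Y"
      and x: "x \<in> carrier (fst (forget_action (induced K H \<rho>A (forget_coaction X))))"
    then obtain N act' \<rho>' where Y: "Y = (N, act', \<rho>')" "relative_hom_Hopf_module K H A \<rho>A N act' \<rho>'"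
      by (auto simp: relative_Hopf_modules_def)
    show "l Y (induced_map K H (forget_coaction Y) f x) = f (l X x)"
      using f x unfolding X Y l_def induced_map_def
      by (auto simp: relative_Hopf_morphisms_def hom_morphisms_def
          intro!: retraction_natural[OF integral[OF X(2)] integral[OF Y(2)]])
  qed
  then show ?thesis unfolding naturally_split_def by blast
qed

text \<open>Statement (2) is specialized to the copy of A on 'm, with A acting on it by right
  multiplication; conjugating that component back gives the map required by (3).\<close>

lemma coaction_split_of_naturally_split:
  fixes \<iota> :: "'a \<Rightarrow> 'm"
  assumes \<iota>: "inj_on \<iota> (carrier A)" and split: "naturally_split TYPE('m) K H A \<rho>A"
  shows "coaction_split K H A \<rho>A"
proof -
  obtain l :: "('k, 'a, 'h, 'm) Hrel \<Rightarrow> ('k, 'm, 'h) tensor \<Rightarrow> 'm"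
    where l: "natural_coaction_retraction K H A \<rho>A l"
    using split unfolding naturally_split_def by blast
  interpret T: hom_relative_transport K H A \<rho>A A "mult A" \<rho>A \<iota>
    by (intro hom_relative_transport.intro hom_relative_transport_axioms.intro hom_relativeI \<iota>
        right_hom_comodule_algebra.relative_self A)
  let ?X = "(T.N, T.actN, T.\<rho>N)"
  have X: "?X \<in> relative_Hopf_modules K H A \<rho>A"
    using T.relative_hom_Hopf_module_N by (simp add: relative_Hopf_modules_def)
  have "l ?X \<in> comodule_morphisms K H (forget_action (induced K H \<rho>A (T.N, T.actN))) (T.N, T.\<rho>N)"
    using l X unfolding natural_coaction_retraction_def natural_transformation_def by fastforce
  moreover have "\<forall>y\<in>carrier T.N. l ?X (T.\<rho>N y) = y"
    using l X unfolding natural_coaction_retraction_def by fastforce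
  moreover define g where "g = (\<lambda>t. T.\<kappa> (l ?X (tensor_map K T.N H \<iota> id t)))"
  ultimately have "g \<in> comodule_morphisms K H (forget_action (induced K H \<rho>A (A, mult A))) (A, \<rho>A)"
    and "\<forall>a\<in>carrier A. g (\<rho>A a) = a"
    using T.retraction_transport[of "l ?X"] unfolding comodule_morphisms_induced_iff by simp_all
  then show ?thesis
    unfolding coaction_split_def by blast
qed

lemma integral_of_coaction_split:
  assumes "coaction_split K H A \<rho>A"
  shows "\<exists>\<phi>. total_integral K H A \<rho>A \<phi>"
proof -
  interpret hom_relative K H A \<rho>A A "mult A" \<rho>A
    by (intro hom_relativeI right_hom_comodule_algebra.relative_self A)
  obtain l where "l \<in> comodule_morphisms K H (forget_action (induced K H \<rho>A (A, mult A))) (A, \<rho>A)"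
    and "\<forall>a\<in>carrier A. l (\<rho>A a) = a"
    using assms unfolding coaction_split_def by blast
  then have "total_integral K H A \<rho>A (\<lambda>h. l (pure_tensor K A H \<one>\<^bsub>A\<^esub> (inv_twist H h)))"
    unfolding comodule_morphisms_induced_iff by (intro total_integral_of_retraction) simp_all
  then show ?thesis by blast
qed

lemma injective_of_integral:
  assumes \<phi>: "total_integral K H A \<rho>A \<phi>"
    and V: "V \<in> (relative_Hopf_modules K H A \<rho>A :: ('k, 'a, 'h, 'n) Hrel set)"
  shows "injective_comodule TYPE('x) TYPE('y) K H (forget_action V)"
  unfolding injective_comodule_def
proof (intro ballI impI)
  obtain S where S: "antipode K H S"
    using monoidal_hom_Hopf_algebra.antipode_exists[OF H] by blast
  from V obtain M act \<rho> where M: "V = (M, act, \<rho>)" "relative_hom_Hopf_module K H A \<rho>A M act \<rho>"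
    by (auto simp: relative_Hopf_modules_def)
  interpret M: hom_relative_integral K H A \<rho>A M act \<rho> S \<phi>
    by (rule hom_relative_integralI[OF M(2) S \<phi>])
  fix X' Y' i f
  assume "X' \<in> (comodules K H :: ('k, 'h, 'x) Hcomod set)" "Y' \<in> (comodules K H :: ('k, 'h, 'y) Hcomod set)"
    and i: "i \<in> comodule_morphisms K H X' Y'"
    and "\<exists>p\<in>hom_morphisms K (fst Y') (fst X'). \<forall>x\<in>carrier (fst X'). p (i x) = x"
    and f: "f \<in> comodule_morphisms K H X' (forget_action V)"
  then obtain X \<rho>X Y \<rho>Y p where X: "X' = (X, \<rho>X)" "right_hom_comodule K H X \<rho>X"
    and Y: "Y' = (Y, \<rho>Y)" "right_hom_comodule K H Y \<rho>Y"
    and p: "p \<in> hom_morphisms K Y X" "\<forall>x\<in>carrier X. p (i x) = x"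
    by (auto simp: comodules_def)
  let ?g = "\<lambda>y. M.\<Lambda> (tensor_map K M H (\<lambda>y. f (p y)) id (\<rho>Y y))"
  note ext = M.retraction_extend[OF X(2) Y(2), of i p f]
  have "?g \<in> comodule_morphisms K H Y' (forget_action V)"
    using i p f ext(1-3) by (simp add: X Y M hom_morphisms_def)
  moreover have "?g (i x) = f x" if "x \<in> carrier X" for x
    using i p f ext(4) that by (simp add: X Y M hom_morphisms_def)
  ultimately show "\<exists>g\<in>comodule_morphisms K H Y' (forget_action V). \<forall>x\<in>carrier (fst X'). g (i x) = f x"
    unfolding X(1) fst_conv by (intro bexI[where x = ?g] ballI)
qed

end

text \<open>The implications run in the cycle (1), (2), (3), (1). Injectivity is derived from (1),
  which mentions no type of modules; hence 'n, 'x and 'y are independent of 'm.\<close>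

theorem theorem4p3:
  fixes K :: "('k, 'r) ring_scheme"
    and H :: "('k, 'h) hom_bialgebra"
    and A :: "('k, 'a) hom_object"
    and \<rho>A :: "'a \<Rightarrow> ('k, 'a, 'h) tensor"
    and \<iota> :: "'a \<Rightarrow> 'm"
  assumes "monoidal_hom_Hopf_algebra K H"
    and "right_hom_comodule_algebra K H A \<rho>A"
    \<comment> \<open>the universe \<open>'m\<close> of modules is large enough to contain a copy of \<open>A\<close>\<close>
    and "inj_on \<iota> (carrier A)"
  shows "((\<exists>\<phi>. total_integral K H A \<rho>A \<phi>) \<longleftrightarrow> naturally_split TYPE('m) K H A \<rho>A) \<and>
    (naturally_split TYPE('m) K H A \<rho>A \<longleftrightarrow> coaction_split K H A \<rho>A) \<and>
    ((\<exists>\<phi>. total_integral K H A \<rho>A \<phi>) \<or> naturally_split TYPE('m) K H A \<rho>A \<or>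
        coaction_split K H A \<rho>A \<longrightarrow>
      (\<forall>M \<in> (relative_Hopf_modules K H A \<rho>A :: ('k, 'a, 'h, 'n) Hrel set).
        injective_comodule TYPE('x) TYPE('y) K H (forget_action M)))"
  using naturally_split_of_integral[OF assms(1,2), where 'm = 'm]
    coaction_split_of_naturally_split[OF assms] integral_of_coaction_split[OF assms(1,2)]
    injective_of_integral[OF assms(1,2), where 'n = 'n and 'x = 'x and 'y = 'y]
  by blast

end
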